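(* Suppose $X$ possesses a first positive element $\chi_1$. Let $\mu$ be a generalized semi-character of $X_+$ and $a:X_+\setminus\{\chi_0\}\to\mathbb{C}$ a function such that the $\mu$-Hankel operator $A=A_{\mu,a}:H^2(G)\to H^2_-(G)$ is bounded and $|\mu(\chi_1)|>1$. Then $$A=\sum_{n=1}^\infty\left(\frac{1}{\mu(\chi_1)}\right)^{n-1}\overline{\chi_1}^{\,n}\otimes\psi_n,\qquad(1)$$ where $(\psi_n)_{n\ge1}$ is a sequence of functions from $H^2(G)$ with Fourier coefficients $$\langle\psi_n,\chi\rangle=\overline{\mu(\chi_1^{n-1}\chi)\,a(\chi_1^n\chi)}\quad\forall n\in\mathbb{N},\ \chi\in X_+,\qquad(2)$$ that is uniformly bounded in norm. Moreover, $\mathrm{Im}\,A\subset H^2(\overline{\chi_1})$, the function $a$ is supported in $X_+^i\setminus\{\chi_0\}$, the operator $A$ is nuclear, and its norm satisfies $\|A\|\le|\mu(\chi_1)|\,\|\psi_1\|/(|\mu(\chi_1)|-1)$. Conversely, if a sequence $(\psi_n)_{n\ge1}$ in $H^2(G)$ is uniformly bounded in norm, and (2) holds with some generalized semi-character $\mu\in\mathrm{Hom}(X_+,\mathbb{C})$, $|\mu(\chi_1)|>1$, and some function $a$ supported in $X_+^i\setminus\{\chi_0\}$, then each operator $A$ of the form (1) is nuclear and equals $A_{\mu,a}$.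
   Context: $G$ is a compact connected Abelian group with normalized Haar measure, $X$ is its (discrete, multiplicatively written) dual group of continuous characters, viewed as functions on $G$, and a total order compatible with the group structure is fixed on $X$. $\chi_0\equiv 1$ is the unit character, $X_+=\{\chi\in X:\chi\ge\chi_0\}$ and $X_-=X\setminus X_+=\{\overline{\xi}:\xi\in X_+\setminus\{\chi_0\}\}$, where the bar is complex conjugation (so $\overline{\xi}=\xi^{-1}$). $H^2(G)=\{f\in L^2(G):\widehat f(\chi)=0\ \forall\chi\in X_-\}$, where $\widehat f$ is the Fourier transform, and $H^2_-(G)=L^2(G)\ominus H^2(G)$; $X_+$ and $X_-$ are orthonormal bases of $H^2(G)$ and $H^2_-(G)$ respectively. $\langle\cdot,\cdot\rangle$ and $\|\cdot\|$ are the inner product and norm of $L^2(G)$ (and $\|\cdot\|$ also denotes the operator norm). A first positive element $\chi_1$ is a least element of $X_+\setminus\{\chi_0\}$; $\chi_1^0:=\chi_0$; $X_+^i=\{\chi_1^n:n\in\mathbb{Z}_+\}$, $\mathbb{Z}_+=\{0,1,2,\dots\}$, $\mathbb{N}=\{1,2,\dots\}$. $H^2(\overline{\chi_1})$ is the Hilbert subspace of $H^2_-(G)$ with orthonormal basis $\{\overline{\chi_1}^{\,n}:n\in\mathbb{N}\}$. $\mathrm{Im}\,A$ is the image of $A$. For $y\in H_1$, $f\in H_2$ ($H_1,H_2$ Hilbert spaces), $f\otimes y:H_1\to H_2$ is the rank-one operator $(f\otimes y)x=\langle x,y\rangle f$. Series of operators converge in operator norm. A generalized semi-character of $X_+$ is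 a non-null (not identically zero) homomorphism $\mu$ of the semigroup $X_+$ into the multiplicative semigroup $\mathbb{C}$. Given such $\mu$ and $a:X_+\setminus\{\chi_0\}\to\mathbb{C}$, a $\mu$-Hankel operator $A_{\mu,a}$ is a linear operator from $H^2(G)$ to $H^2_-(G)$, defined at least on $\mathrm{span}(X_+)$, such that $\langle A_{\mu,a}\chi,\overline{\xi}\rangle=\mu(\chi)a(\chi\xi)$ for all $\chi\in X_+$, $\xi\in X_+\setminus\{\chi_0\}$; it is called bounded if it is a bounded operator on all of $H^2(G)$. *)

theory Defs
  imports "HOL-Analysis.Analysis" "HOL-Library.Function_Algebras"
begin

text \<open>
  The group is the whole of an additively written type of class
  \<open>{topological_ab_group_add, t2_space}\<close>; compactness and connectedness are assumptions on
  \<open>UNIV\<close>. Characters are complex functions on it, multiplied pointwise, so \<open>1\<close> is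
  the unit character and \<open>cnj \<circ> \<phi>\<close> is the inverse of \<open>\<phi>\<close>.
\<close>

text \<open>
  Without a countable base, a translation-invariant Borel probability measure need not be regular;
  inner regularity is part of what makes it the Haar measure.
\<close>

definition normalized_haar :: "'g::{topological_ab_group_add,t2_space} measure \<Rightarrow> bool" where
  "normalized_haar M \<longleftrightarrow>
     sets M = sets borel \<and>
     emeasure M UNIV = 1 \<and>
     (\<forall>x. distr M borel (\<lambda>y. x + y) = M) \<and>
     (\<forall>B\<in>sets borel. emeasure M B = (SUP K\<in>{K. compact K \<and> K \<subseteq> B}. emeasure M K))"

definition characters :: "('g::{topological_ab_group_add,t2_space} \<Rightarrow> complex) set" where
  "characters = {\<phi>. continuous_on UNIV \<phi> \<and> (\<forall>x y. \<phi> (x + y) = \<phi> x * \<phi> y) \<and> (\<forall>x. cmod (\<phi> x) = 1)}"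

text \<open>\<open>(\<phi>, \<xi>) \<in> r\<close> means \<open>\<phi> \<le> \<xi>\<close>.\<close>

definition dual_order :: "('g::{topological_ab_group_add,t2_space} \<Rightarrow> complex) rel \<Rightarrow> bool" where
  "dual_order r \<longleftrightarrow>
     linear_order_on characters r \<and>
     (\<forall>\<phi> \<xi>. \<forall>\<eta>\<in>characters. (\<phi>, \<xi>) \<in> r \<longrightarrow> (\<phi> * \<eta>, \<xi> * \<eta>) \<in> r)"

definition Xplus :: "('g::{topological_ab_group_add,t2_space} \<Rightarrow> complex) rel \<Rightarrow> ('g \<Rightarrow> complex) set" where
  "Xplus r = {\<phi>\<in>characters. (1, \<phi>) \<in> r}"

definition Xminus :: "('g::{topological_ab_group_add,t2_space} \<Rightarrow> complex) rel \<Rightarrow> ('g \<Rightarrow> complex) set" where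
  "Xminus r = characters - Xplus r"

definition first_positive ::
  "('g::{topological_ab_group_add,t2_space} \<Rightarrow> complex) rel \<Rightarrow> ('g \<Rightarrow> complex) \<Rightarrow> bool" where
  "first_positive r \<phi>1 \<longleftrightarrow> \<phi>1 \<in> Xplus r - {1} \<and> (\<forall>\<xi>\<in>Xplus r - {1}. (\<phi>1, \<xi>) \<in> r)"

text \<open>
  Elements of the space \<open>L\<^sup>2\<close> are represented by square-integrable functions; equality in
  \<open>L\<^sup>2\<close> is equality almost everywhere.
\<close>

definition L2 :: "'g::topological_space measure \<Rightarrow> ('g \<Rightarrow> complex) set" where
  "L2 M = {f \<in> borel_measurable M. integrable M (\<lambda>x. (cmod (f x))\<^sup>2)}"

definition l2_inner :: "'g measure \<Rightarrow> ('g \<Rightarrow> complex) \<Rightarrow> ('g \<Rightarrow> complex) \<Rightarrow> complex" where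
  "l2_inner M f g = (LINT x|M. f x * cnj (g x))"

definition l2_norm :: "'g measure \<Rightarrow> ('g \<Rightarrow> complex) \<Rightarrow> real" where
  "l2_norm M f = sqrt (LINT x|M. (cmod (f x))\<^sup>2)"

definition fourier :: "'g measure \<Rightarrow> ('g \<Rightarrow> complex) \<Rightarrow> ('g \<Rightarrow> complex) \<Rightarrow> complex" where
  "fourier M f \<phi> = (LINT x|M. f x * cnj (\<phi> x))"

definition H2 :: "'g::{topological_ab_group_add,t2_space} measure \<Rightarrow> ('g \<Rightarrow> complex) rel \<Rightarrow> ('g \<Rightarrow> complex) set" where
  "H2 M r = {f \<in> L2 M. \<forall>\<phi>\<in>Xminus r. fourier M f \<phi> = 0}"

definition H2minus :: "'g::{topological_ab_group_add,t2_space} measure \<Rightarrow> ('g \<Rightarrow> complex) rel \<Rightarrow> ('g \<Rightarrow> complex) set" where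
  "H2minus M r = {f \<in> L2 M. \<forall>h\<in>H2 M r. l2_inner M f h = 0}"

definition cscale :: "complex \<Rightarrow> ('g \<Rightarrow> complex) \<Rightarrow> 'g \<Rightarrow> complex" where
  "cscale c f = (\<lambda>x. c * f x)"

interpretation cfun: vector_space cscale
  by standard (auto simp: cscale_def fun_eq_iff algebra_simps)

definition closed_span :: "'g::topological_space measure \<Rightarrow> ('g \<Rightarrow> complex) set \<Rightarrow> ('g \<Rightarrow> complex) set" where
  "closed_span M S = {f \<in> L2 M. \<forall>e>0. \<exists>g\<in>cfun.span S. l2_norm M (f - g) < e}"

definition H2_cnj :: "'g::topological_space measure \<Rightarrow> ('g \<Rightarrow> complex) \<Rightarrow> ('g \<Rightarrow> complex) set" where
  "H2_cnj M \<phi>1 = closed_span M {(cnj \<circ> \<phi>1) ^ n | n. n \<ge> 1}"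

text \<open>
  Operators act on representatives: they have to respect equality almost everywhere, and are
  linear up to it. Their values outside the domain \<open>U\<close> are irrelevant.
\<close>

definition linear_op ::
  "'g measure \<Rightarrow> ('g \<Rightarrow> complex) set \<Rightarrow> ('g \<Rightarrow> complex) set \<Rightarrow> (('g \<Rightarrow> complex) \<Rightarrow> 'g \<Rightarrow> complex) \<Rightarrow> bool" where
  "linear_op M U V A \<longleftrightarrow>
     (\<forall>f\<in>U. A f \<in> V) \<and>
     (\<forall>f\<in>U. \<forall>g\<in>U. (AE x in M. f x = g x) \<longrightarrow> (AE x in M. A f x = A g x)) \<and>
     (\<forall>f\<in>U. \<forall>g\<in>U. AE x in M. A (f + g) x = A f x + A g x) \<and>
     (\<forall>c. \<forall>f\<in>U. AE x in M. A (cscale c f) x = c * A f x)"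

definition bounded_op ::
  "'g measure \<Rightarrow> ('g \<Rightarrow> complex) set \<Rightarrow> ('g \<Rightarrow> complex) set \<Rightarrow> (('g \<Rightarrow> complex) \<Rightarrow> 'g \<Rightarrow> complex) \<Rightarrow> bool" where
  "bounded_op M U V A \<longleftrightarrow> linear_op M U V A \<and> (\<exists>C. \<forall>f\<in>U. l2_norm M (A f) \<le> C * l2_norm M f)"

text \<open>The real supremum is the operator norm only for bounded operators; it is used for no others.\<close>

definition op_norm ::
  "'g measure \<Rightarrow> ('g \<Rightarrow> complex) set \<Rightarrow> (('g \<Rightarrow> complex) \<Rightarrow> 'g \<Rightarrow> complex) \<Rightarrow> real" where
  "op_norm M U A = (SUP f\<in>{f\<in>U. l2_norm M f \<le> 1}. l2_norm M (A f))"

definition rank_one ::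
  "'g measure \<Rightarrow> ('g \<Rightarrow> complex) \<Rightarrow> ('g \<Rightarrow> complex) \<Rightarrow> ('g \<Rightarrow> complex) \<Rightarrow> 'g \<Rightarrow> complex" where
  "rank_one M f y = (\<lambda>x. cscale (l2_inner M x y) f)"

text \<open>\<open>A = (\<Sum>n\<ge>1. T n)\<close>, with convergence in operator norm; \<open>T 0\<close> is not used.\<close>

definition op_sums ::
  "'g measure \<Rightarrow> ('g \<Rightarrow> complex) set \<Rightarrow> (nat \<Rightarrow> ('g \<Rightarrow> complex) \<Rightarrow> 'g \<Rightarrow> complex) \<Rightarrow>
     (('g \<Rightarrow> complex) \<Rightarrow> 'g \<Rightarrow> complex) \<Rightarrow> bool" where
  "op_sums M U T A \<longleftrightarrow> (\<lambda>N. op_norm M U (\<lambda>f. A f - (\<Sum>n=1..N. T n f))) \<longlonglongrightarrow> 0"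

definition nuclear_op ::
  "'g measure \<Rightarrow> ('g \<Rightarrow> complex) set \<Rightarrow> ('g \<Rightarrow> complex) set \<Rightarrow> (('g \<Rightarrow> complex) \<Rightarrow> 'g \<Rightarrow> complex) \<Rightarrow> bool" where
  "nuclear_op M U V A \<longleftrightarrow>
     bounded_op M U V A \<and>
     (\<exists>v u. (\<forall>n. v n \<in> V \<and> u n \<in> U) \<and>
        summable (\<lambda>n. l2_norm M (v n) * l2_norm M (u n)) \<and>
        op_sums M U (\<lambda>n. rank_one M (v n) (u n)) A)"

text \<open>Only the values of \<open>\<mu>\<close> on \<open>Xplus r\<close> and of \<open>a\<close> on \<open>Xplus r - {1}\<close> matter.\<close>

definition semi_character ::
  "('g::{topological_ab_group_add,t2_space} \<Rightarrow> complex) rel \<Rightarrow> (('g \<Rightarrow> complex) \<Rightarrow> complex) \<Rightarrow> bool" where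
  "semi_character r \<mu> \<longleftrightarrow>
     (\<forall>\<phi>\<in>Xplus r. \<forall>\<xi>\<in>Xplus r. \<mu> (\<phi> * \<xi>) = \<mu> \<phi> * \<mu> \<xi>) \<and> (\<exists>\<phi>\<in>Xplus r. \<mu> \<phi> \<noteq> 0)"

definition mu_Hankel ::
  "'g::{topological_ab_group_add,t2_space} measure \<Rightarrow> ('g \<Rightarrow> complex) rel \<Rightarrow>
     (('g \<Rightarrow> complex) \<Rightarrow> complex) \<Rightarrow> (('g \<Rightarrow> complex) \<Rightarrow> complex) \<Rightarrow>
     ('g \<Rightarrow> complex) set \<Rightarrow> (('g \<Rightarrow> complex) \<Rightarrow> 'g \<Rightarrow> complex) \<Rightarrow> bool" where
  "mu_Hankel M r \<mu> a D A \<longleftrightarrow>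
     cfun.subspace D \<and> cfun.span (Xplus r) \<subseteq> D \<and> D \<subseteq> H2 M r \<and>
     linear_op M D (H2minus M r) A \<and>
     (\<forall>\<phi>\<in>Xplus r. \<forall>\<xi>\<in>Xplus r - {1}. l2_inner M (A \<phi>) (cnj \<circ> \<xi>) = \<mu> \<phi> * a (\<phi> * \<xi>))"

definition bounded_mu_Hankel ::
  "'g::{topological_ab_group_add,t2_space} measure \<Rightarrow> ('g \<Rightarrow> complex) rel \<Rightarrow>
     (('g \<Rightarrow> complex) \<Rightarrow> complex) \<Rightarrow> (('g \<Rightarrow> complex) \<Rightarrow> complex) \<Rightarrow>
     (('g \<Rightarrow> complex) \<Rightarrow> 'g \<Rightarrow> complex) \<Rightarrow> bool" where
  "bounded_mu_Hankel M r \<mu> a A \<longleftrightarrow>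
     mu_Hankel M r \<mu> a (H2 M r) A \<and> bounded_op M (H2 M r) (H2minus M r) A"

definition supported_in_powers ::
  "('g::{topological_ab_group_add,t2_space} \<Rightarrow> complex) rel \<Rightarrow> ('g \<Rightarrow> complex) \<Rightarrow>
     (('g \<Rightarrow> complex) \<Rightarrow> complex) \<Rightarrow> bool" where
  "supported_in_powers r \<phi>1 a \<longleftrightarrow>
     {\<phi>\<in>Xplus r - {1}. a \<phi> \<noteq> 0} \<subseteq> range (\<lambda>n::nat. \<phi>1 ^ n) - {1}"

definition series_term ::
  "'g measure \<Rightarrow> (('g \<Rightarrow> complex) \<Rightarrow> complex) \<Rightarrow> ('g \<Rightarrow> complex) \<Rightarrow> (nat \<Rightarrow> 'g \<Rightarrow> complex) \<Rightarrow>
     nat \<Rightarrow> ('g \<Rightarrow> complex) \<Rightarrow> 'g \<Rightarrow> complex" where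
  "series_term M \<mu> \<phi>1 \<psi> n =
     (\<lambda>f. cscale ((1 / \<mu> \<phi>1) ^ (n - 1)) (rank_one M ((cnj \<circ> \<phi>1) ^ n) (\<psi> n) f))"

definition has_coefficients ::
  "'g::{topological_ab_group_add,t2_space} measure \<Rightarrow> ('g \<Rightarrow> complex) rel \<Rightarrow>
     (('g \<Rightarrow> complex) \<Rightarrow> complex) \<Rightarrow> (('g \<Rightarrow> complex) \<Rightarrow> complex) \<Rightarrow> ('g \<Rightarrow> complex) \<Rightarrow>
     (nat \<Rightarrow> 'g \<Rightarrow> complex) \<Rightarrow> bool" where
  "has_coefficients M r \<mu> a \<phi>1 \<psi> \<longleftrightarrow>
     (\<forall>n\<ge>1. \<forall>\<phi>\<in>Xplus r. l2_inner M (\<psi> n) \<phi> = cnj (\<mu> (\<phi>1 ^ (n - 1) * \<phi>) * a (\<phi>1 ^ n * \<phi>)))"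

definition bounded_H2_sequence ::
  "'g::{topological_ab_group_add,t2_space} measure \<Rightarrow> ('g \<Rightarrow> complex) rel \<Rightarrow>
     (nat \<Rightarrow> 'g \<Rightarrow> complex) \<Rightarrow> bool" where
  "bounded_H2_sequence M r \<psi> \<longleftrightarrow> (\<forall>n\<ge>1. \<psi> n \<in> H2 M r) \<and> (\<exists>C. \<forall>n\<ge>1. l2_norm M (\<psi> n) \<le> C)"

end

theory Submission
  imports Defs
begin

text \<open>
  Write \<open>m = \<mu> \<phi>1\<close>, where \<open>\<phi>1\<close> is the first positive character. A positive character \<open>\<xi>\<close> that is not a
  power of \<open>\<phi>1\<close> lies above all powers of \<open>\<phi>1\<close>, because dividing it by \<open>\<phi>1\<close> leaves a positive character
  again (\<open>nonpower_divided_Xplus\<close>). So \<open>m ^ n * a \<xi>\<close> is a matrix entry of \<open>A\<close> for every \<open>n\<close>, and as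
  these entries are bounded and \<open>\<bar>m\<bar> > 1\<close>, \<open>a \<xi> = 0\<close> (\<open>bounded_mu_Hankel_supported\<close>). Hence the range of \<open>A\<close> only
  involves the powers of the conjugate of \<open>\<phi>1\<close>, and the Fourier expansion of \<open>A f\<close> in these powers
  is the asserted series: up to the scalar \<open>m ^ (n - 1)\<close>, the function \<open>\<psi> n\<close> represents the
  functional that takes \<open>f\<close> to the coefficient of \<open>A f\<close> at the \<open>n\<close>-th power. The coefficients of
  \<open>\<psi> n\<close> are those of \<open>\<psi> 1\<close>, shifted, so the norms of all \<open>\<psi> n\<close> are at most that of \<open>\<psi> 1\<close>. The
  factors \<open>(1 / m) ^ (n - 1)\<close> make the series of rank-one operators converge like a geometric series,
  which gives convergence in operator norm, nuclearity and the estimate of the norm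
  (\<open>hankel_series_tail\<close>). Conversely, the coefficients of the \<open>\<psi> n\<close> are exactly those for which the
  sum of the series has the matrix entries of a \<open>\<mu>\<close>-Hankel operator.
  
  Two facts from analysis carry this argument. The space \<open>L\<^sup>2\<close> is complete (\<open>L2_complete\<close>), so that
  the functions \<open>\<psi> n\<close> exist. And the characters are total in \<open>L\<^sup>2\<close> (\<open>trig_poly_dense_L2\<close>), so that
  an operator which is given only by its entries on characters is determined on the whole Hardy
  space; by the order, the positive characters are then total in the Hardy space
  (\<open>span_Xplus_dense_H2\<close>).
  
  Totality of the characters is the Peter--Weyl theorem for a compact abelian group. Its proof starts
  from convolution with a Hermitian kernel, which is a compact self-adjoint operator on continuous
  functions. On every nonzero closed ideal \<open>V\<close> of the convolution algebra some such operator does not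
  vanish, and it has an eigenvector in \<open>V\<close> for a nonzero eigenvalue; the eigenspace is finite-dimensional and
  an ideal, as convolutions commute. In an ideal of minimal dimension all convolutions act as scalars,
  so all translations do, and such an ideal is spanned by a character. Thus every nonzero closed
  ideal contains a character (\<open>nonzero_convolution_module_has_character\<close>). Applied to the ideal of
  functions orthogonal to all characters, this shows that the characters separate points, and the
  Stone--Weierstrass theorem and the regularity of the Haar measure give density in \<open>L\<^sup>2\<close>.
\<close>

section \<open>Inner products of square-integrable functions\<close>

lemma sum_fun_apply: "(\<Sum>i\<in>I. f i) x = (\<Sum>i\<in>I. (f i x :: 'b::comm_monoid_add))"
  by (induct I rule: infinite_finite_induct) simp_all

lemma L2D:
  assumes "f \<in> L2 M"
  shows "f \<in> borel_measurable M" "integrable M (\<lambda>x. (cmod (f x))\<^sup>2)"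
  using assms by (auto simp: L2_def)

lemma two_mult_le_sum_squares: "a * b \<le> a\<^sup>2 + (b::real)\<^sup>2"
proof -
  have "0 \<le> (a - b)\<^sup>2" "0 \<le> (a + b)\<^sup>2"
    by auto
  then show ?thesis
    by (auto simp: power2_eq_square algebra_simps)
qed

lemma L2_integrable_mult_cnj:
  assumes "f \<in> L2 M" "g \<in> L2 M"
  shows "integrable M (\<lambda>x. f x * cnj (g x))"
proof (rule Bochner_Integration.integrable_bound)
  show "integrable M (\<lambda>x. (cmod (f x))\<^sup>2 + (cmod (g x))\<^sup>2)"
    using assms by (auto simp: L2_def)
  show "(\<lambda>x. f x * cnj (g x)) \<in> borel_measurable M"
    using L2D(1)[OF assms(1)] L2D(1)[OF assms(2)] continuous_on_cnj[OF continuous_on_id]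
    by (intro borel_measurable_times borel_measurable_continuous_on[of cnj])
  show "AE x in M. norm (f x * cnj (g x)) \<le> norm ((cmod (f x))\<^sup>2 + (cmod (g x))\<^sup>2)"
    by (auto simp: norm_mult intro: two_mult_le_sum_squares)
qed

lemma norm_add_square_le: "(cmod (a + b))\<^sup>2 \<le> 2 * (cmod a)\<^sup>2 + 2 * (cmod b)\<^sup>2"
proof -
  have "(cmod (a + b))\<^sup>2 \<le> (cmod a + cmod b)\<^sup>2"
    by (simp add: norm_triangle_ineq power_mono)
  also have "\<dots> \<le> 2 * (cmod a)\<^sup>2 + 2 * (cmod b)\<^sup>2"
    using sum_squares_bound[of "cmod a" "cmod b"] by (simp add: power2_sum)
  finally show ?thesis .
qed

lemma L2_add:
  assumes "f \<in> L2 M" "g \<in> L2 M"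
  shows "f + g \<in> L2 M"
proof -
  have fg: "(\<lambda>x. f x + g x) \<in> borel_measurable M"
    using assms by (auto simp: L2_def)
  have "integrable M (\<lambda>x. (cmod (f x + g x))\<^sup>2)"
  proof (rule Bochner_Integration.integrable_bound)
    show "integrable M (\<lambda>x. 2 * (cmod (f x))\<^sup>2 + 2 * (cmod (g x))\<^sup>2)"
      using assms by (auto simp: L2_def)
    show "(\<lambda>x. (cmod (f x + g x))\<^sup>2) \<in> borel_measurable M"
      using fg by measurable
    show "AE x in M. norm ((cmod (f x + g x))\<^sup>2)
        \<le> norm (2 * (cmod (f x))\<^sup>2 + 2 * (cmod (g x))\<^sup>2)"
      using norm_add_square_le by (intro AE_I2) fastforce
  qed
  then show ?thesis
    using fg unfolding L2_def plus_fun_def by blast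
qed

lemma L2_cscale:
  assumes "f \<in> L2 M"
  shows "cscale c f \<in> L2 M"
  using assms by (auto simp: L2_def cscale_def norm_mult power_mult_distrib)

lemma L2_zero: "0 \<in> L2 M"
  by (simp add: L2_def zero_fun_def)

lemma diff_eq_add_cscale: "f - g = f + cscale (-1) g"
  by (auto simp: cscale_def fun_eq_iff)

lemma L2_diff: "f \<in> L2 M \<Longrightarrow> g \<in> L2 M \<Longrightarrow> f - g \<in> L2 M"
  unfolding diff_eq_add_cscale by (intro L2_add L2_cscale)

lemma L2_sum: "(\<And>i. i \<in> I \<Longrightarrow> f i \<in> L2 M) \<Longrightarrow> sum f I \<in> L2 M"
  by (induct I rule: infinite_finite_induct) (auto intro: L2_add L2_zero)

lemma l2_inner_add_left:
  assumes "f \<in> L2 M" "g \<in> L2 M" "h \<in> L2 M"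
  shows "l2_inner M (f + g) h = l2_inner M f h + l2_inner M g h"
  unfolding l2_inner_def
  using L2_integrable_mult_cnj[OF assms(1,3)] L2_integrable_mult_cnj[OF assms(2,3)]
  by (simp add: algebra_simps)

lemma l2_inner_cscale_left: "l2_inner M (cscale c f) h = c * l2_inner M f h"
  by (simp add: l2_inner_def cscale_def mult.assoc)

lemma l2_inner_commute: "l2_inner M f g = cnj (l2_inner M g f)"
  unfolding l2_inner_def by (simp add: Bochner_Integration.integral_cnj[symmetric] mult.commute)

lemma l2_inner_cscale_right: "l2_inner M f (cscale c h) = cnj c * l2_inner M f h"
  by (subst (1 2) l2_inner_commute) (simp add: l2_inner_cscale_left)

lemma l2_inner_zero_left [simp]: "l2_inner M 0 h = 0"
  and l2_inner_zero_right [simp]: "l2_inner M h 0 = 0"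
  by (simp_all add: l2_inner_def)

lemma l2_inner_diff_left:
  assumes "f \<in> L2 M" "g \<in> L2 M" "h \<in> L2 M"
  shows "l2_inner M (f - g) h = l2_inner M f h - l2_inner M g h"
  using l2_inner_add_left[OF assms(1) L2_cscale[OF assms(2)] assms(3), of "-1"]
  unfolding l2_inner_cscale_left diff_eq_add_cscale[symmetric] by simp

lemma l2_inner_add_right:
  assumes "f \<in> L2 M" "g \<in> L2 M" "h \<in> L2 M"
  shows "l2_inner M h (f + g) = l2_inner M h f + l2_inner M h g"
  by (subst (1 2 3) l2_inner_commute) (simp add: l2_inner_add_left[OF assms])

lemma l2_inner_diff_right:
  assumes "f \<in> L2 M" "g \<in> L2 M" "h \<in> L2 M"
  shows "l2_inner M h (f - g) = l2_inner M h f - l2_inner M h g"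
  by (subst (1 2 3) l2_inner_commute) (simp add: l2_inner_diff_left[OF assms])

lemma l2_inner_sum_left:
  assumes "\<And>i. i \<in> I \<Longrightarrow> f i \<in> L2 M" "h \<in> L2 M"
  shows "l2_inner M (sum f I) h = (\<Sum>i\<in>I. l2_inner M (f i) h)"
  using assms
  by (induct I rule: infinite_finite_induct) (auto simp: l2_inner_add_left L2_sum)

lemma l2_norm_nonneg [simp]: "0 \<le> l2_norm M f"
  by (simp add: l2_norm_def)

lemma l2_inner_self: "l2_inner M f f = of_real ((l2_norm M f)\<^sup>2)"
proof -
  have "l2_inner M f f = (LINT x|M. complex_of_real ((cmod (f x))\<^sup>2))"
    by (simp only: l2_inner_def complex_norm_square)
  also have "\<dots> = of_real (LINT x|M. (cmod (f x))\<^sup>2)"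
    by (rule integral_complex_of_real)
  finally show ?thesis
    by (simp add: l2_norm_def)
qed

lemma l2_norm_square: "(l2_norm M f)\<^sup>2 = Re (l2_inner M f f)"
  by (simp add: l2_inner_self)

lemma l2_norm_zero [simp]: "l2_norm M 0 = 0"
  by (simp add: l2_norm_def)

lemma l2_norm_cscale: "l2_norm M (cscale c f) = cmod c * l2_norm M f"
  by (simp add: l2_norm_def cscale_def norm_mult power_mult_distrib real_sqrt_mult)

lemma l2_norm_diff_square:
  assumes "f \<in> L2 M" "g \<in> L2 M"
  shows "(l2_norm M (f - g))\<^sup>2 = (l2_norm M f)\<^sup>2 - 2 * Re (l2_inner M f g) + (l2_norm M g)\<^sup>2"
proof -
  have "Re (l2_inner M g f) = Re (l2_inner M f g)"
    using l2_inner_commute[of M f g] by simp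
  then show ?thesis
    unfolding l2_norm_square
    using assms by (simp add: l2_inner_diff_left l2_inner_diff_right L2_diff)
qed

lemma l2_norm_add_square:
  assumes "f \<in> L2 M" "g \<in> L2 M"
  shows "(l2_norm M (f + g))\<^sup>2 = (l2_norm M f)\<^sup>2 + 2 * Re (l2_inner M f g) + (l2_norm M g)\<^sup>2"
proof -
  have "Re (l2_inner M g f) = Re (l2_inner M f g)"
    using l2_inner_commute[of M f g] by simp
  then show ?thesis
    unfolding l2_norm_square
    using assms by (simp add: l2_inner_add_left l2_inner_add_right L2_add)
qed

lemma l2_cauchy_schwarz:
  assumes f: "f \<in> L2 M" and g: "g \<in> L2 M"
  shows "cmod (l2_inner M f g) \<le> l2_norm M f * l2_norm M g"
proof -
  define c where "c = l2_inner M f g"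
  \<comment> \<open>This is the squared norm of \<open>f - s c g\<close>; it is smallest at \<open>s = 1 / \<parallel>g\<parallel>\<^sup>2\<close>.\<close>
  have main: "0 \<le> (l2_norm M f)\<^sup>2 - 2 * s * (cmod c)\<^sup>2 + s\<^sup>2 * (cmod c)\<^sup>2 * (l2_norm M g)\<^sup>2" for s :: real
  proof -
    have "Re (l2_inner M f (cscale (of_real s * c) g)) = s * (cmod c)\<^sup>2"
      unfolding l2_inner_cscale_right c_def[symmetric]
      by (simp add: cmod_def power2_eq_square algebra_simps)
    then have "(l2_norm M (f - cscale (of_real s * c) g))\<^sup>2
        = (l2_norm M f)\<^sup>2 - 2 * s * (cmod c)\<^sup>2 + s\<^sup>2 * (cmod c)\<^sup>2 * (l2_norm M g)\<^sup>2"
      using f g by (simp add: l2_norm_diff_square L2_cscale l2_norm_cscale norm_mult power_mult_distrib)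
    then show ?thesis
      by (metis zero_le_power2)
  qed
  show ?thesis
  proof (cases "l2_norm M g = 0")
    case True
    have "c = 0"
    proof (rule ccontr)
      assume "c \<noteq> 0"
      then show False
        \<comment> \<open>Without the quadratic term, a large \<open>s\<close> makes the expression negative.\<close>
        using main[of "((l2_norm M f)\<^sup>2 + 1) / (cmod c)\<^sup>2"] True zero_le_power2[of "l2_norm M f"]
        by simp
    qed
    then show ?thesis
      using True c_def by simp
  next
    case False
    then have g0: "(l2_norm M g)\<^sup>2 > 0"
      by simp
    have "0 \<le> (l2_norm M f)\<^sup>2 - (cmod c)\<^sup>2 / (l2_norm M g)\<^sup>2"
      using main[of "1 / (l2_norm M g)\<^sup>2"] g0 by (simp add: power2_eq_square divide_simps split: if_splits)
    then have "(cmod c)\<^sup>2 \<le> (l2_norm M f * l2_norm M g)\<^sup>2"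
      using g0 by (simp add: field_simps)
    then show ?thesis
      unfolding c_def by (rule power2_le_imp_le) simp
  qed
qed

lemma l2_norm_triangle:
  assumes f: "f \<in> L2 M" and g: "g \<in> L2 M"
  shows "l2_norm M (f + g) \<le> l2_norm M f + l2_norm M g"
proof (rule power2_le_imp_le)
  have "Re (l2_inner M f g) \<le> l2_norm M f * l2_norm M g"
    using l2_cauchy_schwarz[OF f g] complex_Re_le_cmod order_trans by blast
  then show "(l2_norm M (f + g))\<^sup>2 \<le> (l2_norm M f + l2_norm M g)\<^sup>2"
    using f g by (simp add: l2_norm_add_square power2_sum)
qed simp

lemma l2_norm_minus_commute: "l2_norm M (f - g) = l2_norm M (g - f)"
  by (simp add: l2_norm_def norm_minus_commute)

lemma l2_norm_triangle_diff:
  assumes "f \<in> L2 M" "g \<in> L2 M" "h \<in> L2 M"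
  shows "l2_norm M (f - h) \<le> l2_norm M (f - g) + l2_norm M (g - h)"
  using l2_norm_triangle[of "f - g" M "g - h"] assms by (simp add: L2_diff)

lemma l2_norm_triangle_sub:
  assumes "f \<in> L2 M" "g \<in> L2 M"
  shows "l2_norm M f \<le> l2_norm M g + l2_norm M (f - g)"
  using l2_norm_triangle[of g M "f - g"] assms by (simp add: L2_diff)

lemma l2_inner_cong_AE:
  assumes "f \<in> L2 M" "g \<in> L2 M" "h \<in> L2 M" "AE x in M. f x = g x"
  shows "l2_inner M f h = l2_inner M g h"
  unfolding l2_inner_def
  by (rule integral_cong_AE)
     (use assms L2_integrable_mult_cnj[of _ M h] in \<open>auto intro: borel_measurable_integrable\<close>)

lemma l2_norm_eq_0_AE:
  assumes "f \<in> L2 M" "l2_norm M f = 0"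
  shows "AE x in M. f x = 0"
proof -
  have "(LINT x|M. (cmod (f x))\<^sup>2) = 0"
    using assms by (simp add: l2_norm_def)
  then have "AE x in M. (cmod (f x))\<^sup>2 = 0"
    using integral_nonneg_eq_0_iff_AE[OF L2D(2)[OF assms(1)]] by simp
  then show ?thesis
    by auto
qed

text \<open>
  Fourier coefficients of limits in norm, and with them of infinite series, are computed through
  this consequence of the Cauchy--Schwarz inequality.
\<close>

lemma l2_inner_tendsto:
  assumes "\<And>n. f n \<in> L2 M" "g \<in> L2 M" "h \<in> L2 M" "(\<lambda>n. l2_norm M (f n - g)) \<longlonglongrightarrow> 0"
  shows "(\<lambda>n. l2_inner M (f n) h) \<longlonglongrightarrow> l2_inner M g h"
proof (rule LIM_zero_cancel, rule Lim_null_comparison)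
  show "(\<lambda>n. l2_norm M (f n - g) * l2_norm M h) \<longlonglongrightarrow> 0"
    using tendsto_mult_left_zero[OF assms(4)] .
  show "\<forall>\<^sub>F n in sequentially. norm (l2_inner M (f n) h - l2_inner M g h) \<le> l2_norm M (f n - g) * l2_norm M h"
    using assms(1-3) l2_cauchy_schwarz[of "f _ - g" M h]
    by (simp add: l2_inner_diff_left[symmetric] L2_diff)
qed

lemma l2_norm_tendsto:
  assumes "\<And>n. f n \<in> L2 M" "g \<in> L2 M" "(\<lambda>n. l2_norm M (f n - g)) \<longlonglongrightarrow> 0"
  shows "(\<lambda>n. l2_norm M (f n)) \<longlonglongrightarrow> l2_norm M g"
proof (rule LIM_zero_cancel, rule Lim_null_comparison[OF _ assms(3)])
  have "\<bar>l2_norm M (f n) - l2_norm M g\<bar> \<le> l2_norm M (f n - g)" for n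
    using l2_norm_triangle_sub[of "f n" M g] l2_norm_triangle_sub[of g M "f n"] assms(1,2)
      l2_norm_minus_commute[of M g "f n"] by simp
  then show "\<forall>\<^sub>F n in sequentially. norm (l2_norm M (f n) - l2_norm M g) \<le> l2_norm M (f n - g)"
    by simp
qed

lemma l2_norm_scaled_pythagoras:
  assumes "finite I" "\<And>i. i \<in> I \<Longrightarrow> e i \<in> L2 M"
    "\<And>i j. i \<in> I \<Longrightarrow> j \<in> I \<Longrightarrow> l2_inner M (e i) (e j) = (if i = j then 1 else 0)"
  shows "(l2_norm M (\<Sum>i\<in>I. cscale (c i) (e i)))\<^sup>2 = (\<Sum>i\<in>I. (cmod (c i))\<^sup>2)"
  using assms
proof (induct I rule: finite_induct)
  case (insert i I)
  have L: "e i \<in> L2 M" "(\<Sum>i\<in>I. cscale (c i) (e i)) \<in> L2 M" "cscale (c i) (e i) \<in> L2 M"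
    using insert by (auto intro!: L2_sum L2_cscale)
  have "l2_inner M (\<Sum>j\<in>I. cscale (c j) (e j)) (cscale (c i) (e i))
      = (\<Sum>j\<in>I. l2_inner M (cscale (c j) (e j)) (cscale (c i) (e i)))"
    using insert by (intro l2_inner_sum_left L2_cscale) auto
  also have "\<dots> = 0"
    using insert by (intro sum.neutral) (auto simp: l2_inner_cscale_left l2_inner_cscale_right)
  finally have "l2_inner M (cscale (c i) (e i)) (\<Sum>j\<in>I. cscale (c j) (e j)) = 0"
    using l2_inner_commute[of M "cscale (c i) (e i)"] by simp
  moreover have "l2_norm M (e i) = 1"
  proof -
    have "(l2_norm M (e i))\<^sup>2 = 1"
      using insert by (simp add: l2_norm_square)
    then show ?thesis
      using l2_norm_nonneg[of M "e i"] by (auto simp: power2_eq_1_iff)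
  qed
  ultimately have "(l2_norm M (cscale (c i) (e i) + (\<Sum>j\<in>I. cscale (c j) (e j))))\<^sup>2
      = (cmod (c i))\<^sup>2 + (\<Sum>i\<in>I. (cmod (c i))\<^sup>2)"
    using insert l2_norm_add_square[OF L(3,2)] by (simp add: l2_norm_cscale)
  moreover have "(\<Sum>j\<in>insert i I. cscale (c j) (e j)) = cscale (c i) (e i) + (\<Sum>j\<in>I. cscale (c j) (e j))"
    by (rule sum.insert[OF insert.hyps(1,2)])
  ultimately show ?case
    unfolding sum.insert[OF insert.hyps(1,2), of "\<lambda>i. (cmod (c i))\<^sup>2"] by metis
qed simp

lemma bessel_inequality:
  assumes I: "finite I" and e: "\<And>i. i \<in> I \<Longrightarrow> e i \<in> L2 M"
    and orth: "\<And>i j. i \<in> I \<Longrightarrow> j \<in> I \<Longrightarrow> l2_inner M (e i) (e j) = (if i = j then 1 else 0)"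
    and f: "f \<in> L2 M"
  shows "(\<Sum>i\<in>I. (cmod (l2_inner M f (e i)))\<^sup>2) \<le> (l2_norm M f)\<^sup>2"
proof -
  define p where "p = (\<Sum>i\<in>I. cscale (l2_inner M f (e i)) (e i))"
  have p: "p \<in> L2 M"
    unfolding p_def by (intro L2_sum L2_cscale e)
  have "l2_inner M p f = (\<Sum>i\<in>I. l2_inner M (cscale (l2_inner M f (e i)) (e i)) f)"
    unfolding p_def by (intro l2_inner_sum_left L2_cscale e f)
  also have "\<dots> = (\<Sum>i\<in>I. of_real ((cmod (l2_inner M f (e i)))\<^sup>2))"
    by (intro sum.cong refl)
       (subst l2_inner_cscale_left, subst (2) l2_inner_commute, simp only: complex_norm_square)
  finally have "Re (l2_inner M f p) = (\<Sum>i\<in>I. (cmod (l2_inner M f (e i)))\<^sup>2)"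
    by (subst l2_inner_commute) simp
  moreover have "(l2_norm M p)\<^sup>2 = (\<Sum>i\<in>I. (cmod (l2_inner M f (e i)))\<^sup>2)"
    unfolding p_def by (rule l2_norm_scaled_pythagoras) (use I e orth in auto)
  ultimately have "(l2_norm M (f - p))\<^sup>2 = (l2_norm M f)\<^sup>2 - (\<Sum>i\<in>I. (cmod (l2_inner M f (e i)))\<^sup>2)"
    using f p by (simp add: l2_norm_diff_square)
  then show ?thesis
    by (smt (verit) zero_le_power2)
qed

section \<open>Completeness and orthonormal series\<close>

lemma nn_integral_L2:
  assumes "f \<in> L2 M"
  shows "(\<integral>\<^sup>+x. ennreal ((cmod (f x))\<^sup>2) \<partial>M) = ennreal ((l2_norm M f)\<^sup>2)"
  using nn_integral_eq_integral[OF L2D(2)[OF assms]] by (simp add: l2_norm_def)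

lemma L2_if_nn_integral_le:
  assumes f: "f \<in> borel_measurable M"
    and le: "(\<integral>\<^sup>+x. ennreal ((cmod (f x))\<^sup>2) \<partial>M) \<le> ennreal (e\<^sup>2)" and e: "0 \<le> e"
  shows "f \<in> L2 M" "l2_norm M f \<le> e"
proof -
  have "integrable M (\<lambda>x. (cmod (f x))\<^sup>2)"
  proof (rule integrableI_bounded)
    have "(\<integral>\<^sup>+x. ennreal (norm ((cmod (f x))\<^sup>2)) \<partial>M) \<le> ennreal (e\<^sup>2)"
      using le by simp
    also have "\<dots> < \<infinity>"
      by simp
    finally show "(\<integral>\<^sup>+x. ennreal (norm ((cmod (f x))\<^sup>2)) \<partial>M) < \<infinity>" .
  qed (use f in measurable)
  then show L: "f \<in> L2 M"
    using f by (simp add: L2_def)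
  have "(l2_norm M f)\<^sup>2 \<le> e\<^sup>2"
    using le nn_integral_L2[OF L] by simp
  then show "l2_norm M f \<le> e"
    using e by (rule power2_le_imp_le)
qed

lemma const_in_L2:
  assumes "finite_measure M"
  shows "(\<lambda>x. c) \<in> L2 M"
proof -
  interpret finite_measure M by fact
  show ?thesis
    by (simp add: L2_def)
qed

lemma nn_integral_norm_le_l2_norm:
  fixes M :: "'g::topological_space measure"
  assumes M: "finite_measure M" and f: "f \<in> L2 M"
  shows "(\<integral>\<^sup>+x. ennreal (cmod (f x)) \<partial>M) \<le> ennreal (l2_norm M f * l2_norm M (\<lambda>x. 1))"
proof -
  have g: "(\<lambda>x. complex_of_real (cmod (f x))) \<in> L2 M"
    using f by (auto simp: L2_def)
  have i: "integrable M (\<lambda>x. cmod (f x))"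
    using integrable_Re[OF L2_integrable_mult_cnj[OF g const_in_L2[OF M, of 1]]] by simp
  have "(\<integral>\<^sup>+x. ennreal (cmod (f x)) \<partial>M) = ennreal (LINT x|M. cmod (f x))"
    by (rule nn_integral_eq_integral) (use i in auto)
  moreover have "(LINT x|M. cmod (f x)) \<le> l2_norm M f * l2_norm M (\<lambda>x. 1)"
  proof -
    have "l2_inner M (\<lambda>x. complex_of_real (cmod (f x))) (\<lambda>x. 1) = of_real (LINT x|M. cmod (f x))"
      by (simp add: l2_inner_def integral_complex_of_real)
    moreover have "l2_norm M (\<lambda>x. complex_of_real (cmod (f x))) = l2_norm M f"
      by (simp add: l2_norm_def)
    ultimately show ?thesis
      using l2_cauchy_schwarz[OF g const_in_L2[OF M, of 1]] by simp
  qed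
  ultimately show ?thesis
    by (simp add: ennreal_leI)
qed

text \<open>
  Along a subsequence with norm differences at most \<open>(1/2)^k\<close> the functions converge almost
  everywhere, because the differences are then absolutely summable almost everywhere. Fatou's lemma
  turns the pointwise limit into the limit in norm of the whole sequence.
\<close>

lemma L2_complete:
  fixes M :: "'g::topological_space measure"
  assumes M: "finite_measure M" and f: "\<And>n. f n \<in> L2 M"
    and cauchy: "\<And>e. e > 0 \<Longrightarrow> \<exists>N. \<forall>m\<ge>N. \<forall>n\<ge>N. l2_norm M (f m - f n) \<le> e"
  shows "\<exists>g\<in>L2 M. (\<lambda>n. l2_norm M (f n - g)) \<longlonglongrightarrow> 0"
proof -
  have "\<exists>N. \<forall>m\<ge>N. \<forall>n\<ge>N. l2_norm M (f m - f n) \<le> (1/2) ^ k" for k :: nat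
    by (rule cauchy) simp
  then obtain N :: "nat \<Rightarrow> nat" where
    N: "\<And>k m n. m \<ge> N k \<Longrightarrow> n \<ge> N k \<Longrightarrow> l2_norm M (f m - f n) \<le> (1/2) ^ k"
    by metis
  \<comment> \<open>The summation makes the chosen indices increasing, and the last term makes them unbounded.\<close>
  define s where "s k = (\<Sum>i\<le>k. N i) + k" for k
  have sN: "N k \<le> s k" for k
    unfolding s_def by (rule trans_le_add1) (rule member_le_sum, auto)
  have sSuc: "s k \<le> s (Suc k)" and sk: "k \<le> s k" for k
    unfolding s_def by simp_all
  define d where "d k = f (s (Suc k)) - f (s k)" for k
  have d: "d k \<in> L2 M" for k
    unfolding d_def by (intro L2_diff f)
  have nd: "l2_norm M (d k) \<le> (1/2) ^ k" for k
    unfolding d_def by (rule N) (use sN sSuc order_trans in blast)+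
  have fm [measurable]: "f n \<in> borel_measurable M" for n
    using f L2D(1) by blast
  have dm [measurable]: "d k \<in> borel_measurable M" for k
    using d L2D(1) by blast
  define c where "c = l2_norm M (\<lambda>x. 1)"
  have "(\<integral>\<^sup>+x. (\<Sum>k. ennreal (cmod (d k x))) \<partial>M) = (\<Sum>k. \<integral>\<^sup>+x. ennreal (cmod (d k x)) \<partial>M)"
    by (rule nn_integral_suminf) measurable
  also have "\<dots> \<le> (\<Sum>k. ennreal ((1/2) ^ k * c))"
  proof (rule suminf_le)
    show "(\<integral>\<^sup>+x. ennreal (cmod (d k x)) \<partial>M) \<le> ennreal ((1/2) ^ k * c)" for k
      using nn_integral_norm_le_l2_norm[OF M d, of k] nd[of k]
      unfolding c_def by (elim order_trans) (intro ennreal_leI mult_right_mono, auto)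
  qed auto
  also have "\<dots> = ennreal (\<Sum>k. (1/2) ^ k * c)"
    by (rule suminf_ennreal2) (auto simp: c_def intro!: summable_mult2 summable_geometric)
  also have "\<dots> < \<infinity>"
    by simp
  finally have "AE x in M. (\<Sum>k. ennreal (cmod (d k x))) \<noteq> \<infinity>"
    by (intro nn_integral_PInf_AE) auto
  then have AE_conv: "AE x in M. convergent (\<lambda>k. f (s k) x)"
  proof eventually_elim
    case (elim x)
    then have "summable (\<lambda>k. cmod (d k x))"
      by (intro summable_suminf_not_top) auto
    then have "summable (\<lambda>k. d k x)"
      by (rule summable_norm_cancel)
    then have "convergent (\<lambda>n. \<Sum>k<n. d k x)"
      by (simp add: summable_iff_convergent)
    moreover have "(\<Sum>k<n. d k x) = f (s n) x - f (s 0) x" for n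
      unfolding d_def using sum_lessThan_telescope[of "\<lambda>k. f (s k) x" n] by simp
    ultimately have "convergent (\<lambda>n. (f (s n) x - f (s 0) x) + f (s 0) x)"
      by (intro convergent_add convergent_const) simp
    then show ?case
      by simp
  qed
  define g where "g x = lim (\<lambda>k. f (s k) x)" for x
  have gm [measurable]: "g \<in> borel_measurable M"
    unfolding g_def by (rule borel_measurable_lim_metric) measurable
  have AE_lim: "AE x in M. (\<lambda>k. f (s k) x) \<longlonglongrightarrow> g x"
    using AE_conv by eventually_elim (simp add: g_def convergent_LIMSEQ_iff)
  have close: "f n - g \<in> L2 M \<and> l2_norm M (f n - g) \<le> e"
    if e: "e > 0" and n: "n \<ge> K" and K: "\<forall>m\<ge>K. \<forall>n\<ge>K. l2_norm M (f m - f n) \<le> e" for n e K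
  proof -
    have "(\<integral>\<^sup>+x. ennreal ((cmod ((f n - g) x))\<^sup>2) \<partial>M)
        = (\<integral>\<^sup>+x. liminf (\<lambda>k. ennreal ((cmod (f n x - f (s k) x))\<^sup>2)) \<partial>M)"
    proof (rule nn_integral_cong_AE, use AE_lim in eventually_elim)
      fix x assume "(\<lambda>k. f (s k) x) \<longlonglongrightarrow> g x"
      then have "(\<lambda>k. ennreal ((cmod (f n x - f (s k) x))\<^sup>2)) \<longlonglongrightarrow> ennreal ((cmod (f n x - g x))\<^sup>2)"
        by (intro tendsto_intros)
      then have "liminf (\<lambda>k. ennreal ((cmod (f n x - f (s k) x))\<^sup>2)) = ennreal ((cmod (f n x - g x))\<^sup>2)"
        by (rule lim_imp_Liminf[OF sequentially_bot])
      then show "ennreal ((cmod ((f n - g) x))\<^sup>2) = liminf (\<lambda>k. ennreal ((cmod (f n x - f (s k) x))\<^sup>2))"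
        by (simp only: fun_diff_def)
    qed
    also have "\<dots> \<le> liminf (\<lambda>k. \<integral>\<^sup>+x. ennreal ((cmod (f n x - f (s k) x))\<^sup>2) \<partial>M)"
      by (rule nn_integral_liminf) measurable
    also have "\<dots> \<le> ennreal (e\<^sup>2)"
    proof (rule Liminf_le)
      have "(\<integral>\<^sup>+x. ennreal ((cmod (f n x - f (s k) x))\<^sup>2) \<partial>M) \<le> ennreal (e\<^sup>2)" if "k \<ge> K" for k
      proof -
        have "l2_norm M (f n - f (s k)) \<le> e"
          using K n that sk[of k] by simp
        then show ?thesis
          using nn_integral_L2[OF L2_diff[OF f f], of n "s k"] by (auto intro!: ennreal_leI power_mono)
      qed
      then show "\<forall>\<^sub>F k in sequentially. (\<integral>\<^sup>+x. ennreal ((cmod (f n x - f (s k) x))\<^sup>2) \<partial>M) \<le> ennreal (e\<^sup>2)"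
        by (auto simp: eventually_sequentially)
    qed simp
    finally have le: "(\<integral>\<^sup>+x. ennreal ((cmod ((f n - g) x))\<^sup>2) \<partial>M) \<le> ennreal (e\<^sup>2)" .
    have m: "f n - g \<in> borel_measurable M"
      unfolding fun_diff_def by measurable
    show ?thesis
      using L2_if_nn_integral_le[OF m le order.strict_implies_order[OF e]] by blast
  qed
  obtain K where K: "\<forall>m\<ge>K. \<forall>n\<ge>K. l2_norm M (f m - f n) \<le> 1"
    using cauchy[of 1] by auto
  have "f K - g \<in> L2 M"
    using close[OF zero_less_one order_refl K] by blast
  from L2_diff[OF f this, of K] have "g \<in> L2 M"
    unfolding diff_diff_eq2 by (simp only: add_diff_cancel_left')
  moreover have "(\<lambda>n. l2_norm M (f n - g)) \<longlonglongrightarrow> 0"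
  proof (rule LIMSEQ_I)
    fix e :: real assume "e > 0"
    then obtain K where K: "\<forall>m\<ge>K. \<forall>n\<ge>K. l2_norm M (f m - f n) \<le> e / 2"
      using cauchy[of "e / 2"] by auto
    have "norm (l2_norm M (f n - g) - 0) < e" if "n \<ge> K" for n
      using close[OF _ that K] \<open>e > 0\<close> by simp
    then show "\<exists>no. \<forall>n\<ge>no. norm (l2_norm M (f n - g) - 0) < e"
      by blast
  qed
  ultimately show ?thesis
    by blast
qed

text \<open>
  By Pythagoras, the squared distance of two partial sums is a segment of the convergent series of
  squared moduli of the coefficients, so the partial sums form a Cauchy sequence.
\<close>

lemma riesz_fischer:
  fixes M :: "'g::topological_space measure"
  assumes M: "finite_measure M" and e: "\<And>n::nat. e n \<in> L2 M"
    and orth: "\<And>m n. l2_inner M (e m) (e n) = (if m = n then 1 else 0)"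
    and c: "summable (\<lambda>n. (cmod (c n))\<^sup>2)"
  shows "\<exists>g\<in>L2 M. (\<lambda>N. l2_norm M ((\<Sum>n<N. cscale (c n) (e n)) - g)) \<longlonglongrightarrow> 0
           \<and> (l2_norm M g)\<^sup>2 = (\<Sum>n. (cmod (c n))\<^sup>2)"
proof -
  define S where "S N = (\<Sum>n<N. cscale (c n) (e n))" for N
  have S: "S N \<in> L2 M" for N
    unfolding S_def by (intro L2_sum L2_cscale e)
  have "\<exists>N. \<forall>m\<ge>N. \<forall>n\<ge>N. l2_norm M (S m - S n) \<le> \<epsilon>" if "\<epsilon> > 0" for \<epsilon>
  proof -
    have "\<exists>N. \<forall>m\<ge>N. \<forall>n. norm (\<Sum>k=m..<n. (cmod (c k))\<^sup>2) < \<epsilon>\<^sup>2"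
      using c that by (simp only: summable_Cauchy zero_less_power)
    then obtain N where N: "\<And>m n. m \<ge> N \<Longrightarrow> norm (\<Sum>k=m..<n. (cmod (c k))\<^sup>2) < \<epsilon>\<^sup>2"
      by blast
    have le: "l2_norm M (S n - S m) \<le> \<epsilon>" if "N \<le> m" "m \<le> n" for m n
    proof (rule power2_le_imp_le)
      have "S n - S m = (\<Sum>k\<in>{m..<n}. cscale (c k) (e k))"
        unfolding S_def using that sum_diff_nat_ivl[of 0 m n "\<lambda>k. cscale (c k) (e k)"]
        by (simp add: lessThan_atLeast0)
      then have "(l2_norm M (S n - S m))\<^sup>2 = (\<Sum>k\<in>{m..<n}. (cmod (c k))\<^sup>2)"
        using l2_norm_scaled_pythagoras[of "{m..<n}" e M c] e orth by simp
      also have "\<dots> \<le> \<epsilon>\<^sup>2"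
        using N[OF that(1), of n] by simp
      finally show "(l2_norm M (S n - S m))\<^sup>2 \<le> \<epsilon>\<^sup>2" .
    qed (use \<open>\<epsilon> > 0\<close> in simp)
    have "l2_norm M (S m - S n) \<le> \<epsilon>" if "m \<ge> N" "n \<ge> N" for m n
      using le[of m n] le[of n m] that by (cases "m \<le> n") (auto simp: l2_norm_minus_commute)
    then show ?thesis
      by blast
  qed
  then obtain g where g: "g \<in> L2 M" "(\<lambda>N. l2_norm M (S N - g)) \<longlonglongrightarrow> 0"
    using L2_complete[OF M, of S] S by blast
  have "(\<lambda>N. (l2_norm M (S N))\<^sup>2) \<longlonglongrightarrow> (l2_norm M g)\<^sup>2"
    by (intro tendsto_power l2_norm_tendsto S g)
  moreover have "(l2_norm M (S N))\<^sup>2 = (\<Sum>n<N. (cmod (c n))\<^sup>2)" for N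
    unfolding S_def by (rule l2_norm_scaled_pythagoras) (use e orth in auto)
  ultimately have "(\<lambda>n. (cmod (c n))\<^sup>2) sums (l2_norm M g)\<^sup>2"
    by (simp add: sums_def)
  then show ?thesis
    using g sums_unique unfolding S_def by blast
qed

section \<open>Haar integration on a compact abelian group\<close>

text \<open>
  The iterated integrals of a finite sum of products \<open>f x * g y\<close> agree for trivial reasons, and by
  the Stone--Weierstrass theorem such sums approximate every continuous function of two variables
  uniformly. In this way iterated integrals of continuous functions can be interchanged without a
  product measure: if the group has no countable base, a continuous function of two variables is a
  Borel function on the product space, whose Borel sets need not be generated by measurable rectangles.
\<close>

inductive tensor_sum :: "('a::topological_space \<times> 'b::topological_space \<Rightarrow> real) \<Rightarrow> bool" where
  product: "continuous_on UNIV f \<Longrightarrow> continuous_on UNIV g \<Longrightarrow> tensor_sum (\<lambda>p. f (fst p) * g (snd p))"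
| add: "tensor_sum F \<Longrightarrow> tensor_sum G \<Longrightarrow> tensor_sum (\<lambda>p. F p + G p)"

lemma tensor_sum_continuous: "tensor_sum F \<Longrightarrow> continuous_on UNIV F"
proof (induct rule: tensor_sum.induct)
  case (product f g)
  have "continuous_on UNIV (\<lambda>p. f (fst p))" "continuous_on UNIV (\<lambda>p. g (snd p))"
    by (rule continuous_on_compose2[OF product(1)] continuous_on_compose2[OF product(2)];
        auto intro: continuous_intros)+
  then show ?case
    by (rule continuous_on_mult)
qed (rule continuous_on_add)

lemma tensor_sum_mult_product:
  assumes "tensor_sum G" "continuous_on UNIV f" "continuous_on UNIV g"
  shows "tensor_sum (\<lambda>p. (f (fst p) * g (snd p)) * G p)"
  using assms(1)
proof (induct rule: tensor_sum.induct)
  case (product f' g')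
  have "tensor_sum (\<lambda>p. (\<lambda>x. f x * f' x) (fst p) * (\<lambda>x. g x * g' x) (snd p))"
    by (intro tensor_sum.product continuous_on_mult assms product)
  then show ?case
    by (simp add: mult_ac)
next
  case (add F G)
  then show ?case
    using tensor_sum.add by (fastforce simp: distrib_left)
qed

lemma tensor_sum_mult:
  assumes "tensor_sum F" "tensor_sum G"
  shows "tensor_sum (\<lambda>p. F p * G p)"
  using assms(1)
proof (induct rule: tensor_sum.induct)
  case (add F F')
  then show ?case
    using tensor_sum.add by (fastforce simp: distrib_right)
qed (rule tensor_sum_mult_product[OF assms(2)])

lemma compact_Hausdorff_Urysohn:
  fixes S T :: "'g::t2_space set"
  assumes "compact (UNIV :: 'g set)" "closed S" "closed T" "S \<inter> T = {}"
  shows "\<exists>f :: 'g \<Rightarrow> real. continuous_on UNIV f \<and> (\<forall>x. 0 \<le> f x \<and> f x \<le> 1) \<and> (\<forall>x\<in>S. f x = 0) \<and> (\<forall>x\<in>T. f x = 1)"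
proof -
  have "Hausdorff_space (euclidean :: 'g topology)"
    unfolding Hausdorff_space_def using hausdorff by (fastforce simp: disjnt_def)
  moreover have "compact_space (euclidean :: 'g topology)"
    using assms(1) by (simp add: compact_space_def compactin_euclidean_iff)
  ultimately have "normal_space (euclidean :: 'g topology)"
    by (intro compact_Hausdorff_or_regular_imp_normal_space) auto
  then obtain f where "continuous_map euclidean (top_of_set {0..1::real}) f" "f ` S \<subseteq> {0}" "f ` T \<subseteq> {1}"
    using Urysohn_lemma[of "euclidean :: 'g topology" S T 0 1] assms
    by (auto simp: disjnt_def)
  then show ?thesis
    by (intro exI[of _ f]) (fastforce simp: continuous_map_in_subtopology)
qed

lemma tensor_sum_dense:
  fixes F :: "'g::t2_space \<times> 'g \<Rightarrow> real"
  assumes "compact (UNIV :: 'g set)" "continuous_on UNIV F" "e > 0"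
  shows "\<exists>T. tensor_sum T \<and> (\<forall>p. \<bar>F p - T p\<bar> < e)"
proof -
  have "\<exists>T. tensor_sum T \<and> (\<forall>p\<in>UNIV. \<bar>F p - T p\<bar> < e)"
  proof (rule Stone_Weierstrass_HOL)
    show "compact (UNIV :: ('g \<times> 'g) set)"
      using compact_Times[OF assms(1,1)] by simp
    show "tensor_sum (\<lambda>p::'g \<times> 'g. c)" for c
      using tensor_sum.product[OF continuous_on_const[of _ c] continuous_on_const[of _ 1]] by simp
    show "\<exists>T. tensor_sum T \<and> T p \<noteq> T q" if "p \<in> UNIV \<and> q \<in> UNIV \<and> p \<noteq> q" for p q :: "'g \<times> 'g"
    proof -
      have sep: "\<exists>f :: 'g \<Rightarrow> real. continuous_on UNIV f \<and> f x \<noteq> f y" if "x \<noteq> y" for x y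
        using compact_Hausdorff_Urysohn[OF assms(1), of "{x}" "{y}"] that
        by (metis closed_singleton disjoint_insert(1) inf_bot_right singletonD singletonI zero_neq_one)
      show ?thesis
      proof (cases "fst p = fst q")
        case False
        then obtain f where "continuous_on UNIV f" "f (fst p) \<noteq> (f (fst q) :: real)"
          using sep by blast
        then show ?thesis
          using tensor_sum.product[of f "\<lambda>_::'g. 1"] by auto
      next
        case True
        then have "snd p \<noteq> snd q"
          using that by (auto simp: prod_eq_iff)
        then obtain f where "continuous_on UNIV f" "f (snd p) \<noteq> (f (snd q) :: real)"
          using sep by blast
        then show ?thesis
          using tensor_sum.product[of "\<lambda>_::'g. 1" f] by auto
      qed
    qed
  qed (use assms tensor_sum_continuous tensor_sum.add tensor_sum_mult in auto)
  then show ?thesis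
    by simp
qed

locale compact_abelian_group =
  fixes M :: "'g::{topological_ab_group_add,t2_space} measure"
  assumes compact_group: "compact (UNIV :: 'g set)"
    and haar: "normalized_haar M"
begin

lemma sets_M [measurable_cong]: "sets M = sets borel"
  using haar by (simp add: normalized_haar_def)

lemma space_M [simp]: "space M = UNIV"
  using sets_eq_imp_space_eq[OF sets_M] by simp

lemma emeasure_UNIV [simp]: "emeasure M UNIV = 1"
  using haar by (simp add: normalized_haar_def)

lemma finite_measure_M: "finite_measure M"
  by (rule finite_measureI) simp

lemma measure_UNIV [simp]: "measure M UNIV = 1"
  by (simp add: measure_def)

lemma continuous_borel_measurable: "continuous_on UNIV f \<Longrightarrow> f \<in> borel_measurable M"
  using borel_measurable_continuous_onI measurable_cong_sets[OF sets_M refl] by blast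

lemma continuous_bounded:
  fixes f :: "'g \<Rightarrow> 'b::real_normed_vector"
  assumes "continuous_on UNIV f"
  shows "\<exists>B>0. \<forall>x. norm (f x) \<le> B"
  using compact_imp_bounded[OF compact_continuous_image[OF assms compact_group]]
  by (auto simp: bounded_pos)

lemma continuous_integrable:
  fixes f :: "'g \<Rightarrow> 'b::{banach,second_countable_topology}"
  assumes "continuous_on UNIV f"
  shows "integrable M f"
proof -
  obtain B where "\<And>x. norm (f x) \<le> B"
    using continuous_bounded[OF assms] by blast
  then show ?thesis
    using finite_measure.integrable_const_bound[OF finite_measure_M, of f B]
      continuous_borel_measurable[OF assms] by simp
qed

lemma continuous_in_L2: "continuous_on UNIV f \<Longrightarrow> f \<in> L2 M"
  unfolding L2_def using continuous_borel_measurable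
  by (auto intro!: continuous_integrable continuous_intros)

lemma integral_translate:
  fixes f :: "'g \<Rightarrow> 'b::{banach,second_countable_topology}"
  assumes "continuous_on UNIV f"
  shows "(LINT x|M. f (a + x)) = (LINT x|M. f x)"
proof -
  have "distr M borel (\<lambda>y. a + y) = M"
    using haar by (simp add: normalized_haar_def)
  then have "(LINT x|M. f x) = (LINT x|distr M borel (\<lambda>y. a + y). f x)"
    by simp
  also have "\<dots> = (LINT x|M. f (a + x))"
    by (rule integral_distr)
       (use assms in \<open>auto intro!: borel_measurable_continuous_onI continuous_borel_measurable continuous_intros\<close>)
  finally show ?thesis ..
qed

lemma integral_norm_le:
  fixes f :: "'g \<Rightarrow> 'b::{banach,second_countable_topology}"
  assumes "continuous_on UNIV f" "\<And>x. norm (f x) \<le> B"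
  shows "norm (LINT x|M. f x) \<le> B"
proof -
  have "norm (LINT x|M. f x) \<le> (LINT x|M. norm (f x))"
    by (rule integral_norm_bound)
  also have "\<dots> \<le> (LINT x|M. B)"
    by (rule integral_mono) (use assms in \<open>auto intro!: continuous_integrable continuous_intros\<close>)
  finally show ?thesis
    by simp
qed

lemma l2_norm_le_sup:
  assumes "continuous_on UNIV f" "\<And>x. cmod (f x) \<le> B"
  shows "l2_norm M f \<le> B"
proof (rule power2_le_imp_le)
  show "0 \<le> B"
    using assms(2)[of 0] norm_ge_zero order_trans by blast
  have "norm (LINT x|M. (cmod (f x))\<^sup>2) \<le> B\<^sup>2"
    by (rule integral_norm_le) (use assms in \<open>auto intro!: continuous_intros power_mono\<close>)
  then show "(l2_norm M f)\<^sup>2 \<le> B\<^sup>2"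
    by (simp add: l2_norm_def)
qed

text \<open>
  Finitely many translates of a nonempty open set cover the group, and all of them have its measure.
\<close>

lemma emeasure_open_pos:
  assumes "open U" "u \<in> U"
  shows "emeasure M U \<noteq> 0"
proof
  assume 0: "emeasure M U = 0"
  have op: "open ((\<lambda>y. a + y) -` U)" for a
    by (rule open_vimage[OF assms(1)]) (intro continuous_intros)
  have "y \<in> (\<lambda>z. (u - y) + z) -` U" for y
    using assms(2) by simp
  then have "UNIV \<subseteq> (\<Union>a\<in>UNIV. (\<lambda>y. a + y) -` U)"
    by blast
  then obtain A where A: "finite A" "UNIV \<subseteq> (\<Union>a\<in>A. (\<lambda>y. a + y) -` U)"
    by (rule compactE_image[OF compact_group op])
  have "emeasure M ((\<lambda>y. a + y) -` U) = 0" for a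
  proof -
    have "emeasure (distr M borel (\<lambda>y. a + y)) U = emeasure M ((\<lambda>y. a + y) -` U \<inter> space M)"
      by (rule emeasure_distr)
         (use assms in \<open>auto intro!: continuous_borel_measurable continuous_intros\<close>)
    moreover have "distr M borel (\<lambda>y. a + y) = M"
      using haar by (simp add: normalized_haar_def)
    ultimately show ?thesis
      using 0 by simp
  qed
  then have "(\<Union>a\<in>A. (\<lambda>y. a + y) -` U) \<in> null_sets M"
    using A(1) op by (intro null_sets_UN') (auto simp: sets_M null_sets_def countable_finite)
  then have "emeasure M (\<Union>a\<in>A. (\<lambda>y. a + y) -` U) = 0"
    by auto
  moreover have "(\<Union>a\<in>A. (\<lambda>y. a + y) -` U) = UNIV"
    using A(2) by blast
  ultimately show False
    by simp
qed

lemma l2_norm_eq_0_continuous: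
  assumes "continuous_on UNIV f" "l2_norm M f = 0"
  shows "f = 0"
proof (rule ccontr)
  assume "f \<noteq> 0"
  then obtain u where u: "u \<in> f -` (- {0})"
    by (auto simp: fun_eq_iff)
  have op: "open (f -` (- {0}))"
    by (rule open_vimage[OF _ assms(1)]) auto
  have "AE x in M. f x = 0"
    using l2_norm_eq_0_AE[OF continuous_in_L2] assms by blast
  then have "emeasure M (f -` (- {0})) = 0"
    using op by (subst (asm) AE_iff_measurable[of "f -` (- {0})"]) (auto simp: sets_M)
  then show False
    using emeasure_open_pos[OF op u] by simp
qed

section \<open>Interchanging iterated integrals\<close>

text \<open>
  By the tube lemma, \<open>F (x, y)\<close> is close to \<open>F (x0, y)\<close> for all \<open>y\<close> at once when \<open>x\<close> is near \<open>x0\<close>.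
\<close>

lemma continuous_parametric_integral:
  fixes F :: "'g \<times> 'g \<Rightarrow> 'b::{banach,second_countable_topology}"
  assumes F: "continuous_on UNIV F"
  shows "continuous_on UNIV (\<lambda>x. LINT y|M. F (x, y))"
proof -
  have sec: "continuous_on UNIV (\<lambda>y. F (x, y))" for x
    by (rule continuous_on_compose2[OF F]) (auto intro: continuous_intros)
  have "isCont (\<lambda>x. LINT y|M. F (x, y)) x0" for x0
    unfolding continuous_at
  proof (rule tendstoI)
    fix e :: real assume e: "e > 0"
    obtain X where X: "x0 \<in> X" "open X" "\<forall>x\<in>X \<inter> UNIV. \<forall>y\<in>UNIV. dist (F (x, y)) (F (x0, y)) \<le> e / 2"
      by (rule continuous_on_prod_compactE[of UNIV UNIV F x0 "e / 2"])
         (use F e compact_group in auto)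
    have "dist (LINT y|M. F (x, y)) (LINT y|M. F (x0, y)) < e" if "x \<in> X" for x
    proof -
      have "norm (LINT y|M. F (x, y) - F (x0, y)) \<le> e / 2"
        by (rule integral_norm_le) (use X that sec in \<open>auto intro!: continuous_intros simp: dist_norm\<close>)
      then show ?thesis
        using e sec by (simp add: dist_norm continuous_integrable)
    qed
    then show "\<forall>\<^sub>F x in at x0. dist (LINT y|M. F (x, y)) (LINT y|M. F (x0, y)) < e"
      using X eventually_at_topological by blast
  qed
  then show ?thesis
    by (simp add: continuous_at_imp_continuous_on)
qed

lemma continuous_swap_args: "continuous_on UNIV F \<Longrightarrow> continuous_on UNIV (\<lambda>(y, x). F (x, y))"
  unfolding case_prod_beta by (rule continuous_on_compose2) (auto intro!: continuous_intros)

lemma iterated_integral_diff_le: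
  fixes F G :: "'g \<times> 'g \<Rightarrow> 'b::{banach,second_countable_topology}"
  assumes F: "continuous_on UNIV F" and G: "continuous_on UNIV G" and le: "\<And>p. norm (F p - G p) \<le> e"
  shows "norm ((LINT x|M. LINT y|M. F (x, y)) - (LINT x|M. LINT y|M. G (x, y))) \<le> e"
proof -
  have sec: "continuous_on UNIV (\<lambda>y. F (x, y))" "continuous_on UNIV (\<lambda>y. G (x, y))" for x
    by (rule continuous_on_compose2[OF F] continuous_on_compose2[OF G]; auto intro: continuous_intros)+
  note int = continuous_integrable[OF sec(1)] continuous_integrable[OF sec(2)]
    continuous_integrable[OF continuous_parametric_integral[OF F]]
    continuous_integrable[OF continuous_parametric_integral[OF G]]
  have "(LINT x|M. LINT y|M. F (x, y)) - (LINT x|M. LINT y|M. G (x, y)) = (LINT x|M. LINT y|M. F (x, y) - G (x, y))"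
    using int by simp
  also have "norm \<dots> \<le> e"
  proof (rule integral_norm_le)
    show "continuous_on UNIV (\<lambda>x. LINT y|M. F (x, y) - G (x, y))"
      using F G by (intro continuous_parametric_integral[of "\<lambda>p. F p - G p"] continuous_intros)
    show "norm (LINT y|M. F (x, y) - G (x, y)) \<le> e" for x
      by (rule integral_norm_le) (use sec le in \<open>auto intro!: continuous_intros\<close>)
  qed
  finally show ?thesis .
qed

lemma tensor_sum_integral_swap:
  fixes T :: "'g \<times> 'g \<Rightarrow> real"
  assumes "tensor_sum T"
  shows "(LINT x|M. LINT y|M. T (x, y)) = (LINT y|M. LINT x|M. T (x, y))"
  using assms
proof (induct rule: tensor_sum.induct)
  case (add F G)
  have sec: "continuous_on UNIV (\<lambda>y. H (x, y))" "continuous_on UNIV (\<lambda>y. H (y, x))"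
    if "tensor_sum H" for H :: "'g \<times> 'g \<Rightarrow> real" and x
    by (rule continuous_on_compose2[OF tensor_sum_continuous[OF that]]; auto intro: continuous_intros)+
  have "continuous_on UNIV (\<lambda>x. LINT y|M. H (x, y))" "continuous_on UNIV (\<lambda>y. LINT x|M. H (x, y))"
    if "tensor_sum H" for H :: "'g \<times> 'g \<Rightarrow> real"
    using continuous_parametric_integral[OF tensor_sum_continuous[OF that]]
      continuous_parametric_integral[OF continuous_swap_args[OF tensor_sum_continuous[OF that]]]
    by simp_all
  then show ?case
    using add sec by (simp add: continuous_integrable)
qed simp

lemma integral_swap_real:
  fixes F :: "'g \<times> 'g \<Rightarrow> real"
  assumes F: "continuous_on UNIV F"
  shows "(LINT x|M. LINT y|M. F (x, y)) = (LINT y|M. LINT x|M. F (x, y))"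
proof -
  have "\<bar>(LINT x|M. LINT y|M. F (x, y)) - (LINT y|M. LINT x|M. F (x, y))\<bar> \<le> e" if "e > 0" for e
  proof -
    obtain T where T: "tensor_sum T" "\<And>p. \<bar>F p - T p\<bar> < e / 2"
      using tensor_sum_dense[OF compact_group F, of "e / 2"] \<open>e > 0\<close> by auto
    have "norm ((LINT x|M. LINT y|M. F (x, y)) - (LINT x|M. LINT y|M. T (x, y))) \<le> e / 2"
      using T tensor_sum_continuous[OF T(1)] F
      by (intro iterated_integral_diff_le) (auto intro: less_imp_le)
    moreover have "norm ((LINT y|M. LINT x|M. (\<lambda>(y, x). F (x, y)) (y, x))
        - (LINT y|M. LINT x|M. (\<lambda>(y, x). T (x, y)) (y, x))) \<le> e / 2"
      using T tensor_sum_continuous[OF T(1)] F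
      by (intro iterated_integral_diff_le continuous_swap_args) (auto intro: less_imp_le)
    ultimately show ?thesis
      using tensor_sum_integral_swap[OF T(1)] unfolding real_norm_def case_prod_conv by linarith
  qed
  then have "\<bar>(LINT x|M. LINT y|M. F (x, y)) - (LINT y|M. LINT x|M. F (x, y))\<bar> \<le> 0"
    by (rule field_le_epsilon) simp
  then show ?thesis
    by simp
qed

lemma integral_swap:
  fixes F :: "'g \<times> 'g \<Rightarrow> complex"
  assumes F: "continuous_on UNIV F"
  shows "(LINT x|M. LINT y|M. F (x, y)) = (LINT y|M. LINT x|M. F (x, y))"
proof -
  have sec: "integrable M (\<lambda>y. F (x, y))" "integrable M (\<lambda>y. F (y, x))" for x
    by (rule continuous_integrable, rule continuous_on_compose2[OF F]; auto intro: continuous_intros)+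
  have it: "integrable M (\<lambda>x. LINT y|M. F (x, y))" "integrable M (\<lambda>y. LINT x|M. F (x, y))"
    using continuous_integrable[OF continuous_parametric_integral[OF F]]
      continuous_integrable[OF continuous_parametric_integral[OF continuous_swap_args[OF F]]]
    by simp_all
  show ?thesis
  proof (rule complex_eqI)
    show "Re (LINT x|M. LINT y|M. F (x, y)) = Re (LINT y|M. LINT x|M. F (x, y))"
      using integral_swap_real[of "\<lambda>p. Re (F p)"] F sec it
      by (simp add: integral_Re[symmetric] continuous_on_Re del: integral_Re)
    show "Im (LINT x|M. LINT y|M. F (x, y)) = Im (LINT y|M. LINT x|M. F (x, y))"
      using integral_swap_real[of "\<lambda>p. Im (F p)"] F sec it
      by (simp add: integral_Im[symmetric] continuous_on_Im del: integral_Im)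
  qed
qed

text \<open>
  Invariance under reflection is a consequence of invariance under translation: integrated in the two
  possible orders, \<open>f (x - y)\<close> gives the two sides.
\<close>

lemma integral_reflect:
  fixes f :: "'g \<Rightarrow> complex"
  assumes f: "continuous_on UNIV f"
  shows "(LINT y|M. f (- y)) = (LINT y|M. f y)"
proof -
  have c: "continuous_on UNIV (\<lambda>y. f (x - y))" for x
    by (rule continuous_on_compose2[OF f]) (auto intro!: continuous_intros)
  have F: "continuous_on UNIV (\<lambda>p. f (fst p - snd p))"
    by (rule continuous_on_compose2[OF f]) (auto intro!: continuous_intros)
  have "(LINT y|M. f (x - y)) = (LINT y|M. f (- y))" for x
    using integral_translate[OF c[of x], of x] by simp
  then have "(LINT y|M. f (- y)) = (LINT x|M. LINT y|M. f (x - y))"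
    by simp
  also have "\<dots> = (LINT y|M. LINT x|M. f (x - y))"
    using integral_swap[OF F] by simp
  also have "(LINT x|M. f (x - y)) = (LINT x|M. f x)" for y
    using integral_translate[OF f, of "- y"] by (simp add: algebra_simps)
  then have "(LINT y|M. LINT x|M. f (x - y)) = (LINT x|M. f x)"
    by simp
  finally show ?thesis .
qed

end

section \<open>Compactness of convolution operators\<close>

lemma complete_bcontfun: "complete (UNIV :: ('a::topological_space \<Rightarrow>\<^sub>C 'b::complete_space) set)"
proof (rule completeI)
  fix f :: "nat \<Rightarrow> 'a \<Rightarrow>\<^sub>C 'b"
  assume "Cauchy f"
  then obtain g where "uniform_limit UNIV f g sequentially"
    using uniformly_convergent_eq_cauchy[of "\<lambda>_. True" f]
    unfolding Cauchy_def uniform_limit_sequentially_iff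
    by (metis dist_fun_lt_imp_dist_val_lt)
  from uniform_limit_bcontfunE[OF this sequentially_bot]
  show "\<exists>l\<in>UNIV. f \<longlonglongrightarrow> l"
    by auto
qed

text \<open>
  The Arzela--Ascoli theorem on a compact space: equicontinuity reduces a bounded family to its
  values at finitely many points, up to a small error, and a bounded set of finitely many complex
  numbers is totally bounded.
\<close>

lemma arzela_ascoli:
  fixes S :: "('a::topological_space \<Rightarrow>\<^sub>C complex) set"
  assumes compact: "compact (UNIV :: 'a set)"
    and bounded: "\<And>u x. u \<in> S \<Longrightarrow> cmod (u x) \<le> B"
    and equicontinuous: "\<And>x e. e > 0 \<Longrightarrow> \<exists>U. open U \<and> x \<in> U \<and> (\<forall>y\<in>U. \<forall>u\<in>S. dist (u y) (u x) \<le> e)"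
  shows "compact (closure S)"
proof -
  have net: "\<exists>K. finite K \<and> S \<subseteq> (\<Union>v\<in>K. cball v (4 * e))" if e: "e > 0" for e :: real
  proof -
    obtain U where U: "\<And>x. open (U x)" "\<And>x. x \<in> U x" "\<And>x y u. y \<in> U x \<Longrightarrow> u \<in> S \<Longrightarrow> dist (u y) (u x) \<le> e"
      using equicontinuous[OF e] by metis
    obtain A where A: "finite A" "UNIV \<subseteq> (\<Union>a\<in>A. U a)"
      by (rule compactE_image[OF compact, of UNIV U]) (use U in auto)
    obtain D where D: "finite D" "cball (0::complex) B \<subseteq> (\<Union>d\<in>D. ball d e)"
      using compact_cball[of "0::complex" B] e unfolding compact_eq_totally_bounded by blast
    define close where "close u \<phi> \<longleftrightarrow> u \<in> S \<and> (\<forall>a\<in>A. dist (u a) (\<phi> a) < e)" for u \<phi>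
    define K where "K = (\<lambda>\<phi>. SOME u. close u \<phi>) ` (A \<rightarrow>\<^sub>E D)"
    have "finite K"
      unfolding K_def using A(1) D(1) by (intro finite_imageI finite_PiE) auto
    moreover have "S \<subseteq> (\<Union>v\<in>K. cball v (4 * e))"
    proof
      fix u assume u: "u \<in> S"
      have "\<exists>d\<in>D. dist (u a) d < e" for a
        using bounded[OF u, of a] D(2) by (fastforce simp: dist_commute)
      then obtain d where d: "\<And>a. d a \<in> D" "\<And>a. dist (u a) (d a) < e"
        by metis
      define \<phi> where "\<phi> = restrict d A"
      have \<phi>: "\<phi> \<in> A \<rightarrow>\<^sub>E D" "close u \<phi>"
        using d u by (auto simp: \<phi>_def close_def)
      define v where "v = (SOME u. close u \<phi>)"
      have v: "close v \<phi>" "v \<in> K"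
        using someI[of "\<lambda>u. close u \<phi>" u] \<phi> by (auto simp: v_def K_def)
      have "dist (v x) (u x) \<le> 4 * e" for x
      proof -
        obtain a where a: "a \<in> A" "x \<in> U a"
          using A(2) by blast
        have "dist (v x) (v a) \<le> e" "dist (u x) (u a) \<le> e"
          using U(3)[OF a(2)] u v by (auto simp: close_def)
        moreover have "dist (v a) (\<phi> a) < e" "dist (u a) (\<phi> a) < e"
          using a v \<phi> by (auto simp: close_def)
        ultimately show ?thesis
          using dist_triangle[of "v x" "u x" "v a"] dist_triangle[of "v a" "u x" "\<phi> a"]
            dist_triangle[of "\<phi> a" "u x" "u a"] by (simp add: dist_commute)
      qed
      then have "dist v u \<le> 4 * e"
        by (rule dist_bound)
      then show "u \<in> (\<Union>v\<in>K. cball v (4 * e))"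
        using v by auto
    qed
    ultimately show ?thesis
      by blast
  qed
  show ?thesis
    unfolding compact_eq_totally_bounded
  proof (intro conjI allI impI)
    show "complete (closure S)"
      using complete_closed_subset[OF closed_closure subset_UNIV complete_bcontfun] .
    fix e :: real assume "e > 0"
    then obtain K where K: "finite K" "S \<subseteq> (\<Union>v\<in>K. cball v (4 * (e / 8)))"
      using net[of "e / 8"] by auto
    have "closed (\<Union>v\<in>K. cball v (4 * (e / 8)))"
      using K(1) by (intro closed_UN) auto
    then have "closure S \<subseteq> (\<Union>v\<in>K. cball v (4 * (e / 8)))"
      using K(2) by (rule closure_minimal[rotated])
    also have "\<dots> \<subseteq> (\<Union>v\<in>K. ball v e)"
      using \<open>e > 0\<close> by force
    finally show "\<exists>K. finite K \<and> closure S \<subseteq> (\<Union>x\<in>K. ball x e)"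
      using K(1) by blast
  qed
qed

context compact_abelian_group
begin

definition conv :: "('g \<Rightarrow> complex) \<Rightarrow> ('g \<Rightarrow> complex) \<Rightarrow> 'g \<Rightarrow> complex" where
  "conv k h = (\<lambda>x. LINT y|M. k (x - y) * h y)"

lemma continuous_kernel:
  fixes k :: "'g \<Rightarrow> complex"
  assumes "continuous_on UNIV k"
  shows "continuous_on UNIV (\<lambda>p. k (fst p - snd p))" "continuous_on UNIV (\<lambda>y. k (x - y))"
    "continuous_on UNIV (\<lambda>y. k (y - x))"
proof -
  show "continuous_on UNIV (\<lambda>p. k (fst p - snd p))"
    by (rule continuous_on_compose2[OF assms]) (auto intro!: continuous_intros)
  show "continuous_on UNIV (\<lambda>y. k (x - y))" "continuous_on UNIV (\<lambda>y. k (y - x))"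
    by (rule continuous_on_compose2[OF assms]; auto intro!: continuous_intros)+
qed

lemma continuous_conv:
  assumes "continuous_on UNIV k" "continuous_on UNIV h"
  shows "continuous_on UNIV (conv k h)"
proof -
  have "continuous_on UNIV (\<lambda>p::'g \<times> 'g. h (snd p))"
    by (rule continuous_on_compose2[OF assms(2)]) (auto intro!: continuous_intros)
  then have "continuous_on UNIV (\<lambda>p. k (fst p - snd p) * h (snd p))"
    using continuous_kernel(1)[OF assms(1)] by (intro continuous_on_mult)
  from continuous_parametric_integral[OF this] show ?thesis
    by (simp add: conv_def)
qed

lemma conv_eq_inner: "conv k h x = l2_inner M h (\<lambda>y. cnj (k (x - y)))"
  by (simp add: conv_def l2_inner_def mult.commute)

lemma kernel_in_L2:
  assumes "continuous_on UNIV k"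
  shows "(\<lambda>y. cnj (k (x - y))) \<in> L2 M"
  using continuous_kernel(2)[OF assms] by (intro continuous_in_L2 continuous_on_cnj)

lemma norm_conv_le:
  assumes k: "continuous_on UNIV k" and B: "\<And>x. cmod (k x) \<le> B" and h: "h \<in> L2 M"
  shows "cmod (conv k h x) \<le> B * l2_norm M h"
proof -
  have "cmod (conv k h x) \<le> l2_norm M h * l2_norm M (\<lambda>y. cnj (k (x - y)))"
    unfolding conv_eq_inner by (rule l2_cauchy_schwarz[OF h kernel_in_L2[OF k]])
  also have "\<dots> \<le> l2_norm M h * B"
    using B continuous_kernel(2)[OF k]
    by (intro mult_left_mono l2_norm_le_sup continuous_on_cnj) auto
  finally show ?thesis
    by (simp add: mult.commute)
qed

lemma conv_add:
  assumes "continuous_on UNIV k" "f \<in> L2 M" "g \<in> L2 M"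
  shows "conv k (f + g) = conv k f + conv k g"
  using l2_inner_add_left[OF assms(2,3) kernel_in_L2[OF assms(1)]]
  by (intro ext) (simp only: conv_eq_inner plus_fun_apply)

lemma conv_cscale: "conv k (cscale c f) = cscale c (conv k f)"
  by (intro ext) (simp add: conv_eq_inner l2_inner_cscale_left cscale_def[of c "conv k f"])

lemma conv_diff:
  assumes "continuous_on UNIV k" "f \<in> L2 M" "g \<in> L2 M"
  shows "conv k (f - g) = conv k f - conv k g"
  using l2_inner_diff_left[OF assms(2,3) kernel_in_L2[OF assms(1)]]
  by (intro ext) (simp only: conv_eq_inner fun_diff_def)

lemma conv_zero [simp]: "conv k 0 = 0"
  by (intro ext) (simp add: conv_def)

lemma conv_kernel_add:
  assumes "continuous_on UNIV k" "continuous_on UNIV l" "continuous_on UNIV h"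
  shows "conv (k + l) h = conv k h + conv l h"
proof
  fix x
  have "integrable M (\<lambda>y. k (x - y) * h y)" "integrable M (\<lambda>y. l (x - y) * h y)"
    using continuous_kernel(2) assms by (intro continuous_integrable continuous_on_mult; blast)+
  then show "conv (k + l) h x = (conv k h + conv l h) x"
    by (simp add: conv_def distrib_right)
qed

lemma conv_kernel_cscale: "conv (cscale c k) h = cscale c (conv k h)"
  by (intro ext) (simp add: conv_def cscale_def mult.assoc)

lemma conv_translate: "conv k h (x + a) = conv (\<lambda>z. k (z + a)) h x"
  by (simp add: conv_def algebra_simps)

text \<open>
  The kernel of the adjoint of an integral operator is the conjugate kernel with its two variables
  exchanged, and exchanging the variables of \<open>k (x - y)\<close> reflects \<open>k\<close>.
\<close>

lemma conv_adjoint: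
  assumes k: "continuous_on UNIV k" and f: "continuous_on UNIV f" and h: "continuous_on UNIV h"
  shows "l2_inner M (conv k f) h = l2_inner M f (conv (\<lambda>x. cnj (k (- x))) h)"
proof -
  define F where "F p = k (fst p - snd p) * f (snd p) * cnj (h (fst p))" for p
  have "continuous_on UNIV (\<lambda>p::'g \<times> 'g. f (snd p))" "continuous_on UNIV (\<lambda>p::'g \<times> 'g. h (fst p))"
    by (rule continuous_on_compose2[OF f] continuous_on_compose2[OF h]; auto intro!: continuous_intros)+
  then have F: "continuous_on UNIV F"
    unfolding F_def using continuous_kernel(1)[OF k] by (intro continuous_on_mult continuous_on_cnj)
  have inner: "(LINT x|M. F (x, y)) = f y * cnj (conv (\<lambda>x. cnj (k (- x))) h y)" for y
  proof -
    have "F (x, y) = f y * cnj (cnj (k (- (y - x))) * h x)" for x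
      by (simp add: F_def mult_ac)
    then have "(LINT x|M. F (x, y)) = f y * (LINT x|M. cnj (cnj (k (- (y - x))) * h x))"
      by simp
    also have "(LINT x|M. cnj (cnj (k (- (y - x))) * h x)) = cnj (conv (\<lambda>x. cnj (k (- x))) h y)"
      unfolding conv_def by (rule Bochner_Integration.integral_cnj)
    finally show ?thesis .
  qed
  have "l2_inner M (conv k f) h = (LINT x|M. LINT y|M. F (x, y))"
    by (simp add: l2_inner_def conv_def F_def)
  also have "\<dots> = (LINT y|M. LINT x|M. F (x, y))"
    by (rule integral_swap[OF F])
  finally show ?thesis
    by (simp only: inner l2_inner_def)
qed

text \<open>
  Both sides are integral operators, and substituting \<open>x + z - y\<close> for \<open>y\<close> turns the kernel of one
  into that of the other; reflection of the Haar measure enters here.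
\<close>

lemma conv_commute:
  assumes k: "continuous_on UNIV k" and l: "continuous_on UNIV l" and h: "continuous_on UNIV h"
  shows "conv k (conv l h) = conv l (conv k h)"
proof
  fix x
  have eq: "conv k (conv l h) x = (LINT z|M. (LINT y|M. k (x - y) * l (y - z)) * h z)"
    if k: "continuous_on UNIV k" and l: "continuous_on UNIV l" for k l
  proof -
    define F where "F p = k (x - fst p) * l (fst p - snd p) * h (snd p)" for p
    have "continuous_on UNIV (\<lambda>p::'g \<times> 'g. h (snd p))" "continuous_on UNIV (\<lambda>p::'g \<times> 'g. k (x - fst p))"
      by (rule continuous_on_compose2[OF h] continuous_on_compose2[OF k]; auto intro!: continuous_intros)+
    then have F: "continuous_on UNIV F"
      unfolding F_def using continuous_kernel(1)[OF l] by (intro continuous_on_mult)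
    have "conv k (conv l h) x = (LINT y|M. LINT z|M. F (y, z))"
      by (simp add: conv_def F_def mult.assoc)
    also have "\<dots> = (LINT z|M. LINT y|M. F (y, z))"
      by (rule integral_swap[OF F])
    finally show ?thesis
      by (simp add: F_def)
  qed
  have "(LINT y|M. k (x - y) * l (y - z)) = (LINT y|M. l (x - y) * k (y - z))" for z
  proof -
    define \<phi> where "\<phi> y = k (x - y) * l (y - z)" for y
    have \<phi>: "continuous_on UNIV \<phi>"
      unfolding \<phi>_def using continuous_kernel(2)[OF k] continuous_kernel(3)[OF l] by (intro continuous_on_mult)
    have \<phi>': "continuous_on UNIV (\<lambda>y. \<phi> (x + z + y))"
      by (rule continuous_on_compose2[OF \<phi>]) (auto intro!: continuous_intros)
    have "(LINT y|M. \<phi> y) = (LINT y|M. \<phi> (x + z + y))"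
      using integral_translate[OF \<phi>, of "x + z"] by simp
    also have "\<dots> = (LINT y|M. \<phi> (x + z - y))"
      using integral_reflect[OF \<phi>'] by simp
    finally show ?thesis
      by (simp add: \<phi>_def algebra_simps)
  qed
  then show "conv k (conv l h) x = conv l (conv k h) x"
    by (simp add: eq[OF k l] eq[OF l k])
qed

text \<open>
  The values of \<open>conv k h\<close> are inner products of \<open>h\<close> with translates of \<open>k\<close>. These depend
  continuously on the translation in the supremum norm, so \<open>h\<close> in the unit ball of the space
  \<open>L\<^sup>2\<close> give a bounded equicontinuous family of functions \<open>conv k h\<close>.
\<close>

lemma conv_compact:
  assumes k: "continuous_on UNIV k" and h: "\<And>n::nat. continuous_on UNIV (h n)" "\<And>n. l2_norm M (h n) \<le> 1"
  shows "\<exists>s w. strict_mono (s :: nat \<Rightarrow> nat) \<and> continuous_on UNIV w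
           \<and> uniform_limit UNIV (\<lambda>n. conv k (h (s n))) w sequentially"
proof -
  obtain B where B: "\<And>x. cmod (k x) \<le> B"
    using continuous_bounded[OF k] by auto
  define u where "u n = Bcontfun (conv k (h n))" for n
  have hL: "h n \<in> L2 M" for n
    using h(1) by (rule continuous_in_L2)
  have le: "cmod (conv k (h n) x) \<le> B" for n x
    using norm_conv_le[OF k B hL, of n x] h(2)[of n] B[of 0] norm_ge_zero[of "k 0"]
      mult_left_le[of "l2_norm M (h n)" B] by linarith
  have u: "apply_bcontfun (u n) = conv k (h n)" for n
    unfolding u_def using continuous_conv[OF k h(1)] le by (intro Bcontfun_inverse bcontfun_normI)
  have "compact (closure (range u))"
  proof (rule arzela_ascoli[OF compact_group])
    show "cmod (v x) \<le> B" if "v \<in> range u" for v x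
      using that le by (auto simp: u)
    fix x :: 'g and e :: real assume "e > 0"
    obtain U where U: "x \<in> U" "open U"
      "\<forall>y\<in>U \<inter> UNIV. \<forall>t\<in>UNIV. dist (k (fst (y, t) - snd (y, t))) (k (fst (x, t) - snd (x, t))) \<le> e"
      by (rule continuous_on_prod_compactE[of UNIV UNIV "\<lambda>p. k (fst p - snd p)" x e])
         (use continuous_kernel(1)[OF k] \<open>e > 0\<close> compact_group in auto)
    have "dist (u n y) (u n x) \<le> e" if "y \<in> U" for y n
    proof -
      have "u n y - u n x = l2_inner M (h n) ((\<lambda>t. cnj (k (y - t))) - (\<lambda>t. cnj (k (x - t))))"
        unfolding u conv_eq_inner by (rule l2_inner_diff_right[symmetric]; intro hL kernel_in_L2 k)
      also have "cmod \<dots> \<le> l2_norm M (h n) * l2_norm M ((\<lambda>t. cnj (k (y - t))) - (\<lambda>t. cnj (k (x - t))))"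
        by (intro l2_cauchy_schwarz hL L2_diff kernel_in_L2 k)
      also have "\<dots> \<le> 1 * e"
      proof (rule mult_mono)
        have "cmod (k (y - t) - k (x - t)) \<le> e" for t
          using U(3) that by (simp add: dist_norm)
        then have "cmod (cnj (k (y - t)) - cnj (k (x - t))) \<le> e" for t
          using complex_mod_cnj[of "k (y - t) - k (x - t)"] by simp
        then show "l2_norm M ((\<lambda>t. cnj (k (y - t))) - (\<lambda>t. cnj (k (x - t)))) \<le> e"
          unfolding fun_diff_def using continuous_kernel(2)[OF k]
          by (intro l2_norm_le_sup continuous_on_diff continuous_on_cnj) auto
      qed (use h(2) in auto)
      finally show ?thesis
        by (simp add: dist_norm)
    qed
    then show "\<exists>U. open U \<and> x \<in> U \<and> (\<forall>y\<in>U. \<forall>v\<in>range u. dist (v y) (v x) \<le> e)"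
      using U by blast
  qed
  then have "seq_compact (closure (range u))"
    by (simp add: compact_eq_seq_compact_metric)
  then obtain l s where "strict_mono (s :: nat \<Rightarrow> nat)" and lim: "(u \<circ> s) \<longlonglongrightarrow> l"
    by (rule seq_compactE[of _ u]) (auto intro: closure_subset[THEN subsetD])
  moreover have "uniform_limit UNIV (\<lambda>n. conv k (h (s n))) l sequentially"
    using tendsto_bcontfun_uniform_limit[OF lim] by (simp add: u o_def)
  ultimately show ?thesis
    using continuous_on_apply_bcontfun[of UNIV l] by blast
qed

lemma uniform_limit_l2_norm:
  assumes "\<And>n. continuous_on UNIV (f n)" "continuous_on UNIV w" "uniform_limit UNIV f w sequentially"
  shows "(\<lambda>n. l2_norm M (f n - w)) \<longlonglongrightarrow> 0"
proof (rule LIMSEQ_I)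
  fix e :: real assume "e > 0"
  then have "\<forall>\<^sub>F n in sequentially. \<forall>x\<in>UNIV. dist (f n x) (w x) < e / 2"
    by (intro uniform_limitD[OF assms(3)]) simp
  then obtain N where N: "\<And>n x. n \<ge> N \<Longrightarrow> dist (f n x) (w x) < e / 2"
    by (auto simp: eventually_sequentially)
  have "norm (l2_norm M (f n - w) - 0) < e" if "n \<ge> N" for n
  proof -
    have "l2_norm M (\<lambda>x. f n x - w x) \<le> e / 2"
      using assms N[OF that] by (intro l2_norm_le_sup continuous_on_diff) (auto simp: dist_norm intro: less_imp_le)
    then show ?thesis
      using \<open>e > 0\<close> by (simp add: fun_diff_def)
  qed
  then show "\<exists>N. \<forall>n\<ge>N. norm (l2_norm M (f n - w) - 0) < e"
    by blast
qed

end

section \<open>Eigenvectors of Hermitian convolution operators\<close>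

context compact_abelian_group
begin

text \<open>
  The nonempty sets of this kind are the uniformly closed ideals of the algebra of continuous functions
  with convolution as its product.
\<close>

definition convolution_module :: "('g \<Rightarrow> complex) set \<Rightarrow> bool" where
  "convolution_module V \<longleftrightarrow>
     (\<forall>f\<in>V. continuous_on UNIV f) \<and>
     (\<forall>f\<in>V. \<forall>g\<in>V. f + g \<in> V) \<and>
     (\<forall>c. \<forall>f\<in>V. cscale c f \<in> V) \<and>
     (\<forall>k. continuous_on UNIV k \<longrightarrow> (\<forall>f\<in>V. conv k f \<in> V)) \<and>
     (\<forall>f w. (\<forall>n. f n \<in> V) \<longrightarrow> uniform_limit UNIV f w sequentially \<longrightarrow> w \<in> V)"

lemma convolution_moduleI:
  assumes "\<And>f. f \<in> V \<Longrightarrow> continuous_on UNIV f"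
    and "\<And>f g. f \<in> V \<Longrightarrow> g \<in> V \<Longrightarrow> f + g \<in> V"
    and "\<And>c f. f \<in> V \<Longrightarrow> cscale c f \<in> V"
    and "\<And>k f. continuous_on UNIV k \<Longrightarrow> f \<in> V \<Longrightarrow> conv k f \<in> V"
    and "\<And>f w. (\<And>n. f n \<in> V) \<Longrightarrow> uniform_limit UNIV f w sequentially \<Longrightarrow> w \<in> V"
  shows "convolution_module V"
  unfolding convolution_module_def
proof (intro conjI allI impI)
  show "w \<in> V" if "\<forall>n. f n \<in> V" "uniform_limit UNIV f w sequentially" for f w
    by (rule assms(5)[of f w]) (use that in auto)
qed (use assms(1-4) in auto)

lemma convolution_moduleD:
  assumes "convolution_module V"
  shows "f \<in> V \<Longrightarrow> continuous_on UNIV f"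
    and "f \<in> V \<Longrightarrow> g \<in> V \<Longrightarrow> f + g \<in> V"
    and "f \<in> V \<Longrightarrow> cscale c f \<in> V"
    and "f \<in> V \<Longrightarrow> g \<in> V \<Longrightarrow> f - g \<in> V"
    and "continuous_on UNIV k \<Longrightarrow> f \<in> V \<Longrightarrow> conv k f \<in> V"
    and "(\<And>n. F n \<in> V) \<Longrightarrow> uniform_limit UNIV F w sequentially \<Longrightarrow> w \<in> V"
    and "f \<in> V \<Longrightarrow> f \<in> L2 M"
  using assms continuous_in_L2 unfolding convolution_module_def diff_eq_add_cscale by blast+

lemma norm_le_imp_tendsto_zero:
  assumes "\<And>n. cmod (f n) \<le> c * g n" "g \<longlonglongrightarrow> (0 :: real)"
  shows "f \<longlonglongrightarrow> 0"
  by (rule Lim_null_comparison[OF _ tendsto_mult_right_zero[OF assms(2), of c]]) (simp add: assms(1))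

text \<open>
  Let \<open>L\<close> be the norm of the operator on the module \<open>V\<close>, with respect to the norm of the space
  \<open>L\<^sup>2\<close>. For unit vectors on which the norm \<open>L\<close> is almost attained, self-adjointness shows that the
  square of the operator almost multiplies them by \<open>L\<^sup>2\<close>. Their images have a uniformly
  convergent subsequence by compactness, and its limit is an eigenvector of the square. The limit is
  uniform, hence stays in \<open>V\<close>, so that no completion of \<open>V\<close> is needed.
\<close>

lemma conv_square_eigenvector:
  assumes V: "convolution_module V"
    and k: "continuous_on UNIV k" and sym: "\<And>x. k (- x) = cnj (k x)"
    and f: "f \<in> V" "conv k f \<noteq> 0"
  shows "\<exists>L::real. \<exists>w\<in>V. L > 0 \<and> w \<noteq> 0 \<and> conv k (conv k w) = cscale (of_real (L\<^sup>2)) w"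
proof -
  note VD = convolution_moduleD[OF V]
  have sa: "l2_inner M (conv k g) h = l2_inner M g (conv k h)"
    if "continuous_on UNIV g" "continuous_on UNIV h" for g h
    using conv_adjoint[OF k that] sym by simp
  obtain B where B: "B > 0" "\<And>x. cmod (k x) \<le> B"
    using continuous_bounded[OF k] by auto
  have bound: "l2_norm M (conv k g) \<le> B * l2_norm M g" if "continuous_on UNIV g" for g
    using that by (intro l2_norm_le_sup continuous_conv k norm_conv_le B continuous_in_L2)
  define N where "N = (\<lambda>g. l2_norm M (conv k g)) ` {g\<in>V. l2_norm M g \<le> 1}"
  define L where "L = Sup N"
  have bdd: "bdd_above N"
  proof (rule bdd_aboveI)
    fix y assume "y \<in> N"
    then obtain g where g: "g \<in> V" "l2_norm M g \<le> 1" "y = l2_norm M (conv k g)"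
      by (auto simp: N_def)
    show "y \<le> B"
      using bound[OF VD(1)[OF g(1)]] g B(1) mult_left_le[of "l2_norm M g" B] by linarith
  qed
  have homogeneous: "l2_norm M (conv k g) \<le> L * l2_norm M g" if g: "g \<in> V" for g
  proof (cases "l2_norm M g = 0")
    case True
    then have "g = 0"
      using l2_norm_eq_0_continuous VD(1) g by blast
    then show ?thesis
      by simp
  next
    case False
    then have pos: "l2_norm M g > 0"
      using l2_norm_nonneg[of M g] by linarith
    let ?u = "cscale (of_real (1 / l2_norm M g)) g"
    have "?u \<in> V" "l2_norm M ?u = 1"
      using VD(3)[OF g] pos by (auto simp: l2_norm_cscale norm_divide)
    then have "l2_norm M (conv k ?u) \<le> L"
      unfolding L_def N_def using bdd[unfolded N_def] by (intro cSUP_upper) auto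
    then show ?thesis
      using pos by (simp add: conv_cscale l2_norm_cscale norm_divide field_simps)
  qed
  have "conv k f \<in> V"
    by (rule VD(5)[OF k f(1)])
  then have "l2_norm M (conv k f) \<noteq> 0"
    using l2_norm_eq_0_continuous VD(1) f(2) by blast
  then have "0 < L * l2_norm M f"
    using homogeneous[OF f(1)] l2_norm_nonneg[of M "conv k f"] by linarith
  then have L: "L > 0"
    using l2_norm_nonneg[of M f] by (simp add: zero_less_mult_iff)
  have "\<exists>g\<in>V. l2_norm M g \<le> 1 \<and> L - 1 / (Suc n) < l2_norm M (conv k g)" for n
  proof -
    have "0 \<in> V"
      using VD(3)[OF f(1), of 0] by (simp add: cscale_def zero_fun_def)
    then have "N \<noteq> {}"
      by (auto simp: N_def)
    then obtain y where "y \<in> N" "L - 1 / (Suc n) < y"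
      using less_cSupE[of "L - 1 / Suc n" N] by (auto simp: L_def)
    then show ?thesis
      by (auto simp: N_def)
  qed
  then obtain h where h: "\<And>n. h n \<in> V" "\<And>n. l2_norm M (h n) \<le> 1"
    "\<And>n. L - 1 / (Suc n) < l2_norm M (conv k (h n))"
    by metis
  have ub: "l2_norm M (conv k (h n)) \<le> L" for n
    using homogeneous[OF h(1), of n] mult_left_le[OF h(2)[of n], of L] L by linarith
  have normlim: "(\<lambda>n. l2_norm M (conv k (h n))) \<longlonglongrightarrow> L"
  proof (rule tendsto_sandwich)
    show "(\<lambda>n. L - 1 / Suc n) \<longlonglongrightarrow> L"
      using tendsto_diff[OF tendsto_const[of L] LIMSEQ_Suc[OF lim_1_over_n]] by simp
    show "\<forall>\<^sub>F n in sequentially. L - 1 / Suc n \<le> l2_norm M (conv k (h n))"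
      by (rule always_eventually) (use h(3) in \<open>blast intro: less_imp_le\<close>)
    show "\<forall>\<^sub>F n in sequentially. l2_norm M (conv k (h n)) \<le> L"
      using ub by auto
  qed auto
  obtain s w where s: "strict_mono s" and w: "continuous_on UNIV w"
    and ulim: "uniform_limit UNIV (\<lambda>n. conv k (h (s n))) w sequentially"
    using conv_compact[of k h, OF k VD(1)[OF h(1)] h(2)] by blast
  define g where "g n = h (s n)" for n
  define Tg where "Tg n = conv k (g n)" for n
  have gV: "g n \<in> V" and gc: "continuous_on UNIV (g n)" and gL: "g n \<in> L2 M" for n
    using h VD by (auto simp: g_def)
  have TgV: "Tg n \<in> V" and Tgc: "continuous_on UNIV (Tg n)" and TgL: "Tg n \<in> L2 M" for n
    using VD(5)[OF k gV] VD by (auto simp: Tg_def)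
  have wL: "w \<in> L2 M"
    using w by (rule continuous_in_L2)
  have ulim: "uniform_limit UNIV Tg w sequentially"
  proof -
    have "Tg = (\<lambda>n. conv k (h (s n)))"
      by (simp add: Tg_def g_def fun_eq_iff)
    then show ?thesis
      using ulim by simp
  qed
  have wV: "w \<in> V"
    by (rule VD(6)[of Tg w, OF TgV ulim])
  have l2lim: "(\<lambda>n. l2_norm M (Tg n - w)) \<longlonglongrightarrow> 0"
    by (rule uniform_limit_l2_norm[of Tg w, OF Tgc w ulim])
  have Tgnorm: "(\<lambda>n. l2_norm M (Tg n)) \<longlonglongrightarrow> L"
    using LIMSEQ_subseq_LIMSEQ[OF normlim s] by (simp add: o_def Tg_def g_def)
  have "l2_norm M w = L"
    by (rule LIMSEQ_unique[OF l2_norm_tendsto[of Tg M w, OF TgL wL l2lim] Tgnorm])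
  then have w0: "w \<noteq> 0"
    using L by auto

  \<comment> \<open>Almost maximal vectors are almost eigenvectors of the square of the operator.\<close>
  define d where "d n = conv k (Tg n) - cscale (of_real (L\<^sup>2)) (g n)" for n
  have dL: "d n \<in> L2 M" for n
    unfolding d_def using VD(5)[OF k TgV] VD(7) by (intro L2_diff L2_cscale gL) blast
  have dle: "(l2_norm M (d n))\<^sup>2 \<le> L\<^sup>2 * (L\<^sup>2 - (l2_norm M (Tg n))\<^sup>2)" for n
  proof -
    have "l2_inner M (conv k (Tg n)) (cscale (of_real (L\<^sup>2)) (g n)) = of_real (L\<^sup>2 * (l2_norm M (Tg n))\<^sup>2)"
      using sa[OF Tgc gc, of n n] by (simp add: l2_inner_cscale_right Tg_def[symmetric] l2_inner_self)
    then have "(l2_norm M (d n))\<^sup>2 = (l2_norm M (conv k (Tg n)))\<^sup>2 - 2 * (L\<^sup>2 * (l2_norm M (Tg n))\<^sup>2)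
        + L\<^sup>2 * L\<^sup>2 * (l2_norm M (g n))\<^sup>2"
      unfolding d_def using VD(5)[OF k TgV] VD(7)
      by (subst l2_norm_diff_square) (auto intro!: L2_cscale gL simp: l2_norm_cscale power_mult_distrib norm_power norm_mult power2_eq_square)
    moreover have "(l2_norm M (conv k (Tg n)))\<^sup>2 \<le> (L * l2_norm M (Tg n))\<^sup>2"
      by (rule power_mono[OF homogeneous[OF TgV]]) simp
    moreover have "(l2_norm M (g n))\<^sup>2 \<le> 1"
      using h(2) by (simp add: g_def power_le_one)
    then have "L\<^sup>2 * L\<^sup>2 * (l2_norm M (g n))\<^sup>2 \<le> L\<^sup>2 * L\<^sup>2"
      by (simp add: mult_left_le)
    ultimately show ?thesis
      by (simp add: power_mult_distrib algebra_simps)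
  qed
  have "(\<lambda>n. L\<^sup>2 * (L\<^sup>2 - (l2_norm M (Tg n))\<^sup>2)) \<longlonglongrightarrow> L\<^sup>2 * (L\<^sup>2 - L\<^sup>2)"
    by (intro tendsto_intros Tgnorm)
  then have "(\<lambda>n. (l2_norm M (d n))\<^sup>2) \<longlonglongrightarrow> 0"
    using dle by (intro tendsto_sandwich[of "\<lambda>_. 0" "\<lambda>n. (l2_norm M (d n))\<^sup>2" sequentially
          "\<lambda>n. L\<^sup>2 * (L\<^sup>2 - (l2_norm M (Tg n))\<^sup>2)" 0]) auto
  then have dlim: "(\<lambda>n. l2_norm M (d n)) \<longlonglongrightarrow> 0"
    using tendsto_real_sqrt[of "\<lambda>n. (l2_norm M (d n))\<^sup>2" 0 sequentially] by simp

  have "conv k (conv k w) x = of_real (L\<^sup>2) * w x" for x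
  proof -
    have "conv k (d n) = conv k (conv k (Tg n)) - cscale (of_real (L\<^sup>2)) (conv k (g n))" for n
      unfolding d_def conv_diff[OF k VD(7)[OF VD(5)[OF k TgV]] L2_cscale[OF gL]] conv_cscale ..
    then have "conv k (d n) x = conv k (conv k (Tg n)) x - of_real (L\<^sup>2) * Tg n x" for n
      by (simp add: cscale_def Tg_def)
    moreover have "(\<lambda>n. conv k (d n) x) \<longlonglongrightarrow> 0"
      using norm_conv_le[OF k B(2) dL] dlim by (rule norm_le_imp_tendsto_zero)
    moreover have "(\<lambda>n. Tg n x) \<longlonglongrightarrow> w x"
      by (rule tendsto_uniform_limitI[OF ulim]) simp
    moreover have "(\<lambda>n. conv k (conv k (Tg n)) x - conv k (conv k w) x) \<longlonglongrightarrow> 0"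
    proof (rule norm_le_imp_tendsto_zero[OF _ l2lim])
      fix n
      note diffV = VD(4)[OF TgV[of n] wV]
      have L2: "continuous_on UNIV (Tg n - w)" "conv k (Tg n - w) \<in> L2 M"
        by (rule VD(1)[OF diffV], rule VD(7)[OF VD(5)[OF k diffV]])
      have "conv k (conv k (Tg n)) x - conv k (conv k w) x = conv k (conv k (Tg n - w)) x"
        unfolding conv_diff[OF k TgL wL] conv_diff[OF k VD(7)[OF VD(5)[OF k TgV]] VD(7)[OF VD(5)[OF k wV]]]
        by simp
      also have "cmod \<dots> \<le> B * l2_norm M (conv k (Tg n - w))"
        by (rule norm_conv_le[OF k B(2) L2(2)])
      also have "\<dots> \<le> B * (B * l2_norm M (Tg n - w))"
        using bound[OF L2(1)] B(1) by simp
      finally show "cmod (conv k (conv k (Tg n)) x - conv k (conv k w) x) \<le> (B * B) * l2_norm M (Tg n - w)"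
        by simp
    qed
    then have "(\<lambda>n. conv k (conv k (Tg n)) x) \<longlonglongrightarrow> conv k (conv k w) x"
      by (rule LIM_zero_cancel)
    ultimately have "(\<lambda>n. conv k (d n) x) \<longlonglongrightarrow> conv k (conv k w) x - of_real (L\<^sup>2) * w x"
      by (auto intro!: tendsto_intros)
    then have "conv k (conv k w) x - of_real (L\<^sup>2) * w x = 0"
      using \<open>(\<lambda>n. conv k (d n) x) \<longlonglongrightarrow> 0\<close> LIMSEQ_unique by blast
    then show ?thesis
      by simp
  qed
  then have "conv k (conv k w) = cscale (of_real (L\<^sup>2)) w"
    by (auto simp: cscale_def)
  then show ?thesis
    using L w0 wV by blast
qed

text \<open>
  Writing \<open>T\<close> for the operator, \<open>T\<^sup>2 w = L\<^sup>2 w\<close> means that \<open>T - L\<close> annihilates \<open>T w + L w\<close>: either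
  this is an eigenvector for \<open>L\<close>, or it is zero and \<open>w\<close> is an eigenvector for \<open>- L\<close>.
\<close>

lemma conv_eigenvector:
  assumes V: "convolution_module V"
    and k: "continuous_on UNIV k" and sym: "\<And>x. k (- x) = cnj (k x)"
    and f: "f \<in> V" "conv k f \<noteq> 0"
  shows "\<exists>L::real. \<exists>w\<in>V. L \<noteq> 0 \<and> w \<noteq> 0 \<and> conv k w = cscale (of_real L) w"
proof -
  note VD = convolution_moduleD[OF V]
  obtain L w where L: "(L::real) > 0" and w: "w \<in> V" "w \<noteq> 0"
    and eq: "conv k (conv k w) = cscale (of_real (L\<^sup>2)) w"
    using conv_square_eigenvector[of V k f, OF V k sym f] by blast
  define u where "u = conv k w + cscale (of_real L) w"
  have u: "u \<in> V"
    unfolding u_def by (intro VD(2) VD(3) VD(5) k w)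
  have "conv k u = conv k (conv k w) + cscale (of_real L) (conv k w)"
    unfolding u_def conv_add[OF k VD(7)[OF VD(5)[OF k w(1)]] VD(7)[OF VD(3)[OF w(1)]]] conv_cscale ..
  also have "\<dots> = cscale (of_real L) u"
    unfolding eq u_def by (auto simp: cscale_def power2_eq_square algebra_simps)
  finally have cu: "conv k u = cscale (of_real L) u" .
  show ?thesis
  proof (cases "u = 0")
    case True
    have "conv k w x + of_real L * w x = 0" for x
      using fun_cong[OF True[unfolded u_def], of x] by (simp only: plus_fun_apply zero_fun_apply cscale_def)
    then have "conv k w = cscale (of_real (- L)) w"
      by (intro ext) (simp add: cscale_def eq_neg_iff_add_eq_0)
    then show ?thesis
      using w L by (intro exI[of _ "- L"] bexI[of _ w]) auto
  next
    case False
    then show ?thesis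
      using u cu L by (intro exI[of _ L] bexI[of _ u]) auto
  qed
qed

text \<open>
  For finite-dimensional \<open>V\<close> the least such \<open>n\<close> is the dimension of \<open>V\<close>; measured by orthonormal
  families, it can be compared for a module and an eigenspace in it without choosing bases.
\<close>

definition orthonormal_size_le :: "('g \<Rightarrow> complex) set \<Rightarrow> nat \<Rightarrow> bool" where
  "orthonormal_size_le V n \<longleftrightarrow>
     (\<forall>m e. (\<forall>i<m. e i \<in> V) \<and> (\<forall>i<m. \<forall>j<m. l2_inner M (e i) (e j) = (if i = j then 1 else 0)) \<longrightarrow> m \<le> n)"

text \<open>
  At each point, the numbers \<open>L * e i x\<close> for an orthonormal family of eigenfunctions are the Fourier
  coefficients of a translate of the kernel, so Bessel's inequality bounds the sum of their squares
  by \<open>B\<^sup>2\<close>. Integration over \<open>x\<close> bounds the number of the functions by \<open>B\<^sup>2 / \<bar>L\<bar>\<^sup>2\<close>.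
\<close>

lemma orthonormal_size_le_eigenspace:
  assumes k: "continuous_on UNIV k" and L: "L \<noteq> 0"
    and V: "\<And>f. f \<in> V \<Longrightarrow> continuous_on UNIV f" "\<And>f. f \<in> V \<Longrightarrow> conv k f = cscale L f"
  shows "\<exists>n. orthonormal_size_le V n"
proof -
  obtain B where B: "\<And>x. cmod (k x) \<le> B"
    using continuous_bounded[OF k] by auto
  have "m \<le> nat \<lceil>B\<^sup>2 / (cmod L)\<^sup>2\<rceil>"
    if e: "\<forall>i<m. e i \<in> V" and orth: "\<forall>i<m. \<forall>j<m. l2_inner M (e i) (e j) = (if i = j then 1 else 0)"
    for m and e :: "nat \<Rightarrow> 'g \<Rightarrow> complex"
  proof -
    have eL: "e i \<in> L2 M" and ec: "continuous_on UNIV (e i)" if "i < m" for i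
      using V(1) e that continuous_in_L2 by blast+
    have pointwise: "(\<Sum>i<m. (cmod L)\<^sup>2 * (cmod (e i x))\<^sup>2) \<le> B\<^sup>2" for x
    proof -
      have "cmod (l2_inner M (\<lambda>y. cnj (k (x - y))) (e i)) = cmod L * cmod (e i x)" if "i < m" for i
      proof -
        have "L * e i x = l2_inner M (e i) (\<lambda>y. cnj (k (x - y)))"
          using V(2) e that by (simp add: conv_eq_inner[symmetric] cscale_def)
        then show ?thesis
          by (subst l2_inner_commute) (simp add: norm_mult[symmetric])
      qed
      then have "(\<Sum>i<m. (cmod L)\<^sup>2 * (cmod (e i x))\<^sup>2)
          = (\<Sum>i<m. (cmod (l2_inner M (\<lambda>y. cnj (k (x - y))) (e i)))\<^sup>2)"
        by (intro sum.cong) (auto simp: power_mult_distrib)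
      also have "\<dots> \<le> (l2_norm M (\<lambda>y. cnj (k (x - y))))\<^sup>2"
        by (rule bessel_inequality) (use eL orth kernel_in_L2[OF k] in auto)
      also have "\<dots> \<le> B\<^sup>2"
        using B continuous_kernel(2)[OF k]
        by (intro power_mono l2_norm_le_sup continuous_on_cnj) auto
      finally show ?thesis .
    qed
    have "(\<Sum>i<m. (cmod L)\<^sup>2 * (l2_norm M (e i))\<^sup>2) = (LINT x|M. (\<Sum>i<m. (cmod L)\<^sup>2 * (cmod (e i x))\<^sup>2))"
      using ec by (subst Bochner_Integration.integral_sum)
        (auto intro!: continuous_integrable continuous_intros simp: l2_norm_def)
    also have "\<dots> \<le> (LINT x|M. B\<^sup>2)"
      using ec pointwise by (intro integral_mono) (auto intro!: continuous_integrable continuous_intros)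
    finally have "(\<Sum>i<m. (cmod L)\<^sup>2 * (l2_norm M (e i))\<^sup>2) \<le> B\<^sup>2"
      by simp
    moreover have "(l2_norm M (e i))\<^sup>2 = 1" if "i < m" for i
      using orth that by (simp add: l2_norm_square)
    ultimately have "real m * (cmod L)\<^sup>2 \<le> B\<^sup>2"
      by simp
    then have "real m \<le> B\<^sup>2 / (cmod L)\<^sup>2"
      using L by (simp add: field_simps)
    then show ?thesis
      by linarith
  qed
  then show ?thesis
    unfolding orthonormal_size_le_def by blast
qed

lemma convolution_module_eigenspace:
  assumes V: "convolution_module V" and k: "continuous_on UNIV k"
  shows "convolution_module {g\<in>V. conv k g = cscale L g}"
proof -
  note VD = convolution_moduleD[OF V]
  have lim: "conv k w = cscale L w"
    if F: "\<And>n. F n \<in> V" "\<And>n. conv k (F n) = cscale L (F n)" and ulim: "uniform_limit UNIV F w sequentially" for F w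
  proof
    fix x
    have w: "w \<in> V"
      using F(1) ulim by (rule VD(6))
    have "(\<lambda>n. conv k (F n) x) \<longlonglongrightarrow> conv k w x"
      unfolding conv_eq_inner
      using F VD w by (intro l2_inner_tendsto kernel_in_L2 k uniform_limit_l2_norm ulim) auto
    moreover have "(\<lambda>n. conv k (F n) x) \<longlonglongrightarrow> L * w x"
      unfolding F(2) cscale_def by (intro tendsto_mult tendsto_const tendsto_uniform_limitI[OF ulim]) simp
    ultimately show "conv k w x = cscale L w x"
      using LIMSEQ_unique by (fastforce simp: cscale_def)
  qed
  have add: "conv k (f + g) = cscale L (f + g)"
    if "f \<in> V" "g \<in> V" "conv k f = cscale L f" "conv k g = cscale L g" for f g
    using conv_add[OF k VD(7)[OF that(1)] VD(7)[OF that(2)]] that by (auto simp: cscale_def algebra_simps)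
  have scale: "conv k (cscale c f) = cscale L (cscale c f)" if "conv k f = cscale L f" for c f
    unfolding conv_cscale that by (simp add: cscale_def mult.left_commute)
  have cv: "conv k (conv l f) = cscale L (conv l f)"
    if "f \<in> V" "conv k f = cscale L f" "continuous_on UNIV l" for l f
    using conv_commute[OF k that(3) VD(1)[OF that(1)]] that by (simp add: conv_cscale)
  show ?thesis
  proof (rule convolution_moduleI)
    fix F w assume "\<And>n. F n \<in> {g \<in> V. conv k g = cscale L g}" and "uniform_limit UNIV F w sequentially"
    then show "w \<in> {g \<in> V. conv k g = cscale L g}"
      using lim[of F w] VD(6)[of F w] by simp
  next
    show "f + g \<in> {g \<in> V. conv k g = cscale L g}"
      if "f \<in> {g \<in> V. conv k g = cscale L g}" "g \<in> {g \<in> V. conv k g = cscale L g}" for f g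
      using that VD(2)[of f g] add[of f g] by blast
    show "cscale c f \<in> {g \<in> V. conv k g = cscale L g}"
      if "f \<in> {g \<in> V. conv k g = cscale L g}" for c f
      using that VD(3)[of f c] scale[of f c] by blast
    show "conv l f \<in> {g \<in> V. conv k g = cscale L g}"
      if "continuous_on UNIV l" "f \<in> {g \<in> V. conv k g = cscale L g}" for l f
      using that VD(5)[of l f] cv[of f l] by blast
  qed (use VD(1) in blast)
qed

end

section \<open>Characters exist and separate points\<close>

lemma characterD:
  assumes "\<phi> \<in> characters"
  shows "continuous_on UNIV \<phi>" "\<phi> (x + y) = \<phi> x * \<phi> y" "cmod (\<phi> x) = 1"
    "\<phi> x * cnj (\<phi> x) = 1" "\<phi> x \<noteq> 0" "\<phi> 0 = 1" "\<phi> (- x) = cnj (\<phi> x)"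
proof -
  show c: "continuous_on UNIV \<phi>" "\<phi> (x + y) = \<phi> x * \<phi> y" and n: "cmod (\<phi> x) = 1" for x y
    using assms by (auto simp: characters_def)
  then show u: "\<phi> x * cnj (\<phi> x) = 1" for x
    by (simp add: complex_norm_square[symmetric])
  then show nz: "\<phi> x \<noteq> 0" for x
    by (metis mult_zero_left zero_neq_one)
  have "\<phi> 0 * \<phi> 0 = \<phi> 0 * 1"
    using c(2)[of 0 0] by simp
  then show z: "\<phi> 0 = 1"
    using nz by (simp only: mult_left_cancel simp_thms)
  have "\<phi> x * \<phi> (- x) = \<phi> x * cnj (\<phi> x)"
    using c(2)[of x "- x"] u[of x] z by simp
  then show "\<phi> (- x) = cnj (\<phi> x)"
    using nz by (simp only: mult_left_cancel simp_thms)
qed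

context compact_abelian_group
begin

lemma character_in_L2: "\<phi> \<in> characters \<Longrightarrow> \<phi> \<in> L2 M"
  by (rule continuous_in_L2[OF characterD(1)])

text \<open>
  A value of modulus greater than \<open>1\<close> would have unbounded powers, which are again values; a value of
  modulus less than \<open>1\<close> is the inverse of such a value.
\<close>

lemma bounded_multiplicative_norm_1:
  fixes \<phi> :: "'g \<Rightarrow> complex"
  assumes mult: "\<And>x y. \<phi> (x + y) = \<phi> x * \<phi> y" and one: "\<phi> 0 = 1" and B: "\<And>x. cmod (\<phi> x) \<le> B"
  shows "cmod (\<phi> x) = 1"
proof -
  have le: "cmod (\<phi> x) \<le> 1" for x
  proof (rule ccontr)
    assume "\<not> cmod (\<phi> x) \<le> 1"
    then obtain n where "B < cmod (\<phi> x) ^ n"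
      using real_arch_pow[of "cmod (\<phi> x)" B] by auto
    moreover have "\<exists>y. \<phi> y = \<phi> x ^ n"
      by (induct n) (use mult one in \<open>auto intro: exI[of _ 0] simp flip: power_Suc\<close>, metis mult power_Suc)
    ultimately show False
      using B by (metis norm_power not_less)
  qed
  have "cmod (\<phi> x) * cmod (\<phi> (- x)) = 1"
    using mult[of x "- x"] one by (simp flip: norm_mult)
  then have "1 \<le> cmod (\<phi> x)"
    using le[of "- x"] mult_left_le[of "cmod (\<phi> (- x))" "cmod (\<phi> x)"] by simp
  then show ?thesis
    using le[of x] by simp
qed

lemma hermitian_decomposition:
  fixes k :: "'g \<Rightarrow> complex"
  assumes k: "continuous_on UNIV k"
  obtains k1 k2 where "continuous_on UNIV k1" "\<forall>x. k1 (- x) = cnj (k1 x)"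
    "continuous_on UNIV k2" "\<forall>x. k2 (- x) = cnj (k2 x)" "k = k1 + cscale \<i> k2"
proof
  have k': "continuous_on UNIV (\<lambda>x. k (- x))"
    by (rule continuous_on_compose2[OF k]) (auto intro!: continuous_intros)
  show "continuous_on UNIV (\<lambda>x. (k x + cnj (k (- x))) / 2)"
    "continuous_on UNIV (\<lambda>x. (k x - cnj (k (- x))) / (2 * \<i>))"
    using k k' by (intro continuous_intros; simp)+
  show "k = (\<lambda>x. (k x + cnj (k (- x))) / 2) + cscale \<i> (\<lambda>x. (k x - cnj (k (- x))) / (2 * \<i>))"
    by (auto simp: fun_eq_iff cscale_def field_simps)
qed (auto simp: field_simps)

text \<open>
  With the reflected conjugate of \<open>f\<close> as its kernel, convolution does not annihilate \<open>f\<close> unless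
  \<open>f\<close> is zero almost everywhere.
\<close>

lemma conv_reflected_at_0:
  "conv (\<lambda>z. cnj (f (- z))) f 0 = of_real ((l2_norm M f)\<^sup>2)"
  unfolding l2_inner_self[symmetric] by (simp add: conv_def l2_inner_def mult.commute)

lemma continuous_reflected:
  fixes f :: "'g \<Rightarrow> complex"
  assumes f: "continuous_on UNIV f"
  shows "continuous_on UNIV (\<lambda>z. cnj (f (- z)))"
  by (intro continuous_on_cnj continuous_on_compose2[OF f]) (auto intro!: continuous_intros)

text \<open>
  Translating \<open>conv k f\<close> amounts to translating \<open>k\<close>. If every kernel multiplies \<open>f\<close> by a scalar, it
  follows that every translate of \<open>f\<close> is a multiple of \<open>f\<close>, and then \<open>f\<close> is a multiple of a character.
\<close>

lemma conv_scalar_imp_character: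
  assumes V: "convolution_module V" and f: "f \<in> V" "f \<noteq> 0"
    and scalar: "\<And>k. continuous_on UNIV k \<Longrightarrow> \<exists>c. conv k f = cscale c f"
  shows "\<exists>\<phi>\<in>characters. \<phi> \<in> V"
proof -
  note VD = convolution_moduleD[OF V]
  have fc: "continuous_on UNIV f"
    by (rule VD(1)[OF f(1)])
  define k where "k = (\<lambda>z. cnj (f (- z)))"
  have k: "continuous_on UNIV k"
    unfolding k_def by (rule continuous_reflected[OF fc])
  obtain c where c: "conv k f = cscale c f"
    using scalar[OF k] by blast
  have "l2_norm M f \<noteq> 0"
    using l2_norm_eq_0_continuous[OF fc] f(2) by blast
  moreover have "c * f 0 = of_real ((l2_norm M f)\<^sup>2)"
    using conv_reflected_at_0[of f] fun_cong[OF c, of 0] by (simp only: k_def cscale_def)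
  ultimately have "c * f 0 \<noteq> 0"
    by simp
  then have c0: "c \<noteq> 0" and f0: "f 0 \<noteq> 0"
    by auto
  have mult: "f (x + a) * f 0 = f x * f a" for x a
  proof -
    have "continuous_on UNIV (\<lambda>z. k (z + a))"
      by (rule continuous_on_compose2[OF k]) (auto intro!: continuous_intros)
    then obtain d where d: "conv (\<lambda>z. k (z + a)) f = cscale d f"
      using scalar by blast
    have "c * f (y + a) = d * f y" for y
      using conv_translate[of k f y a] unfolding c d by (simp add: cscale_def)
    from this[of x] this[of 0] have e: "c * f (x + a) = d * f x" "c * f a = d * f 0"
      by simp_all
    have "c * (f (x + a) * f 0) = f x * (d * f 0)"
      unfolding mult.assoc[symmetric] e(1) by (simp only: mult_ac)
    also have "\<dots> = c * (f x * f a)"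
      unfolding e(2)[symmetric] by (simp only: mult_ac)
    finally show ?thesis
      using c0 by simp
  qed
  define \<phi> where "\<phi> = cscale (1 / f 0) f"
  have pm: "\<phi> (x + y) = \<phi> x * \<phi> y" for x y
    using mult[of x y] f0 by (simp add: \<phi>_def cscale_def field_simps)
  have pc: "continuous_on UNIV \<phi>"
    unfolding \<phi>_def by (rule VD(1)[OF VD(3)[OF f(1)]])
  obtain B where B: "\<And>x. cmod (\<phi> x) \<le> B"
    using continuous_bounded[OF pc] by auto
  have "\<phi> 0 = 1"
    using f0 by (simp add: \<phi>_def cscale_def)
  then have "cmod (\<phi> x) = 1" for x
    by (rule bounded_multiplicative_norm_1[OF pm _ B])
  then have "\<phi> \<in> characters"
    using pm pc by (simp add: characters_def)
  moreover have "\<phi> \<in> V"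
    unfolding \<phi>_def by (rule VD(3)[OF f(1)])
  ultimately show ?thesis
    by blast
qed

text \<open>
  If some Hermitian kernel does not act as a scalar, one of its eigenspaces is a proper nonzero
  submodule; a vector \<open>conv k g - L g\<close> with \<open>g\<close> outside of it is orthogonal to it, so orthonormal
  families in the eigenspace can be enlarged within the module and the size bound drops.
\<close>

lemma finite_convolution_module_has_character:
  assumes "convolution_module V" "f \<in> V" "f \<noteq> 0" "orthonormal_size_le V n"
  shows "\<exists>\<phi>\<in>characters. \<phi> \<in> V"
  using assms
proof (induct n arbitrary: V f rule: less_induct)
  case (less n)
  note V = less.prems(1) and f = less.prems(2,3) and n = less.prems(4)
  note VD = convolution_moduleD[OF V]
  show ?case
  proof (cases "\<forall>k. continuous_on UNIV k \<and> (\<forall>x. k (- x) = cnj (k x)) \<longrightarrow> (\<exists>c. \<forall>g\<in>V. conv k g = cscale c g)")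
    case True
    have "\<exists>c. conv k f = cscale c f" if k: "continuous_on UNIV k" for k
    proof -
      obtain k1 k2 where k12: "continuous_on UNIV k1" "\<forall>x. k1 (- x) = cnj (k1 x)"
        "continuous_on UNIV k2" "\<forall>x. k2 (- x) = cnj (k2 x)" and eq: "k = k1 + cscale \<i> k2"
        by (rule hermitian_decomposition[OF k])
      obtain c1 where c1: "\<forall>g\<in>V. conv k1 g = cscale c1 g"
        using True[rule_format, of k1] k12 by blast
      obtain c2 where c2: "\<forall>g\<in>V. conv k2 g = cscale c2 g"
        using True[rule_format, of k2] k12 by blast
      have "continuous_on UNIV (cscale \<i> k2)"
        unfolding cscale_def by (intro continuous_intros k12)
      from conv_kernel_add[OF k12(1) this VD(1)[OF f(1)]]
      have "conv k f = cscale c1 f + cscale \<i> (cscale c2 f)"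
        unfolding eq conv_kernel_cscale using c1 c2 f(1) by simp
      also have "\<dots> = cscale (c1 + \<i> * c2) f"
        by (auto simp: cscale_def algebra_simps)
      finally show ?thesis
        by blast
    qed
    then show ?thesis
      by (rule conv_scalar_imp_character[OF V f])
  next
    case False
    then obtain k where k: "continuous_on UNIV k" and sym: "\<And>x. k (- x) = cnj (k x)"
      and ns: "\<And>c. \<exists>g\<in>V. conv k g \<noteq> cscale c g"
      by blast
    obtain g0 where g0: "g0 \<in> V" "conv k g0 \<noteq> 0"
      using ns[of 0] by (auto simp: cscale_def zero_fun_def)
    obtain L w where w: "w \<in> V" "w \<noteq> 0" "conv k w = cscale (complex_of_real L) w"
      using conv_eigenvector[OF V k sym g0] by blast
    define V' where "V' = {g\<in>V. conv k g = cscale (of_real L) g}"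
    have V': "convolution_module V'"
      unfolding V'_def by (rule convolution_module_eigenspace[OF V k])
    obtain g where g: "g \<in> V" "conv k g \<noteq> cscale (of_real L) g"
      using ns[of "of_real L"] by blast
    define u where "u = conv k g - cscale (of_real L) g"
    have u: "u \<in> V"
      unfolding u_def by (intro VD(4) VD(3) VD(5) k g)
    have "u \<noteq> 0"
      using g(2) by (simp add: u_def)
    then have u0: "l2_norm M u \<noteq> 0"
      using l2_norm_eq_0_continuous[OF VD(1)[OF u]] by blast
    have orth: "l2_inner M u v = 0" if v: "v \<in> V'" for v
    proof -
      have vV: "v \<in> V" and cv: "conv k v = cscale (of_real L) v"
        using v by (auto simp: V'_def)
      have "l2_inner M u v = l2_inner M (conv k g) v - of_real L * l2_inner M g v"
        unfolding u_def l2_inner_diff_left[OF VD(7)[OF VD(5)[OF k g(1)]] VD(7)[OF VD(3)[OF g(1)]] VD(7)[OF vV]]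
          l2_inner_cscale_left ..
      also have "l2_inner M (conv k g) v = l2_inner M g (conv k v)"
        using conv_adjoint[OF k VD(1)[OF g(1)] VD(1)[OF vV]] by (simp add: sym)
      finally show ?thesis
        by (simp add: cv l2_inner_cscale_right)
    qed
    define e0 where "e0 = cscale (of_real (1 / l2_norm M u)) u"
    have e0: "e0 \<in> V"
      unfolding e0_def by (rule VD(3)[OF u])
    have e0_norm: "l2_inner M e0 e0 = 1"
      unfolding l2_inner_self e0_def l2_norm_cscale using u0 by (simp add: norm_divide)
    have e0_orth: "l2_inner M e0 v = 0" "l2_inner M v e0 = 0" if "v \<in> V'" for v
      using orth[OF that] l2_inner_commute[of M v u]
      by (simp_all add: e0_def l2_inner_cscale_left l2_inner_cscale_right)
    have extend: "Suc m \<le> n"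
      if e: "\<forall>i<m. e i \<in> V'" and on: "\<forall>i<m. \<forall>j<m. l2_inner M (e i) (e j) = (if i = j then 1 else 0)" for m e
    proof -
      define e' where "e' = e(m := e0)"
      have "\<forall>i<Suc m. e' i \<in> V"
        using e e0 by (auto simp: e'_def less_Suc_eq V'_def)
      moreover have "\<forall>i<Suc m. \<forall>j<Suc m. l2_inner M (e' i) (e' j) = (if i = j then 1 else 0)"
        using e on e0_norm e0_orth by (auto simp: e'_def less_Suc_eq)
      ultimately show ?thesis
        using n unfolding orthonormal_size_le_def by blast
    qed
    have "n > 0"
      using extend[of 0] by simp
    moreover have "orthonormal_size_le V' (n - 1)"
      unfolding orthonormal_size_le_def
    proof (intro allI impI)
      fix m and e :: "nat \<Rightarrow> 'g \<Rightarrow> complex"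
      assume "(\<forall>i<m. e i \<in> V') \<and> (\<forall>i<m. \<forall>j<m. l2_inner M (e i) (e j) = (if i = j then 1 else 0))"
      then have "Suc m \<le> n"
        by (intro extend[of m e]) simp_all
      then show "m \<le> n - 1"
        by simp
    qed
    moreover have "w \<in> V'"
      using w by (simp add: V'_def)
    ultimately have "\<exists>\<phi>\<in>characters. \<phi> \<in> V'"
      by (intro less.hyps[of "n - 1" V' w] V' w(2)) simp_all
    then show ?thesis
      by (auto simp: V'_def)
  qed
qed

text \<open>
  Some Hermitian kernel does not annihilate \<open>f\<close>, and thus has an eigenvector in \<open>V\<close> with a nonzero
  eigenvalue; the eigenspace is a submodule to which the bound for orthonormal families applies.
\<close>

lemma nonzero_convolution_module_has_character:
  assumes V: "convolution_module V" and f: "f \<in> V" "f \<noteq> 0"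
  shows "\<exists>\<phi>\<in>characters. \<phi> \<in> V"
proof -
  note VD = convolution_moduleD[OF V]
  have fc: "continuous_on UNIV f"
    by (rule VD(1)[OF f(1)])
  obtain k1 k2 where k1: "continuous_on UNIV k1" "\<forall>x. k1 (- x) = cnj (k1 x)"
    and k2: "continuous_on UNIV k2" "\<forall>x. k2 (- x) = cnj (k2 x)"
    and eq: "(\<lambda>z. cnj (f (- z))) = k1 + cscale \<i> k2"
    by (rule hermitian_decomposition[OF continuous_reflected[OF fc]])
  have "continuous_on UNIV (cscale \<i> k2)"
    unfolding cscale_def by (intro continuous_intros k2)
  from conv_kernel_add[OF k1(1) this fc]
  have "conv k1 f 0 + \<i> * conv k2 f 0 = of_real ((l2_norm M f)\<^sup>2)"
    unfolding conv_reflected_at_0[symmetric] eq conv_kernel_cscale by (simp add: cscale_def)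
  moreover have "l2_norm M f \<noteq> 0"
    using l2_norm_eq_0_continuous[OF fc] f(2) by blast
  ultimately have "conv k1 f \<noteq> 0 \<or> conv k2 f \<noteq> 0"
    by auto
  then obtain k where k: "continuous_on UNIV k" "\<And>x. k (- x) = cnj (k x)" "conv k f \<noteq> 0"
    using k1 k2 by blast
  obtain L w where L: "L \<noteq> 0" and w: "w \<in> V" "w \<noteq> 0" "conv k w = cscale (complex_of_real L) w"
    using conv_eigenvector[OF V k(1,2) f(1) k(3)] by blast
  define V' where "V' = {g\<in>V. conv k g = cscale (of_real L) g}"
  have V': "convolution_module V'"
    unfolding V'_def by (rule convolution_module_eigenspace[OF V k(1)])
  have "\<exists>n. orthonormal_size_le V' n"
    by (rule orthonormal_size_le_eigenspace[OF k(1), of "of_real L"]) (use L VD(1) in \<open>auto simp: V'_def\<close>)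
  then obtain n where "orthonormal_size_le V' n" ..
  then have "\<exists>\<phi>\<in>characters. \<phi> \<in> V'"
    using finite_convolution_module_has_character[OF V', of w n] w by (simp add: V'_def)
  then show ?thesis
    by (auto simp: V'_def)
qed

lemma conv_character:
  assumes k: "continuous_on UNIV k" and \<phi>: "\<phi> \<in> characters"
  shows "conv k \<phi> = cscale (LINT y|M. k (- y) * \<phi> y) \<phi>"
proof
  fix x
  have "continuous_on UNIV (\<lambda>y. k (x - y) * \<phi> y)"
    by (intro continuous_on_mult continuous_kernel(2)[OF k] characterD(1)[OF \<phi>])
  from integral_translate[OF this, of x]
  have "conv k \<phi> x = (LINT y|M. (k (- y) * \<phi> y) * \<phi> x)"
    by (simp add: conv_def characterD(2)[OF \<phi>] mult_ac)
  then show "conv k \<phi> x = cscale (LINT y|M. k (- y) * \<phi> y) \<phi> x"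
    by (simp add: cscale_def)
qed

text \<open>
  If all characters were \<open>1\<close> at \<open>z \<noteq> 0\<close>, the difference between a function and its translate
  by \<open>z\<close> would be orthogonal to all characters, and the functions with this property form a
  convolution module; but a nonzero module contains a character.
\<close>

lemma characters_separate_from_0:
  assumes z: "z \<noteq> (0 :: 'g)"
  shows "\<exists>\<phi>\<in>characters. \<phi> z \<noteq> 1"
proof (rule ccontr)
  assume "\<not> (\<exists>\<phi>\<in>characters. \<phi> z \<noteq> 1)"
  then have one: "\<phi> z = 1" if "\<phi> \<in> characters" for \<phi>
    using that by blast
  define V where "V = {f. continuous_on UNIV f \<and> (\<forall>\<phi>\<in>characters. l2_inner M f \<phi> = 0)}"
  have VI: "f \<in> V" if "continuous_on UNIV f" "\<And>\<phi>. \<phi> \<in> characters \<Longrightarrow> l2_inner M f \<phi> = 0" for f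
    using that by (simp add: V_def)
  have Vc: "continuous_on UNIV f" and Vo: "\<phi> \<in> characters \<Longrightarrow> l2_inner M f \<phi> = 0" if "f \<in> V" for f \<phi>
    using that by (simp_all add: V_def)
  note VL = continuous_in_L2[OF Vc]
  have V: "convolution_module V"
  proof (rule convolution_moduleI)
    show "f + g \<in> V" if f: "f \<in> V" and g: "g \<in> V" for f g
    proof (rule VI)
      show "continuous_on UNIV (f + g)"
        unfolding plus_fun_def by (intro continuous_on_add Vc f g)
      show "l2_inner M (f + g) \<phi> = 0" if "\<phi> \<in> characters" for \<phi>
        unfolding l2_inner_add_left[OF VL[OF f] VL[OF g] character_in_L2[OF that]] Vo[OF f that] Vo[OF g that]
        by simp
    qed
    show "cscale c f \<in> V" if f: "f \<in> V" for c f
    proof (rule VI)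
      show "continuous_on UNIV (cscale c f)"
        unfolding cscale_def by (intro continuous_intros Vc f)
    qed (simp add: l2_inner_cscale_left Vo[OF f])
    show "conv k f \<in> V" if k: "continuous_on UNIV k" and f: "f \<in> V" for k f
    proof (rule VI)
      show "continuous_on UNIV (conv k f)"
        by (rule continuous_conv[OF k Vc[OF f]])
      fix \<phi> :: "'g \<Rightarrow> complex" assume \<phi>: "\<phi> \<in> characters"
      show "l2_inner M (conv k f) \<phi> = 0"
        unfolding conv_adjoint[OF k Vc[OF f] characterD(1)[OF \<phi>]]
          conv_character[OF continuous_reflected[OF k] \<phi>] l2_inner_cscale_right
        by (simp add: Vo[OF f \<phi>])
    qed
    show "w \<in> V" if F: "\<And>n. F n \<in> V" and ulim: "uniform_limit UNIV F w sequentially" for F w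
    proof (rule VI)
      show w: "continuous_on UNIV w"
        by (rule uniform_limit_theorem[OF _ ulim]) (use Vc[OF F] in auto)
      fix \<phi> :: "'g \<Rightarrow> complex" assume \<phi>: "\<phi> \<in> characters"
      have "(\<lambda>n. l2_inner M (F n) \<phi>) \<longlonglongrightarrow> l2_inner M w \<phi>"
        by (intro l2_inner_tendsto[of F] VL F continuous_in_L2 w character_in_L2 \<phi> uniform_limit_l2_norm[of F] Vc ulim)
      then show "l2_inner M w \<phi> = 0"
        by (simp add: Vo[OF F \<phi>] LIMSEQ_const_iff)
    qed
  qed (rule Vc)
  obtain u :: "'g \<Rightarrow> real" where u: "continuous_on UNIV u" "u 0 = 0" "u z = 1"
    using compact_Hausdorff_Urysohn[OF compact_group, of "{0}" "{z}"] z by auto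
  define f where "f x = complex_of_real (u (z + x)) - complex_of_real (u x)" for x
  have uz: "continuous_on UNIV (\<lambda>x. u (z + x))"
    by (rule continuous_on_compose2[OF u(1)]) (auto intro!: continuous_intros)
  have fV: "f \<in> V"
  proof (rule VI)
    show "continuous_on UNIV f"
      unfolding f_def using u uz by (intro continuous_intros)
    fix \<phi> :: "'g \<Rightarrow> complex" assume \<phi>: "\<phi> \<in> characters"
    have c: "continuous_on UNIV (\<lambda>x. complex_of_real (u x) * cnj (\<phi> x))"
      "continuous_on UNIV (\<lambda>x. complex_of_real (u (z + x)) * cnj (\<phi> x))"
      using u uz characterD(1)[OF \<phi>] by (intro continuous_intros; simp)+
    have "l2_inner M f \<phi> = (LINT x|M. complex_of_real (u (z + x)) * cnj (\<phi> x)) - (LINT x|M. complex_of_real (u x) * cnj (\<phi> x))"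
      using c by (simp add: l2_inner_def f_def left_diff_distrib continuous_integrable)
    also have "(LINT x|M. complex_of_real (u (z + x)) * cnj (\<phi> x)) = (LINT x|M. complex_of_real (u x) * cnj (\<phi> x))"
      using integral_translate[OF c(1), of z] by (simp add: characterD(2)[OF \<phi>] one[OF \<phi>])
    finally show "l2_inner M f \<phi> = 0"
      by simp
  qed
  have "f 0 = 1"
    using u by (simp add: f_def)
  then have "f \<noteq> 0"
    by auto
  then obtain \<phi> where \<phi>: "\<phi> \<in> characters" "\<phi> \<in> V"
    using nonzero_convolution_module_has_character[OF V fV] by blast
  then have "l2_inner M \<phi> \<phi> = 0"
    by (intro Vo)
  moreover have "l2_inner M \<phi> \<phi> = 1"
    using characterD(4)[OF \<phi>(1)] by (simp add: l2_inner_def)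
  ultimately show False
    by simp
qed

section \<open>Density of the trigonometric polynomials\<close>

lemma character_mult: "\<phi> \<in> characters \<Longrightarrow> \<xi> \<in> characters \<Longrightarrow> \<phi> * \<xi> \<in> characters"
  unfolding characters_def
  by (auto intro!: continuous_intros simp: norm_mult mult_ac times_fun_def)

lemma character_cnj: "\<phi> \<in> characters \<Longrightarrow> cnj \<circ> \<phi> \<in> characters"
  unfolding characters_def by (auto intro!: continuous_intros simp: o_def)

lemma one_character: "1 \<in> characters"
  unfolding characters_def by (auto simp: one_fun_def)

abbreviation trig_polys :: "('g \<Rightarrow> complex) set" where
  "trig_polys \<equiv> cfun.span characters"

lemma trig_poly_induct [consumes 1, case_names zero step]:
  assumes "p \<in> trig_polys" "P 0" "\<And>c \<phi> p. \<phi> \<in> characters \<Longrightarrow> P p \<Longrightarrow> P (cscale c \<phi> + p)"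
  shows "P p"
  using assms by (rule cfun.span_induct_alt)

lemma trig_poly_character_mult: "p \<in> trig_polys \<Longrightarrow> \<phi> \<in> characters \<Longrightarrow> \<phi> * p \<in> trig_polys"
proof (induct rule: trig_poly_induct)
  case (step c \<xi> p)
  have "\<phi> * (cscale c \<xi> + p) = cscale c (\<phi> * \<xi>) + \<phi> * p"
    by (auto simp: cscale_def fun_eq_iff algebra_simps)
  then show ?case
    using step by (metis cfun.span_add cfun.span_scale cfun.span_base character_mult)
qed (simp add: cfun.span_zero)

lemma trig_poly_mult: "p \<in> trig_polys \<Longrightarrow> q \<in> trig_polys \<Longrightarrow> p * q \<in> trig_polys"
proof (induct rule: trig_poly_induct)
  case (step c \<xi> p)
  have "(cscale c \<xi> + p) * q = cscale c (\<xi> * q) + p * q"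
    by (auto simp: cscale_def fun_eq_iff algebra_simps)
  then show ?case
    using step by (metis cfun.span_add cfun.span_scale trig_poly_character_mult)
qed (simp add: cfun.span_zero)

lemma trig_poly_cnj: "p \<in> trig_polys \<Longrightarrow> cnj \<circ> p \<in> trig_polys"
proof (induct rule: trig_poly_induct)
  case zero
  then show ?case
    using cfun.span_zero by (simp add: o_def zero_fun_def)
next
  case (step c \<xi> p)
  have "cnj \<circ> (cscale c \<xi> + p) = cscale (cnj c) (cnj \<circ> \<xi>) + (cnj \<circ> p)"
    by (auto simp: cscale_def fun_eq_iff)
  then show ?case
    using step by (metis cfun.span_add cfun.span_scale cfun.span_base character_cnj)
qed

lemma trig_poly_Re: 
  assumes "p \<in> trig_polys"
  shows "(\<lambda>x. complex_of_real (Re (p x))) \<in> trig_polys"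
proof -
  have "(\<lambda>x. complex_of_real (Re (p x))) = cscale (1/2) (p + (cnj \<circ> p))"
    by (auto simp: cscale_def fun_eq_iff complex_add_cnj)
  then show ?thesis
    using assms by (metis cfun.span_add cfun.span_scale trig_poly_cnj)
qed

lemma trig_poly_continuous: "p \<in> trig_polys \<Longrightarrow> continuous_on UNIV p"
proof (induct rule: trig_poly_induct)
  case (step c \<xi> p)
  then show ?case
    unfolding cscale_def plus_fun_def by (intro continuous_intros) (auto dest: characterD(1))
qed (simp add: zero_fun_def)

text \<open>
  The real parts of trigonometric polynomials are closed under products because they are themselves
  trigonometric polynomials, and they separate points because the characters do.
\<close>

lemma trig_poly_dense_uniform_real:
  fixes f :: "'g \<Rightarrow> real"
  assumes f: "continuous_on UNIV f" and e: "e > 0"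
  shows "\<exists>p\<in>trig_polys. \<forall>x. \<bar>f x - Re (p x)\<bar> < e"
proof -
  define P where "P g \<longleftrightarrow> (\<exists>p\<in>trig_polys. g = (\<lambda>x. Re (p x)))" for g
  have PI: "P (\<lambda>x. Re (p x))" if "p \<in> trig_polys" for p
    using that unfolding P_def by blast
  have "\<exists>g. P g \<and> (\<forall>x\<in>UNIV. \<bar>f x - g x\<bar> < e)"
  proof (rule Stone_Weierstrass_HOL[OF compact_group])
    fix c :: real
    show "P (\<lambda>x. c)"
      using PI[OF cfun.span_scale[OF cfun.span_base[OF one_character]], of "of_real c"] by (simp add: cscale_def)
  next
    fix g assume "P g"
    then show "continuous_on UNIV g"
      unfolding P_def by (auto intro!: continuous_intros trig_poly_continuous)
  next
    fix g h assume "P g \<and> P h"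
    then obtain p q where p: "p \<in> trig_polys" "g = (\<lambda>x. Re (p x))" and q: "q \<in> trig_polys" "h = (\<lambda>x. Re (q x))"
      unfolding P_def by blast
    show "P (\<lambda>x. g x + h x)"
      using PI[OF cfun.span_add[OF p(1) q(1)]] by (simp add: p q)
    show "P (\<lambda>x. g x * h x)"
      using PI[OF trig_poly_mult[OF trig_poly_Re[OF p(1)] q(1)]] by (simp add: p q)
  next
    fix x y :: 'g assume "x \<in> UNIV \<and> y \<in> UNIV \<and> x \<noteq> y"
    then obtain \<phi> where \<phi>: "\<phi> \<in> characters" "\<phi> (x - y) \<noteq> 1"
      using characters_separate_from_0[of "x - y"] by auto
    have "\<phi> x = \<phi> (x - y) * \<phi> y"
      using characterD(2)[OF \<phi>(1), of "x - y" y] by simp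
    then have "\<phi> x \<noteq> \<phi> y"
      using \<phi> characterD(5)[OF \<phi>(1)] by simp
    then have "Re (\<phi> x) \<noteq> Re (\<phi> y) \<or> Re (cscale (- \<i>) \<phi> x) \<noteq> Re (cscale (- \<i>) \<phi> y)"
      by (auto simp: complex_eq_iff cscale_def)
    then show "\<exists>g. P g \<and> g x \<noteq> g y"
      using PI[OF cfun.span_base[OF \<phi>(1)]] PI[OF cfun.span_scale[OF cfun.span_base[OF \<phi>(1)]], of "- \<i>"] by blast
  qed (use f e in auto)
  then show ?thesis
    unfolding P_def by auto
qed

lemma trig_poly_dense_uniform:
  fixes f :: "'g \<Rightarrow> complex"
  assumes f: "continuous_on UNIV f" and e: "e > 0"
  shows "\<exists>p\<in>trig_polys. \<forall>x. cmod (f x - p x) < e"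
proof -
  obtain p where p: "p \<in> trig_polys" "\<And>x. \<bar>Re (f x) - Re (p x)\<bar> < e / 2"
    using trig_poly_dense_uniform_real[of "\<lambda>x. Re (f x)" "e / 2"] f e by (auto intro: continuous_intros)
  obtain q where q: "q \<in> trig_polys" "\<And>x. \<bar>Im (f x) - Re (q x)\<bar> < e / 2"
    using trig_poly_dense_uniform_real[of "\<lambda>x. Im (f x)" "e / 2"] f e by (auto intro: continuous_intros)
  define s where "s = (\<lambda>x. complex_of_real (Re (p x))) + cscale \<i> (\<lambda>x. complex_of_real (Re (q x)))"
  have "s \<in> trig_polys"
    unfolding s_def by (intro cfun.span_add cfun.span_scale trig_poly_Re p q)
  moreover have "cmod (f x - s x) < e" for x
  proof -
    have "cmod (f x - s x) \<le> \<bar>Re (f x) - Re (p x)\<bar> + \<bar>Im (f x) - Re (q x)\<bar>"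
      using cmod_le[of "f x - s x"] by (simp add: s_def cscale_def)
    then show ?thesis
      using p(2)[of x] q(2)[of x] by linarith
  qed
  ultimately show ?thesis
    by blast
qed

definition continuously_approximable :: "('g \<Rightarrow> complex) \<Rightarrow> bool" where
  "continuously_approximable f \<longleftrightarrow> f \<in> L2 M \<and> (\<forall>e>0. \<exists>g. continuous_on UNIV g \<and> l2_norm M (f - g) < e)"

lemma continuously_approximable_limit:
  assumes f: "f \<in> L2 M" and F: "\<And>n::nat. continuously_approximable (F n)" and lim: "(\<lambda>n. l2_norm M (F n - f)) \<longlonglongrightarrow> 0"
  shows "continuously_approximable f"
  unfolding continuously_approximable_def
proof (intro conjI allI impI f)
  fix e :: real assume e: "e > 0"
  have "\<forall>\<^sub>F n in sequentially. l2_norm M (F n - f) < e / 2"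
    using order_tendstoD(2)[OF lim, of "e / 2"] e by simp
  then obtain n where n: "l2_norm M (F n - f) < e / 2"
    by (auto simp: eventually_sequentially)
  obtain g where g: "continuous_on UNIV g" "l2_norm M (F n - g) < e / 2"
    using F[of n] e unfolding continuously_approximable_def by (meson half_gt_zero)
  have "F n \<in> L2 M"
    using F by (simp add: continuously_approximable_def)
  then have "l2_norm M (f - g) < e"
    using l2_norm_triangle_diff[OF f _ continuous_in_L2[OF g(1)], of "F n"] n g(2)
    by (simp add: l2_norm_minus_commute[of M f])
  then show "\<exists>g. continuous_on UNIV g \<and> l2_norm M (f - g) < e"
    using g by blast
qed

lemma continuously_approximable_add:
  assumes "continuously_approximable f" "continuously_approximable h"
  shows "continuously_approximable (f + h)"
  unfolding continuously_approximable_def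
proof (intro conjI allI impI)
  have L: "f \<in> L2 M" "h \<in> L2 M"
    using assms by (simp_all add: continuously_approximable_def)
  then show "f + h \<in> L2 M"
    by (rule L2_add)
  fix e :: real assume "e > 0"
  then obtain g1 g2 where g: "continuous_on UNIV g1" "l2_norm M (f - g1) < e / 2"
    "continuous_on UNIV g2" "l2_norm M (h - g2) < e / 2"
    using assms unfolding continuously_approximable_def by (meson half_gt_zero)
  have "l2_norm M ((f - g1) + (h - g2)) < e"
    using l2_norm_triangle[OF L2_diff[OF L(1) continuous_in_L2[OF g(1)]] L2_diff[OF L(2) continuous_in_L2[OF g(3)]]] g
    by linarith
  moreover have "(f - g1) + (h - g2) = (f + h) - (g1 + g2)"
    by (rule ext) simp
  moreover have "continuous_on UNIV (g1 + g2)"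
    unfolding plus_fun_def by (intro continuous_on_add g)
  ultimately show "\<exists>g. continuous_on UNIV g \<and> l2_norm M (f + h - g) < e"
    by metis
qed

lemma continuously_approximable_cscale:
  assumes "continuously_approximable f"
  shows "continuously_approximable (cscale c f)"
  unfolding continuously_approximable_def
proof (intro conjI allI impI)
  have L: "f \<in> L2 M"
    using assms by (simp add: continuously_approximable_def)
  then show "cscale c f \<in> L2 M"
    by (rule L2_cscale)
  fix e :: real assume e: "e > 0"
  then have "e / (cmod c + 1) > 0"
    by (simp add: add_nonneg_pos)
  then obtain g where g: "continuous_on UNIV g" "l2_norm M (f - g) < e / (cmod c + 1)"
    using assms unfolding continuously_approximable_def by meson
  have "cscale c f - cscale c g = cscale c (f - g)"
    by (auto simp: cscale_def fun_eq_iff algebra_simps)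
  then have "l2_norm M (cscale c f - cscale c g) \<le> (cmod c + 1) * l2_norm M (f - g)"
    by (simp add: l2_norm_cscale distrib_right)
  also have "\<dots> < e"
    using g(2) pos_less_divide_eq[of "cmod c + 1" "l2_norm M (f - g)" e] by (simp add: add_nonneg_pos mult.commute)
  finally show "\<exists>h. continuous_on UNIV h \<and> l2_norm M (cscale c f - h) < e"
    using continuous_on_mult[OF continuous_on_const g(1), of c]
    by (intro exI[of _ "cscale c g"]) (simp add: cscale_def)
qed

lemma continuously_approximable_sum:
  assumes "\<And>i. i \<in> I \<Longrightarrow> continuously_approximable (f i)"
  shows "continuously_approximable (sum f I)"
  using assms
proof (induct I rule: infinite_finite_induct)
  case (insert i I)
  then have "continuously_approximable (f i + sum f I)"
    by (intro continuously_approximable_add) auto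
  then show ?case
    unfolding sum.insert[OF insert.hyps(1,2)] .
qed (auto simp: continuously_approximable_def L2_zero zero_fun_def intro!: exI[of _ "\<lambda>_. 0"] simp flip: zero_fun_def)

lemma compact_inner_approximation:
  assumes B: "B \<in> sets M" and e: "e > 0"
  shows "\<exists>K. compact K \<and> K \<subseteq> B \<and> measure M (B - K) < e"
proof -
  interpret finite_measure M
    by (rule finite_measure_M)
  have eq: "emeasure M B = (SUP K\<in>{K. compact K \<and> K \<subseteq> B}. emeasure M K)"
    using haar B by (simp add: normalized_haar_def sets_M)
  have "\<exists>K. compact K \<and> K \<subseteq> B \<and> measure M B - e < measure M K"
  proof (cases "measure M B - e < 0")
    case True
    then show ?thesis
      by (intro exI[of _ "{}"]) auto
  next
    case False
    then have "ennreal (measure M B - e) < emeasure M B"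
      using e by (simp add: emeasure_eq_measure ennreal_less_iff)
    then obtain K where K: "compact K" "K \<subseteq> B" "ennreal (measure M B - e) < emeasure M K"
      unfolding eq less_SUP_iff by blast
    then show ?thesis
      using False by (intro exI[of _ K]) (simp add: emeasure_eq_measure ennreal_less_iff)
  qed
  then obtain K where K: "compact K" "K \<subseteq> B" "measure M B - e < measure M K"
    by blast
  have "K \<in> sets M"
    using K(1) by (simp add: sets_M borel_compact)
  then have "measure M (B - K) = measure M B - measure M K"
    by (rule finite_measure_Diff[OF B _ K(2)])
  then show ?thesis
    using K by (intro exI[of _ K]) simp
qed

text \<open>
  Inner regularity, applied to \<open>B\<close> and to its complement, gives disjoint compact sets which leave
  out only a set of small measure; a Urysohn function for these two sets approximates the indicator.
\<close>

lemma continuously_approximable_indicator: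
  assumes B: "B \<in> sets M"
  shows "continuously_approximable (indicator B)"
  unfolding continuously_approximable_def
proof (intro conjI allI impI)
  interpret finite_measure M
    by (rule finite_measure_M)
  have ind: "(indicator B :: 'g \<Rightarrow> complex) \<in> borel_measurable M"
    using B by (rule borel_measurable_indicator)
  have "integrable M (\<lambda>x. (cmod (indicator B x))\<^sup>2)"
  proof (rule integrable_const_bound[of _ 1])
    show "(\<lambda>x. (cmod (indicator B x))\<^sup>2) \<in> borel_measurable M"
      using ind by measurable
  qed (simp add: indicator_def)
  then show L: "indicator B \<in> L2 M"
    using ind by (simp add: L2_def)
  fix e :: real assume e: "e > 0"
  obtain K where K: "compact K" "K \<subseteq> B" "measure M (B - K) < e\<^sup>2 / 2"
    using compact_inner_approximation[OF B, of "e\<^sup>2 / 2"] e by auto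
  have "- B \<in> sets M"
    using B by (metis sets.compl_sets Compl_eq_Diff_UNIV space_M)
  then obtain K' where K': "compact K'" "K' \<subseteq> - B" "measure M (- B - K') < e\<^sup>2 / 2"
    using compact_inner_approximation[of "- B" "e\<^sup>2 / 2"] e by auto
  have cl: "closed K" "closed K'"
    using K K' by (auto intro: compact_imp_closed)
  obtain u :: "'g \<Rightarrow> real" where u: "continuous_on UNIV u" "\<And>x. 0 \<le> u x \<and> u x \<le> 1"
    "\<And>x. x \<in> K' \<Longrightarrow> u x = 0" "\<And>x. x \<in> K \<Longrightarrow> u x = 1"
    using compact_Hausdorff_Urysohn[OF compact_group cl(2,1)] K(2) K'(2) by blast
  define g where "g x = complex_of_real (u x)" for x
  have g: "continuous_on UNIV g"
    unfolding g_def by (intro continuous_intros u)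
  define D where "D = (B - K) \<union> (- B - K')"
  have D: "D \<in> sets M"
    unfolding D_def using B \<open>- B \<in> sets M\<close> cl by (auto simp: sets_M)
  have "(l2_norm M (indicator B - g))\<^sup>2 = (LINT x|M. (cmod ((indicator B - g) x))\<^sup>2)"
    by (simp add: l2_norm_def)
  also have "\<dots> \<le> (LINT x|M. indicator D x)"
  proof (rule integral_mono)
    show "integrable M (\<lambda>x. (cmod ((indicator B - g) x))\<^sup>2)"
      by (rule L2D(2)[OF L2_diff[OF L continuous_in_L2[OF g]]])
    show "integrable M (indicator D :: 'g \<Rightarrow> real)"
      using D by (simp add: emeasure_eq_measure)
    fix x
    have "\<bar>1 - u x\<bar> \<le> 1" "\<bar>u x\<bar> \<le> 1"
      using u(2)[of x] by auto
    then have "(1 - u x)\<^sup>2 \<le> 1" "(u x)\<^sup>2 \<le> 1"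
      by (simp_all add: abs_square_le_1)
    moreover have "cmod (1 - complex_of_real (u x)) = \<bar>1 - u x\<bar>"
      by (metis norm_of_real of_real_1 of_real_diff)
    ultimately show "(cmod ((indicator B - g) x))\<^sup>2 \<le> indicator D x"
      using u(3)[of x] u(4)[of x] K(2) K'(2) by (auto simp: D_def g_def indicator_def)
  qed
  also have "\<dots> = measure M D"
    using D by simp
  also have "\<dots> \<le> measure M (B - K) + measure M (- B - K')"
    unfolding D_def using B \<open>- B \<in> sets M\<close> cl by (intro measure_Un_le) (auto simp: sets_M)
  also have "\<dots> < e\<^sup>2"
    using K(3) K'(3) by simp
  finally have "l2_norm M (indicator B - g) < e"
    by (rule power2_less_imp_less) (rule less_imp_le[OF e])
  then show "\<exists>g. continuous_on UNIV g \<and> l2_norm M (indicator B - g) < e"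
    using g by blast
qed

text \<open>
  A square-integrable function is the limit of simple functions dominated by a multiple of it.
\<close>

lemma continuous_dense_L2:
  assumes f: "f \<in> L2 M"
  shows "continuously_approximable f"
proof -
  have fm: "f \<in> borel_measurable M"
    by (rule L2D(1)[OF f])
  obtain s where s: "\<And>i. simple_function M (s i)" "\<And>x. (\<lambda>i. s i x) \<longlonglongrightarrow> f x"
    "\<And>i x. dist (s i x) 0 \<le> 2 * dist (f x) 0"
    using borel_measurable_implies_sequence_metric[OF fm, of 0] by auto
  have approx: "continuously_approximable (s i)" for i
  proof -
    have "s i = (\<Sum>y\<in>range (s i). cscale y (indicator (s i -` {y})))"
    proof
      fix x
      have fin: "finite (range (s i))"
        using simple_functionD(1)[OF s(1)] by simp
      have "(\<Sum>y\<in>range (s i). cscale y (indicator (s i -` {y}))) x = (\<Sum>y\<in>range (s i). y * indicator (s i -` {y}) x)"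
        by (simp only: sum_fun_apply cscale_def)
      also have "\<dots> = (\<Sum>y\<in>range (s i). if y = s i x then y else 0)"
        by (intro sum.cong) (auto simp: indicator_def)
      also have "\<dots> = s i x"
        using fin by simp
      finally show "s i x = (\<Sum>y\<in>range (s i). cscale y (indicator (s i -` {y}))) x" ..
    qed
    moreover have "s i -` {y} \<in> sets M" for y
      using simple_functionD(2)[OF s(1), of i "{y}"] by simp
    ultimately show ?thesis
      by (metis (no_types, lifting) continuously_approximable_sum continuously_approximable_cscale
          continuously_approximable_indicator)
  qed
  have sL: "s i \<in> L2 M" for i
    using approx by (simp add: continuously_approximable_def)
  have "(\<lambda>i. LINT x|M. (cmod (s i x - f x))\<^sup>2) \<longlonglongrightarrow> (LINT x|M. 0)"
  proof (rule integral_dominated_convergence)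
    show "integrable M (\<lambda>x. 9 * (cmod (f x))\<^sup>2)"
      using L2D(2)[OF f] by simp
    show "AE x in M. (\<lambda>i. (cmod (s i x - f x))\<^sup>2) \<longlonglongrightarrow> 0"
    proof (rule AE_I2)
      fix x
      have "(\<lambda>i. (cmod (s i x - f x))\<^sup>2) \<longlonglongrightarrow> (cmod (f x - f x))\<^sup>2"
        by (intro tendsto_intros s(2))
      then show "(\<lambda>i. (cmod (s i x - f x))\<^sup>2) \<longlonglongrightarrow> 0"
        by simp
    qed
    show "AE x in M. norm ((cmod (s i x - f x))\<^sup>2) \<le> 9 * (cmod (f x))\<^sup>2" for i
    proof (rule AE_I2)
      fix x
      have "cmod (s i x - f x) \<le> 3 * cmod (f x)"
        using s(3)[of i x] norm_triangle_ineq4[of "s i x" "f x"] by simp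
      then have "(cmod (s i x - f x))\<^sup>2 \<le> (3 * cmod (f x))\<^sup>2"
        by (rule power_mono) simp
      then show "norm ((cmod (s i x - f x))\<^sup>2) \<le> 9 * (cmod (f x))\<^sup>2"
        by (simp add: power_mult_distrib)
    qed
  qed (use fm L2D(1)[OF sL] in measurable)
  then have "(\<lambda>i. sqrt (LINT x|M. (cmod (s i x - f x))\<^sup>2)) \<longlonglongrightarrow> sqrt 0"
    by (intro tendsto_real_sqrt) simp
  then have "(\<lambda>i. l2_norm M (s i - f)) \<longlonglongrightarrow> 0"
    by (simp add: l2_norm_def)
  then show ?thesis
    by (rule continuously_approximable_limit[OF f approx])
qed

lemma trig_poly_dense_L2:
  assumes f: "f \<in> L2 M" and e: "e > 0"
  shows "\<exists>p\<in>trig_polys. l2_norm M (f - p) < e"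
proof -
  obtain g where g: "continuous_on UNIV g" "l2_norm M (f - g) < e / 2"
    using continuous_dense_L2[OF f] e unfolding continuously_approximable_def by (meson half_gt_zero)
  obtain p where p: "p \<in> trig_polys" "\<And>x. cmod (g x - p x) < e / 2"
    using trig_poly_dense_uniform[OF g(1), of "e / 2"] e by auto
  have pc: "continuous_on UNIV p"
    by (rule trig_poly_continuous[OF p(1)])
  have "l2_norm M (g - p) \<le> e / 2"
    unfolding fun_diff_def by (rule l2_norm_le_sup) (use g pc p(2) in \<open>auto intro: continuous_on_diff less_imp_le\<close>)
  then have "l2_norm M (f - p) < e"
    using l2_norm_triangle_diff[OF f continuous_in_L2[OF g(1)] continuous_in_L2[OF pc]] g(2) by simp
  then show ?thesis
    using p(1) by blast
qed

end

section \<open>Fourier coefficients and the ordered dual group\<close>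

lemma fourier_eq_l2_inner: "fourier M f \<phi> = l2_inner M f \<phi>"
  by (simp add: fourier_def l2_inner_def)

lemma character_inverse: "\<phi> \<in> characters \<Longrightarrow> \<phi> * (cnj \<circ> \<phi>) = 1"
  using characterD(4)[of \<phi>] by (auto simp: fun_eq_iff)

lemma cnj_power: "(cnj \<circ> \<phi>) ^ n = cnj \<circ> (\<phi> ^ n)"
  by (induct n) (auto simp: fun_eq_iff)

lemma cnj_comp_eq_iff: "cnj \<circ> f = cnj \<circ> g \<longleftrightarrow> f = g"
  by (auto simp: fun_eq_iff)

lemma cnj_cnj_comp: "cnj \<circ> (cnj \<circ> f) = f"
  by (auto simp: fun_eq_iff)

context compact_abelian_group
begin

lemma character_power: "\<phi> \<in> characters \<Longrightarrow> \<phi> ^ n \<in> characters"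
  by (induct n) (simp_all add: one_character character_mult)

lemma characters_orthonormal:
  assumes \<phi>: "\<phi> \<in> characters" and \<xi>: "\<xi> \<in> characters"
  shows "l2_inner M \<phi> \<xi> = (if \<phi> = \<xi> then 1 else 0)"
proof (cases "\<phi> = \<xi>")
  case True
  then show ?thesis
    using characterD(4)[OF \<phi>] by (simp add: l2_inner_def)
next
  case False
  then obtain a where a: "\<phi> a \<noteq> \<xi> a"
    by (auto simp: fun_eq_iff)
  define \<eta> where "\<eta> x = \<phi> x * cnj (\<xi> x)" for x
  have c: "continuous_on UNIV \<eta>"
    unfolding \<eta>_def using characterD(1)[OF \<phi>] characterD(1)[OF \<xi>] by (intro continuous_intros)
  have "\<eta> a \<noteq> 1"
  proof
    assume "\<eta> a = 1"
    then have "\<phi> a * (\<xi> a * cnj (\<xi> a)) = \<xi> a"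
      by (simp add: \<eta>_def mult_ac)
    then show False
      using a characterD(4)[OF \<xi>] by simp
  qed
  moreover have "\<eta> (a + x) = \<eta> a * \<eta> x" for x
    by (simp add: \<eta>_def characterD(2)[OF \<phi>] characterD(2)[OF \<xi>] mult_ac)
  then have "(LINT x|M. \<eta> x) = \<eta> a * (LINT x|M. \<eta> x)"
    using integral_translate[OF c, of a] by simp
  ultimately have "(LINT x|M. \<eta> x) = 0"
    by simp
  then show ?thesis
    using False by (simp add: l2_inner_def \<eta>_def)
qed

lemma l2_norm_character: "\<phi> \<in> characters \<Longrightarrow> l2_norm M \<phi> = 1"
  by (rule power2_eq_imp_eq) (simp_all add: l2_norm_square characters_orthonormal)

lemma l2_inner_span_eq_0:
  assumes S: "S \<subseteq> characters" and g: "g \<in> L2 M" and orth: "\<And>\<phi>. \<phi> \<in> S \<Longrightarrow> l2_inner M g \<phi> = 0"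
    and p: "p \<in> cfun.span S"
  shows "l2_inner M g p = 0"
proof -
  have "p \<in> L2 M \<and> l2_inner M g p = 0"
    using p
  proof (induct rule: cfun.span_induct_alt)
    case (step c \<phi> p)
    have \<phi>: "cscale c \<phi> \<in> L2 M"
      using step S by (intro L2_cscale character_in_L2) auto
    have "l2_inner M g (cscale c \<phi>) = 0"
      using orth[OF step(1)] by (simp add: l2_inner_cscale_right)
    then have "l2_inner M g (cscale c \<phi> + p) = 0"
      using step(2) l2_inner_add_right[OF \<phi> _ g, of p] by simp
    then show ?case
      using step(2) L2_add[OF \<phi>, of p] by blast
  qed (intro conjI L2_zero l2_inner_zero_right)
  then show ?thesis ..
qed

text \<open>
  A function orthogonal to all trigonometric polynomials is at least as far from each of them as
  from zero.
\<close>

lemma L2_eq_0_if_orthogonal_to_characters: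
  assumes f: "f \<in> L2 M" and orth: "\<And>\<phi>. \<phi> \<in> characters \<Longrightarrow> l2_inner M f \<phi> = 0"
  shows "l2_norm M f = 0"
proof (rule ccontr)
  assume "l2_norm M f \<noteq> 0"
  then have pos: "l2_norm M f > 0"
    using l2_norm_nonneg[of M f] by linarith
  then obtain p where p: "p \<in> trig_polys" "l2_norm M (f - p) < l2_norm M f"
    using trig_poly_dense_L2[OF f] by blast
  have "l2_inner M f p = 0"
    by (rule l2_inner_span_eq_0[OF order_refl f orth p(1)])
  then have "(l2_norm M (f - p))\<^sup>2 = (l2_norm M f)\<^sup>2 + (l2_norm M p)\<^sup>2"
    using l2_norm_diff_square[OF f continuous_in_L2[OF trig_poly_continuous[OF p(1)]]] by simp
  moreover have "(l2_norm M (f - p))\<^sup>2 < (l2_norm M f)\<^sup>2"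
    using p(2) by (intro power_strict_mono) auto
  ultimately show False
    using zero_le_power2[of "l2_norm M p"] by linarith
qed

end

locale ordered_dual_group = compact_abelian_group M
  for M :: "'g::{topological_ab_group_add,t2_space} measure" +
  fixes r :: "('g \<Rightarrow> complex) rel" and \<phi>1 :: "'g \<Rightarrow> complex"
  assumes dual_order: "dual_order r"
    and first_positive: "first_positive r \<phi>1"
begin

lemma dual_order_mult: "(\<phi>, \<xi>) \<in> r \<Longrightarrow> \<eta> \<in> characters \<Longrightarrow> (\<phi> * \<eta>, \<xi> * \<eta>) \<in> r"
  using dual_order by (simp add: dual_order_def)

lemma dual_order_trans: "(\<phi>, \<xi>) \<in> r \<Longrightarrow> (\<xi>, \<eta>) \<in> r \<Longrightarrow> (\<phi>, \<eta>) \<in> r"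
  using dual_order unfolding dual_order_def order_on_defs by (meson transD)

lemma dual_order_antisym: "(\<phi>, \<xi>) \<in> r \<Longrightarrow> (\<xi>, \<phi>) \<in> r \<Longrightarrow> \<phi> = \<xi>"
  using dual_order unfolding dual_order_def order_on_defs by (meson antisymD)

lemma dual_order_total: "\<phi> \<in> characters \<Longrightarrow> \<xi> \<in> characters \<Longrightarrow> (\<phi>, \<xi>) \<in> r \<or> (\<xi>, \<phi>) \<in> r"
  using dual_order unfolding dual_order_def order_on_defs by (metis refl_onD total_on_def)

lemma XplusD: "\<phi> \<in> Xplus r \<Longrightarrow> \<phi> \<in> characters" "\<phi> \<in> Xplus r \<Longrightarrow> (1, \<phi>) \<in> r"
  by (simp_all add: Xplus_def)

lemma one_Xplus: "1 \<in> Xplus r"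
  using dual_order_total[OF one_character one_character] by (simp add: Xplus_def one_character)

lemma Xplus_mult:
  assumes "\<phi> \<in> Xplus r" "\<xi> \<in> Xplus r"
  shows "\<phi> * \<xi> \<in> Xplus r"
proof -
  have "(\<xi>, \<phi> * \<xi>) \<in> r"
    using dual_order_mult[OF XplusD(2)[OF assms(1)] XplusD(1)[OF assms(2)]] unfolding mult_1_left .
  then have "(1, \<phi> * \<xi>) \<in> r"
    by (rule dual_order_trans[OF XplusD(2)[OF assms(2)]])
  then show ?thesis
    using character_mult[OF XplusD(1)[OF assms(1)] XplusD(1)[OF assms(2)]] unfolding Xplus_def by blast
qed

lemma \<phi>1_Xplus: "\<phi>1 \<in> Xplus r" and \<phi>1_neq_1: "\<phi>1 \<noteq> 1"
  and \<phi>1_least: "\<xi> \<in> Xplus r \<Longrightarrow> \<xi> \<noteq> 1 \<Longrightarrow> (\<phi>1, \<xi>) \<in> r"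
  using first_positive by (auto simp: first_positive_def)

lemma \<phi>1_character: "\<phi>1 \<in> characters"
  using \<phi>1_Xplus by (rule XplusD)

lemma \<phi>1_power_Xplus: "\<phi>1 ^ n \<in> Xplus r"
proof (induct n)
  case 0
  show ?case
    unfolding power_0 by (rule one_Xplus)
next
  case (Suc n)
  show ?case
    unfolding power_Suc by (rule Xplus_mult[OF \<phi>1_Xplus Suc])
qed

lemma \<phi>1_power_character: "\<phi>1 ^ n \<in> characters"
  by (rule character_power[OF \<phi>1_character])

lemma Xplus_mult_eq_1:
  assumes \<phi>: "\<phi> \<in> Xplus r" and \<xi>: "\<xi> \<in> Xplus r" and eq: "\<phi> * \<xi> = 1"
  shows "\<xi> = 1"
proof (rule dual_order_antisym)
  show "(\<xi>, 1) \<in> r"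
    using dual_order_mult[OF XplusD(2)[OF \<phi>] XplusD(1)[OF \<xi>]] eq by simp
qed (rule XplusD(2)[OF \<xi>])

lemma mult_cancel_character:
  assumes "\<phi> \<in> characters" "\<phi> * \<xi> = \<phi> * \<eta>"
  shows "\<xi> = \<eta>"
  using assms characterD(5)[OF assms(1)] by (simp add: fun_eq_iff)

lemma \<phi>1_power_eq_1_iff: "\<phi>1 ^ n = 1 \<longleftrightarrow> n = 0"
proof (cases n)
  case (Suc m)
  have "\<phi>1 ^ m * \<phi>1 \<noteq> 1"
    using Xplus_mult_eq_1[OF \<phi>1_power_Xplus \<phi>1_Xplus] \<phi>1_neq_1 by blast
  then show ?thesis
    using Suc by (simp add: mult.commute)
qed simp

lemma \<phi>1_power_inj: "\<phi>1 ^ m = \<phi>1 ^ n \<longleftrightarrow> m = n"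
proof -
  have le: "m = n" if "m \<le> n" "\<phi>1 ^ m = \<phi>1 ^ n" for m n
  proof -
    have "\<phi>1 ^ m * 1 = \<phi>1 ^ m * \<phi>1 ^ (n - m)"
      unfolding power_add[symmetric] le_add_diff_inverse[OF that(1)] using that(2) by simp
    then have "1 = \<phi>1 ^ (n - m)"
      by (rule mult_cancel_character[OF \<phi>1_power_character])
    then show ?thesis
      using that(1) \<phi>1_power_eq_1_iff[of "n - m"] by simp
  qed
  show ?thesis
    using le[of m n] le[of n m] by (cases "m \<le> n") auto
qed

text \<open>
  A positive character that is not a power of the first positive one lies above all its powers: each
  division by \<open>\<phi>1\<close> leaves a character that is positive by minimality of \<open>\<phi>1\<close>.
\<close>

lemma nonpower_divided_Xplus:
  assumes \<xi>: "\<xi> \<in> Xplus r" and np: "\<xi> \<notin> range (\<lambda>n. \<phi>1 ^ n)"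
  shows "\<xi> * (cnj \<circ> \<phi>1) ^ n \<in> Xplus r - {1}"
proof (induct n)
  case 0
  have "\<xi> \<noteq> 1"
    using np power_0[of \<phi>1] by (metis rangeI)
  then show ?case
    unfolding power_0 mult_1_right using \<xi> by blast
next
  case (Suc n)
  define \<zeta> where "\<zeta> = \<xi> * (cnj \<circ> \<phi>1) ^ n"
  have z: "\<zeta> \<in> Xplus r" "\<zeta> \<noteq> 1"
    using Suc unfolding \<zeta>_def by blast+
  have cn: "cnj \<circ> \<phi>1 \<in> characters"
    by (rule character_cnj[OF \<phi>1_character])
  have eq: "\<zeta> * (cnj \<circ> \<phi>1) = \<xi> * (cnj \<circ> \<phi>1) ^ Suc n"
    unfolding \<zeta>_def power_Suc2 by (rule mult.assoc)
  have "(1, \<zeta> * (cnj \<circ> \<phi>1)) \<in> r"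
    using dual_order_mult[OF \<phi>1_least[OF z] cn] unfolding character_inverse[OF \<phi>1_character] .
  then have "\<zeta> * (cnj \<circ> \<phi>1) \<in> Xplus r"
    using character_mult[OF XplusD(1)[OF z(1)] cn] unfolding Xplus_def by blast
  moreover have "\<zeta> * (cnj \<circ> \<phi>1) \<noteq> 1"
  proof
    assume "\<zeta> * (cnj \<circ> \<phi>1) = 1"
    then have "\<xi> * (cnj \<circ> \<phi>1) ^ Suc n * \<phi>1 ^ Suc n = 1 * \<phi>1 ^ Suc n"
      unfolding eq by (rule arg_cong)
    moreover have "(cnj \<circ> \<phi>1) ^ Suc n * \<phi>1 ^ Suc n = 1"
      unfolding cnj_power mult.commute[of "cnj \<circ> _"] by (rule character_inverse[OF \<phi>1_power_character])
    ultimately have "\<xi> = \<phi>1 ^ Suc n"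
      by (metis mult.assoc mult.right_neutral mult.left_neutral)
    then show False
      using np by blast
  qed
  ultimately show ?case
    unfolding eq by blast
qed

text \<open>
  A positive character that is not a power of \<open>\<phi>1\<close> is larger than \<open>\<phi>1 ^ k\<close>, and so are its products
  with positive characters.
\<close>

lemma factor_of_power:
  assumes \<phi>: "\<phi> \<in> Xplus r" and \<xi>: "\<xi> \<in> Xplus r" and eq: "\<phi> * \<xi> = \<phi>1 ^ k"
  shows "\<xi> \<in> range (\<lambda>n. \<phi>1 ^ n)"
proof (rule ccontr)
  assume "\<xi> \<notin> range (\<lambda>n. \<phi>1 ^ n)"
  then have z: "\<xi> * (cnj \<circ> \<phi>1) ^ k \<in> Xplus r - {1}"
    by (rule nonpower_divided_Xplus[OF \<xi>])
  have "\<phi> * (\<xi> * (cnj \<circ> \<phi>1) ^ k) = 1"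
    unfolding mult.assoc[symmetric] eq cnj_power by (rule character_inverse[OF \<phi>1_power_character])
  then show False
    using Xplus_mult_eq_1[OF \<phi>] z by blast
qed

lemma cnj_Xplus_Xminus:
  assumes "\<xi> \<in> Xplus r" "\<xi> \<noteq> 1"
  shows "cnj \<circ> \<xi> \<in> Xminus r"
proof -
  have "cnj \<circ> \<xi> \<notin> Xplus r"
    using Xplus_mult_eq_1[OF _ assms(1), of "cnj \<circ> \<xi>"] character_inverse[OF XplusD(1)[OF assms(1)]] assms(2)
    by (auto simp: mult.commute)
  then show ?thesis
    using character_cnj[OF XplusD(1)[OF assms(1)]] by (simp add: Xminus_def)
qed

lemma Xminus_cnj_Xplus:
  assumes "\<phi> \<in> Xminus r"
  shows "cnj \<circ> \<phi> \<in> Xplus r - {1}"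
proof -
  have \<phi>: "\<phi> \<in> characters" "(1, \<phi>) \<notin> r"
    using assms by (auto simp: Xminus_def Xplus_def)
  then have "(\<phi>, 1) \<in> r"
    using dual_order_total[OF \<phi>(1) one_character] by blast
  from dual_order_mult[OF this character_cnj[OF \<phi>(1)]] have "cnj \<circ> \<phi> \<in> Xplus r"
    using character_inverse[OF \<phi>(1)] character_cnj[OF \<phi>(1)] by (simp add: Xplus_def)
  moreover have "cnj \<circ> \<phi> \<noteq> 1"
  proof
    assume eq: "cnj \<circ> \<phi> = 1"
    have "\<phi> = cnj \<circ> (cnj \<circ> \<phi>)"
      by (simp only: cnj_cnj_comp)
    also have "\<dots> = 1"
      unfolding eq by (auto simp: fun_eq_iff)
    finally show False
      using \<phi>(2) XplusD(2)[OF one_Xplus] by simp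
  qed
  ultimately show ?thesis
    by simp
qed

lemma cnj_power_Xminus: "n \<ge> 1 \<Longrightarrow> (cnj \<circ> \<phi>1) ^ n \<in> Xminus r"
  unfolding cnj_power by (intro cnj_Xplus_Xminus \<phi>1_power_Xplus) (simp add: \<phi>1_power_eq_1_iff)

lemma cnj_power_character: "(cnj \<circ> \<phi>1) ^ n \<in> characters"
  by (intro character_power character_cnj \<phi>1_character)

lemma Xminus_character: "\<phi> \<in> Xminus r \<Longrightarrow> \<phi> \<in> characters"
  by (simp add: Xminus_def)

lemma H2_L2: "f \<in> H2 M r \<Longrightarrow> f \<in> L2 M"
  by (simp add: H2_def)

lemma H2_orthogonal: "f \<in> H2 M r \<Longrightarrow> \<phi> \<in> Xminus r \<Longrightarrow> l2_inner M f \<phi> = 0"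
  by (simp add: H2_def fourier_eq_l2_inner)

lemma H2I: "f \<in> L2 M \<Longrightarrow> (\<And>\<phi>. \<phi> \<in> Xminus r \<Longrightarrow> l2_inner M f \<phi> = 0) \<Longrightarrow> f \<in> H2 M r"
  by (simp add: H2_def fourier_eq_l2_inner)

lemma H2_subspace: "cfun.subspace (H2 M r)"
proof (rule cfun.subspaceI)
  show "0 \<in> H2 M r"
    by (rule H2I[OF L2_zero]) simp
  show "f + g \<in> H2 M r" if "f \<in> H2 M r" "g \<in> H2 M r" for f g
    using that by (intro H2I L2_add)
      (auto simp: l2_inner_add_left H2_L2 H2_orthogonal character_in_L2[OF Xminus_character])
  show "cscale c f \<in> H2 M r" if "f \<in> H2 M r" for c f
    using that by (intro H2I L2_cscale) (auto simp: l2_inner_cscale_left H2_L2 H2_orthogonal)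
qed

lemmas H2_add = cfun.subspace_add[OF H2_subspace]
  and H2_cscale = cfun.subspace_scale[OF H2_subspace]
  and H2_zero = cfun.subspace_0[OF H2_subspace]
  and H2_diff = cfun.subspace_diff[OF H2_subspace]
  and H2_sum = cfun.subspace_sum[OF H2_subspace]

lemma Xplus_H2: "\<phi> \<in> Xplus r \<Longrightarrow> \<phi> \<in> H2 M r"
  by (rule H2I) (auto simp: character_in_L2 XplusD characters_orthonormal Xminus_def)

lemma span_Xplus_H2: "cfun.span (Xplus r) \<subseteq> H2 M r"
  by (rule cfun.span_minimal[OF _ H2_subspace]) (use Xplus_H2 in blast)

lemma H2minus_L2: "f \<in> H2minus M r \<Longrightarrow> f \<in> L2 M"
  by (simp add: H2minus_def)

lemma H2minus_cscale: "f \<in> H2minus M r \<Longrightarrow> cscale c f \<in> H2minus M r"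
  by (auto simp: H2minus_def l2_inner_cscale_left L2_cscale)

lemma H2minus_sum:
  assumes "\<And>i. i \<in> I \<Longrightarrow> f i \<in> H2minus M r"
  shows "sum f I \<in> H2minus M r"
proof -
  have "l2_inner M (sum f I) h = 0" if "h \<in> H2 M r" for h
    using assms that H2_L2[OF that] by (subst l2_inner_sum_left) (auto simp: H2minus_def)
  moreover have "sum f I \<in> L2 M"
    by (rule L2_sum[OF H2minus_L2[OF assms]])
  ultimately show ?thesis
    unfolding H2minus_def by blast
qed

lemma H2minus_zero: "0 \<in> H2minus M r"
  by (simp add: H2minus_def L2_zero)

lemma Xminus_H2minus:
  assumes "\<phi> \<in> Xminus r"
  shows "\<phi> \<in> H2minus M r"
proof -
  have "l2_inner M \<phi> h = 0" if "h \<in> H2 M r" for h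
    using H2_orthogonal[OF that assms] l2_inner_commute[of M \<phi> h] by simp
  then show ?thesis
    using assms by (simp add: H2minus_def character_in_L2[OF Xminus_character])
qed

text \<open>
  Splitting a trigonometric polynomial near \<open>f\<close> along the order, its part on the negative
  characters is orthogonal to \<open>f\<close> and to the remaining part, so dropping it improves the
  approximation.
\<close>

lemma span_Xplus_dense_H2:
  assumes f: "f \<in> H2 M r" and e: "e > 0"
  shows "\<exists>p\<in>cfun.span (Xplus r). l2_norm M (f - p) < e"
proof -
  obtain p where p: "p \<in> trig_polys" "l2_norm M (f - p) < e"
    using trig_poly_dense_L2[OF H2_L2[OF f] e] by blast
  have "\<exists>p1\<in>cfun.span (Xplus r). \<exists>p2\<in>cfun.span (Xminus r). p = p1 + p2"
    using p(1)
  proof (induct rule: trig_poly_induct)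
    case zero
    then show ?case
      using cfun.span_zero by (intro bexI[of _ 0]) auto
  next
    case (step c \<phi> p)
    then obtain p1 p2 where p12: "p1 \<in> cfun.span (Xplus r)" "p2 \<in> cfun.span (Xminus r)" "p = p1 + p2"
      by blast
    show ?case
    proof (cases "\<phi> \<in> Xplus r")
      case True
      then have "cscale c \<phi> + p1 \<in> cfun.span (Xplus r)"
        by (rule cfun.span_add[OF cfun.span_scale[OF cfun.span_base] p12(1)])
      moreover have "cscale c \<phi> + p = (cscale c \<phi> + p1) + p2"
        unfolding p12(3) by (rule add.assoc[symmetric])
      ultimately show ?thesis
        using p12(2) by blast
    next
      case False
      then have "\<phi> \<in> Xminus r"
        using step(1) by (simp add: Xminus_def)
      then have "cscale c \<phi> + p2 \<in> cfun.span (Xminus r)"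
        by (rule cfun.span_add[OF cfun.span_scale[OF cfun.span_base] p12(2)])
      moreover have "cscale c \<phi> + p = p1 + (cscale c \<phi> + p2)"
        unfolding p12(3) by (rule add.left_commute)
      ultimately show ?thesis
        using p12(1) by blast
    qed
  qed
  then obtain p1 p2 where p1: "p1 \<in> cfun.span (Xplus r)" and p2: "p2 \<in> cfun.span (Xminus r)" and eq: "p = p1 + p2"
    by blast
  have d: "f - p1 \<in> H2 M r"
    using p1 span_Xplus_H2 by (intro H2_diff f) blast
  have "l2_inner M (f - p1) p2 = 0"
    by (rule l2_inner_span_eq_0[OF _ H2_L2[OF d] H2_orthogonal[OF d] p2]) (auto simp: Xminus_def)
  moreover have "p2 \<in> L2 M"
    using p2 cfun.span_mono[of "Xminus r" characters]
    by (intro continuous_in_L2 trig_poly_continuous) (auto simp: Xminus_def)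
  ultimately have "(l2_norm M ((f - p1) - p2))\<^sup>2 = (l2_norm M (f - p1))\<^sup>2 + (l2_norm M p2)\<^sup>2"
    using l2_norm_diff_square[OF H2_L2[OF d], of p2] by simp
  moreover have "(f - p1) - p2 = f - p"
    unfolding eq by (rule diff_diff_add)
  ultimately have "(l2_norm M (f - p1))\<^sup>2 \<le> (l2_norm M (f - p))\<^sup>2"
    by simp
  then have "l2_norm M (f - p1) \<le> l2_norm M (f - p)"
    by (rule power2_le_imp_le) simp
  then show ?thesis
    using p(2) p1 by (intro bexI[of _ p1]) simp_all
qed

end

section \<open>Bounded operators from the Hardy space to its complement\<close>

context ordered_dual_group
begin

lemma bounded_op_H2minus: "bounded_op M (H2 M r) (H2minus M r) A \<Longrightarrow> f \<in> H2 M r \<Longrightarrow> A f \<in> H2minus M r"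
  by (simp add: bounded_op_def linear_op_def)

lemma bounded_op_L2: "bounded_op M (H2 M r) (H2minus M r) A \<Longrightarrow> f \<in> H2 M r \<Longrightarrow> A f \<in> L2 M"
  by (rule H2minus_L2[OF bounded_op_H2minus])

lemma bounded_op_inner_add:
  assumes A: "bounded_op M (H2 M r) (H2minus M r) A" and f: "f \<in> H2 M r" and g: "g \<in> H2 M r" and e: "e \<in> L2 M"
  shows "l2_inner M (A (f + g)) e = l2_inner M (A f) e + l2_inner M (A g) e"
proof -
  have "AE x in M. A (f + g) x = A f x + A g x"
    using A f g unfolding bounded_op_def linear_op_def by blast
  then have "AE x in M. A (f + g) x = (A f + A g) x"
    by (simp only: plus_fun_apply)
  then have "l2_inner M (A (f + g)) e = l2_inner M (A f + A g) e"
    by (intro l2_inner_cong_AE e L2_add bounded_op_L2[OF A] H2_add f g)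
  also have "\<dots> = l2_inner M (A f) e + l2_inner M (A g) e"
    by (intro l2_inner_add_left e bounded_op_L2[OF A] f g)
  finally show ?thesis .
qed

lemma bounded_op_inner_cscale:
  assumes A: "bounded_op M (H2 M r) (H2minus M r) A" and f: "f \<in> H2 M r" and e: "e \<in> L2 M"
  shows "l2_inner M (A (cscale c f)) e = c * l2_inner M (A f) e"
proof -
  have "AE x in M. A (cscale c f) x = c * A f x"
    using A f unfolding bounded_op_def linear_op_def by blast
  then have "AE x in M. A (cscale c f) x = cscale c (A f) x"
    by (simp only: cscale_def)
  then have "l2_inner M (A (cscale c f)) e = l2_inner M (cscale c (A f)) e"
    by (intro l2_inner_cong_AE e L2_cscale bounded_op_L2[OF A] H2_cscale f)
  then show ?thesis
    by (simp only: l2_inner_cscale_left)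
qed

lemma bounded_op_inner_zero:
  assumes A: "bounded_op M (H2 M r) (H2minus M r) A" and e: "e \<in> L2 M"
  shows "l2_inner M (A 0) e = 0"
proof -
  have "cscale 0 0 = (0 :: 'g \<Rightarrow> complex)"
    by (auto simp: cscale_def)
  then show ?thesis
    using bounded_op_inner_cscale[OF A H2_zero e, of 0] by simp
qed

lemma bounded_op_inner_sum:
  assumes A: "bounded_op M (H2 M r) (H2minus M r) A" and f: "\<And>i. i \<in> I \<Longrightarrow> f i \<in> H2 M r" and e: "e \<in> L2 M"
    and I: "finite I"
  shows "l2_inner M (A (\<Sum>i\<in>I. cscale (c i) (f i))) e = (\<Sum>i\<in>I. c i * l2_inner M (A (f i)) e)"
  using I f
proof (induct I rule: finite_induct)
  case empty
  show ?case
    unfolding sum.empty by (rule bounded_op_inner_zero[OF A e])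
next
  case (insert i I)
  have fi: "f i \<in> H2 M r" and s: "(\<Sum>i\<in>I. cscale (c i) (f i)) \<in> H2 M r"
    using insert by (auto intro!: H2_sum H2_cscale)
  have "l2_inner M (A (\<Sum>i\<in>I. cscale (c i) (f i))) e = (\<Sum>i\<in>I. c i * l2_inner M (A (f i)) e)"
    using insert.hyps(3) insert.prems by blast
  then show ?case
    unfolding sum.insert[OF insert.hyps(1,2)] bounded_op_inner_add[OF A H2_cscale[OF fi] s e]
      bounded_op_inner_cscale[OF A fi e] by (rule arg_cong)
qed

lemma bounded_op_bound:
  assumes "bounded_op M (H2 M r) (H2minus M r) A"
  obtains K where "K \<ge> 0" "\<And>f. f \<in> H2 M r \<Longrightarrow> l2_norm M (A f) \<le> K * l2_norm M f"
proof -
  obtain K where K: "\<And>f. f \<in> H2 M r \<Longrightarrow> l2_norm M (A f) \<le> K * l2_norm M f"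
    using assms by (auto simp: bounded_op_def)
  have "l2_norm M (A f) \<le> \<bar>K\<bar> * l2_norm M f" if "f \<in> H2 M r" for f
    using K[OF that] mult_right_mono[OF abs_ge_self[of K] l2_norm_nonneg[of M f]] by linarith
  then show ?thesis
    using that[of "\<bar>K\<bar>"] by simp
qed

text \<open>
  Both sides are bounded linear functionals of \<open>f\<close>, and they agree on the span of the positive
  characters, which is dense in the Hardy space.
\<close>

lemma bounded_op_inner_eqI:
  assumes A: "bounded_op M (H2 M r) (H2minus M r) A" and e: "e \<in> L2 M" and \<psi>: "\<psi> \<in> L2 M"
    and eq: "\<And>\<phi>. \<phi> \<in> Xplus r \<Longrightarrow> l2_inner M (A \<phi>) e = l2_inner M \<phi> \<psi>"
    and f: "f \<in> H2 M r"
  shows "l2_inner M (A f) e = l2_inner M f \<psi>"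
proof -
  obtain K where K: "K \<ge> 0" "\<And>f. f \<in> H2 M r \<Longrightarrow> l2_norm M (A f) \<le> K * l2_norm M f"
    using bounded_op_bound[OF A] by blast
  have span: "p \<in> H2 M r \<and> l2_inner M (A p) e = l2_inner M p \<psi>" if "p \<in> cfun.span (Xplus r)" for p
    using that
  proof (induct rule: cfun.span_induct_alt)
    case base
    show ?case
      using bounded_op_inner_zero[OF A e] H2_zero l2_inner_zero_left by metis
  next
    case (step c \<phi> p)
    have \<phi>: "\<phi> \<in> H2 M r" "cscale c \<phi> \<in> H2 M r" and p: "p \<in> H2 M r" "l2_inner M (A p) e = l2_inner M p \<psi>"
      using step Xplus_H2 H2_cscale by blast+
    have "l2_inner M (A (cscale c \<phi> + p)) e = l2_inner M (cscale c \<phi> + p) \<psi>"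
      unfolding bounded_op_inner_add[OF A \<phi>(2) p(1) e] bounded_op_inner_cscale[OF A \<phi>(1) e]
        l2_inner_add_left[OF H2_L2[OF \<phi>(2)] H2_L2[OF p(1)] \<psi>] l2_inner_cscale_left eq[OF step(1)] p(2) ..
    then show ?case
      using H2_add[OF \<phi>(2) p(1)] by blast
  qed
  define B where "B = K * l2_norm M e + l2_norm M \<psi>"
  have B: "B \<ge> 0"
    unfolding B_def using K(1) by (intro add_nonneg_nonneg mult_nonneg_nonneg) auto
  have "cmod (l2_inner M (A f) e - l2_inner M f \<psi>) \<le> 0 + \<epsilon>" if \<epsilon>: "\<epsilon> > 0" for \<epsilon>
  proof -
    have "\<epsilon> / (B + 1) > 0"
      using \<epsilon> B by simp
    then obtain p where p: "p \<in> cfun.span (Xplus r)" "l2_norm M (f - p) < \<epsilon> / (B + 1)"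
      using span_Xplus_dense_H2[OF f] by blast
    have pH: "p \<in> H2 M r" and d: "f - p \<in> H2 M r"
      using span[OF p(1)] H2_diff[OF f] by blast+
    have "f = (f - p) + p"
      by simp
    then have "l2_inner M (A f) e = l2_inner M (A (f - p)) e + l2_inner M (A p) e"
      "l2_inner M f \<psi> = l2_inner M (f - p) \<psi> + l2_inner M p \<psi>"
      using bounded_op_inner_add[OF A d pH e] l2_inner_add_left[OF H2_L2[OF d] H2_L2[OF pH] \<psi>] by metis+
    then have "cmod (l2_inner M (A f) e - l2_inner M f \<psi>) = cmod (l2_inner M (A (f - p)) e - l2_inner M (f - p) \<psi>)"
      using span[OF p(1)] by simp
    also have "\<dots> \<le> cmod (l2_inner M (A (f - p)) e) + cmod (l2_inner M (f - p) \<psi>)"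
      by (rule norm_triangle_ineq4)
    also have "\<dots> \<le> l2_norm M (A (f - p)) * l2_norm M e + l2_norm M (f - p) * l2_norm M \<psi>"
      by (intro add_mono l2_cauchy_schwarz bounded_op_L2[OF A] d e \<psi> H2_L2)
    also have "\<dots> \<le> (K * l2_norm M (f - p)) * l2_norm M e + l2_norm M (f - p) * l2_norm M \<psi>"
      using K(2)[OF d] by (intro add_mono mult_right_mono) auto
    also have "\<dots> = B * l2_norm M (f - p)"
      by (simp add: B_def algebra_simps)
    also have "\<dots> \<le> (B + 1) * l2_norm M (f - p)"
      by (intro mult_right_mono) auto
    also have "\<dots> \<le> \<epsilon>"
      using p(2) B by (simp add: pos_less_divide_eq mult.commute)
    finally show ?thesis
      by simp
  qed
  then have "cmod (l2_inner M (A f) e - l2_inner M f \<psi>) \<le> 0"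
    by (rule field_le_epsilon)
  then show ?thesis
    by simp
qed

lemma op_norm_bounds:
  assumes T: "\<And>f. f \<in> H2 M r \<Longrightarrow> l2_norm M (T f) \<le> K * l2_norm M f" and K: "K \<ge> 0"
  shows "op_norm M (H2 M r) T \<le> K"
    and "f \<in> H2 M r \<Longrightarrow> l2_norm M f \<le> 1 \<Longrightarrow> l2_norm M (T f) \<le> op_norm M (H2 M r) T"
    and "0 \<le> op_norm M (H2 M r) T"
proof -
  have le: "l2_norm M (T f) \<le> K" if "f \<in> H2 M r" "l2_norm M f \<le> 1" for f
    using T[OF that(1)] mult_left_le[OF that(2) K] by linarith
  show "op_norm M (H2 M r) T \<le> K"
    unfolding op_norm_def by (rule cSUP_least) (use le H2_zero l2_norm_zero in \<open>auto intro!: exI[of _ 0]\<close>)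
  have up: "l2_norm M (T f) \<le> op_norm M (H2 M r) T" if "f \<in> H2 M r" "l2_norm M f \<le> 1" for f
    unfolding op_norm_def by (rule cSUP_upper) (use that le in \<open>auto intro!: bdd_aboveI2\<close>)
  then show "f \<in> H2 M r \<Longrightarrow> l2_norm M f \<le> 1 \<Longrightarrow> l2_norm M (T f) \<le> op_norm M (H2 M r) T" .
  show "0 \<le> op_norm M (H2 M r) T"
    using up[of 0] H2_zero l2_norm_nonneg[of M "T 0"] l2_norm_zero by (metis order_trans zero_le_one)
qed

text \<open>
  Characters have modulus \<open>1\<close>, so absolutely summable coefficients give a uniformly convergent series
  and a continuous representative of its sum.
\<close>

lemma character_series:
  assumes c: "summable (\<lambda>n. cmod (c n))" and \<xi>: "\<And>n::nat. \<xi> n \<in> characters"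
  defines "g \<equiv> (\<lambda>x. \<Sum>n. c n * \<xi> n x)"
  shows "continuous_on UNIV g"
    and "l2_norm M (g - (\<Sum>n<N. cscale (c n) (\<xi> n))) \<le> (\<Sum>n. cmod (c (n + N)))"
    and "h \<in> L2 M \<Longrightarrow> (\<lambda>N. \<Sum>n<N. c n * l2_inner M (\<xi> n) h) \<longlonglongrightarrow> l2_inner M g h"
proof -
  have nrm: "cmod (c n * \<xi> n x) = cmod (c n)" for n x
    using characterD(3)[OF \<xi>] by (simp add: norm_mult)
  have sm: "summable (\<lambda>n. c n * \<xi> n x)" for x
    by (rule summable_norm_cancel) (simp add: nrm c)
  have part: "(\<Sum>n<N. cscale (c n) (\<xi> n)) = (\<lambda>x. \<Sum>n<N. c n * \<xi> n x)" for N
    by (rule ext) (simp only: sum_fun_apply cscale_def)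
  have pc: "continuous_on UNIV (\<lambda>x. \<Sum>n<N. c n * \<xi> n x)" for N
    using characterD(1)[OF \<xi>] by (intro continuous_intros)
  have "uniform_limit UNIV (\<lambda>N x. \<Sum>n<N. c n * \<xi> n x) g sequentially"
    unfolding g_def by (rule Weierstrass_m_test[OF _ c]) (simp add: nrm)
  then show gc: "continuous_on UNIV g"
    by (rule uniform_limit_theorem[rotated]) (simp_all add: pc)
  have tail: "l2_norm M (g - (\<Sum>n<N. cscale (c n) (\<xi> n))) \<le> (\<Sum>n. cmod (c (n + N)))" for N
    unfolding part fun_diff_def
  proof (rule l2_norm_le_sup)
    show "continuous_on UNIV (\<lambda>x. g x - (\<Sum>n<N. c n * \<xi> n x))"
      by (intro continuous_on_diff gc pc)
    fix x
    have "g x - (\<Sum>n<N. c n * \<xi> n x) = (\<Sum>n. c (n + N) * \<xi> (n + N) x)"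
      unfolding g_def using suminf_split_initial_segment[OF sm, of x N] by simp
    also have "cmod \<dots> \<le> (\<Sum>n. cmod (c (n + N) * \<xi> (n + N) x))"
      by (rule summable_norm) (simp only: nrm summable_ignore_initial_segment[OF c])
    finally show "cmod (g x - (\<Sum>n<N. c n * \<xi> n x)) \<le> (\<Sum>n. cmod (c (n + N)))"
      by (simp add: nrm)
  qed
  then show "l2_norm M (g - (\<Sum>n<N. cscale (c n) (\<xi> n))) \<le> (\<Sum>n. cmod (c (n + N)))" .
  show "(\<lambda>N. \<Sum>n<N. c n * l2_inner M (\<xi> n) h) \<longlonglongrightarrow> l2_inner M g h" if h: "h \<in> L2 M"
  proof -
    have "(\<lambda>N. l2_norm M ((\<Sum>n<N. cscale (c n) (\<xi> n)) - g)) \<longlonglongrightarrow> 0"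
    proof (rule tendsto_sandwich[of "\<lambda>_. 0"])
      show "(\<lambda>N. \<Sum>n. cmod (c (n + N))) \<longlonglongrightarrow> 0"
        by (rule suminf_exist_split2[OF c])
      show "\<forall>\<^sub>F N in sequentially. l2_norm M ((\<Sum>n<N. cscale (c n) (\<xi> n)) - g) \<le> (\<Sum>n. cmod (c (n + N)))"
        using tail by (subst l2_norm_minus_commute) simp
    qed auto
    then have "(\<lambda>N. l2_inner M (\<Sum>n<N. cscale (c n) (\<xi> n)) h) \<longlonglongrightarrow> l2_inner M g h"
      by (intro l2_inner_tendsto L2_sum L2_cscale character_in_L2 \<xi> continuous_in_L2 gc h)
    moreover have "l2_inner M (\<Sum>n<N. cscale (c n) (\<xi> n)) h = (\<Sum>n<N. c n * l2_inner M (\<xi> n) h)" for N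
      by (subst l2_inner_sum_left) (simp_all only: l2_inner_cscale_left L2_cscale character_in_L2 \<xi> h)
    ultimately show ?thesis
      by simp
  qed
qed

lemma cnj_power_inj: "(cnj \<circ> \<phi>1) ^ m = (cnj \<circ> \<phi>1) ^ n \<longleftrightarrow> m = n"
  unfolding cnj_power cnj_comp_eq_iff by (rule \<phi>1_power_inj)

section \<open>The series of rank-one operators\<close>

text \<open>
  This is the sum of the series of rank-one operators, computed pointwise, with \<open>m\<close> standing for
  \<open>\<mu> \<phi>1\<close>. Summation starts at \<open>0\<close> here, so the term of index \<open>n\<close> is the one with index
  \<open>Suc n\<close> there.
\<close>
definition hankel_series :: "complex \<Rightarrow> (nat \<Rightarrow> 'g \<Rightarrow> complex) \<Rightarrow> ('g \<Rightarrow> complex) \<Rightarrow> 'g \<Rightarrow> complex" where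
  "hankel_series m \<psi> f = (\<lambda>x. \<Sum>n. ((1 / m) ^ n * l2_inner M f (\<psi> (Suc n))) * ((cnj \<circ> \<phi>1) ^ Suc n) x)"

context
  fixes \<mu> :: "('g \<Rightarrow> complex) \<Rightarrow> complex" and \<psi> :: "nat \<Rightarrow> 'g \<Rightarrow> complex" and C :: real
  assumes \<mu>: "cmod (\<mu> \<phi>1) > 1"
    and \<psi>: "\<And>n. n \<ge> 1 \<Longrightarrow> \<psi> n \<in> H2 M r"
    and C: "\<And>n. n \<ge> 1 \<Longrightarrow> l2_norm M (\<psi> n) \<le> C"
begin

lemma bound_nonneg: "0 \<le> C"
  using C[of 1] l2_norm_nonneg[of M "\<psi> 1"] by linarith

lemma ratio_bounds: "0 < 1 / cmod (\<mu> \<phi>1)" "1 / cmod (\<mu> \<phi>1) < 1"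
  using \<mu> by (auto simp: divide_less_eq_1)

lemma hankel_coefficient_le:
  assumes "f \<in> L2 M"
  shows "cmod ((1 / \<mu> \<phi>1) ^ n * l2_inner M f (\<psi> (Suc n))) \<le> (C * l2_norm M f) * (1 / cmod (\<mu> \<phi>1)) ^ n"
proof -
  have "cmod (l2_inner M f (\<psi> (Suc n))) \<le> l2_norm M f * l2_norm M (\<psi> (Suc n))"
    by (intro l2_cauchy_schwarz assms H2_L2 \<psi>) simp
  also have "\<dots> \<le> l2_norm M f * C"
    by (intro mult_left_mono C) auto
  finally have "(1 / cmod (\<mu> \<phi>1)) ^ n * cmod (l2_inner M f (\<psi> (Suc n))) \<le> (1 / cmod (\<mu> \<phi>1)) ^ n * (l2_norm M f * C)"
    by (rule mult_left_mono) simp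
  then show ?thesis
    by (simp add: norm_mult norm_power norm_divide mult_ac)
qed

lemma geometric_sums_shift: "(\<lambda>n. (1 / cmod (\<mu> \<phi>1)) ^ (n + N)) sums ((1 / cmod (\<mu> \<phi>1)) ^ N / (1 - 1 / cmod (\<mu> \<phi>1)))"
  using sums_mult[OF geometric_sums[of "1 / cmod (\<mu> \<phi>1)"], of "(1 / cmod (\<mu> \<phi>1)) ^ N"] ratio_bounds
  by (simp add: power_add mult.commute)

lemma hankel_coefficient_summable:
  assumes "f \<in> L2 M"
  shows "summable (\<lambda>n. cmod ((1 / \<mu> \<phi>1) ^ n * l2_inner M f (\<psi> (Suc n))))"
proof (rule summable_comparison_test')
  show "summable (\<lambda>n. (C * l2_norm M f) * (1 / cmod (\<mu> \<phi>1)) ^ n)"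
    using ratio_bounds by (intro summable_mult summable_geometric) simp
qed (use hankel_coefficient_le[OF assms] in simp)

lemmas hankel_character_series =
  character_series[of "\<lambda>n. (1 / \<mu> \<phi>1) ^ n * l2_inner M f (\<psi> (Suc n))" "\<lambda>n. (cnj \<circ> \<phi>1) ^ Suc n" for f,
    OF hankel_coefficient_summable cnj_power_character, folded hankel_series_def]

lemma hankel_series_L2: "f \<in> L2 M \<Longrightarrow> hankel_series (\<mu> \<phi>1) \<psi> f \<in> L2 M"
  by (rule continuous_in_L2[OF hankel_character_series(1)])

lemma series_term_sum:
  "(\<Sum>n=1..N. series_term M \<mu> \<phi>1 \<psi> n f)
     = (\<Sum>n<N. cscale ((1 / \<mu> \<phi>1) ^ n * l2_inner M f (\<psi> (Suc n))) ((cnj \<circ> \<phi>1) ^ Suc n))"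
  unfolding One_nat_def sum.atLeast1_atMost_eq series_term_def rank_one_def cfun.scale_scale by simp

text \<open>
  The terms decay geometrically, so the error of the partial sums is a geometric tail; \<open>N = 0\<close> gives the
  bound for the operator norm.
\<close>

lemma hankel_series_tail:
  assumes f: "f \<in> L2 M"
  shows "l2_norm M (hankel_series (\<mu> \<phi>1) \<psi> f - (\<Sum>n=1..N. series_term M \<mu> \<phi>1 \<psi> n f))
    \<le> (C * (1 / cmod (\<mu> \<phi>1)) ^ N / (1 - 1 / cmod (\<mu> \<phi>1))) * l2_norm M f"
proof -
  have s: "summable (\<lambda>n. cmod ((1 / \<mu> \<phi>1) ^ (n + N) * l2_inner M f (\<psi> (Suc (n + N)))))"
    using hankel_coefficient_summable[OF f] by (rule summable_ignore_initial_segment)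
  have "l2_norm M (hankel_series (\<mu> \<phi>1) \<psi> f - (\<Sum>n=1..N. series_term M \<mu> \<phi>1 \<psi> n f))
      \<le> (\<Sum>n. cmod ((1 / \<mu> \<phi>1) ^ (n + N) * l2_inner M f (\<psi> (Suc (n + N)))))"
    unfolding series_term_sum by (rule hankel_character_series(2)[OF f])
  also have "\<dots> \<le> (\<Sum>n. (C * l2_norm M f) * (1 / cmod (\<mu> \<phi>1)) ^ (n + N))"
    by (rule suminf_le[OF hankel_coefficient_le[OF f] s])
      (intro summable_mult sums_summable[OF geometric_sums_shift])
  also have "\<dots> = (C * l2_norm M f) * ((1 / cmod (\<mu> \<phi>1)) ^ N / (1 - 1 / cmod (\<mu> \<phi>1)))"
    by (intro sums_unique[symmetric] sums_mult geometric_sums_shift)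
  finally show ?thesis
    by (simp add: mult_ac)
qed

lemma hankel_series_inner_tendsto:
  assumes "f \<in> L2 M" "h \<in> L2 M"
  shows "(\<lambda>N. \<Sum>n<N. ((1 / \<mu> \<phi>1) ^ n * l2_inner M f (\<psi> (Suc n))) * l2_inner M ((cnj \<circ> \<phi>1) ^ Suc n) h)
    \<longlonglongrightarrow> l2_inner M (hankel_series (\<mu> \<phi>1) \<psi> f) h"
  by (rule hankel_character_series(3)[OF assms])

lemma hankel_series_coefficient:
  assumes f: "f \<in> L2 M"
  shows "l2_inner M (hankel_series (\<mu> \<phi>1) \<psi> f) ((cnj \<circ> \<phi>1) ^ Suc k) = (1 / \<mu> \<phi>1) ^ k * l2_inner M f (\<psi> (Suc k))"
proof (rule LIMSEQ_unique[OF hankel_series_inner_tendsto[OF f character_in_L2[OF cnj_power_character]]])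
  define c where "c n = (1 / \<mu> \<phi>1) ^ n * l2_inner M f (\<psi> (Suc n))" for n
  have inner: "l2_inner M ((cnj \<circ> \<phi>1) ^ Suc n) ((cnj \<circ> \<phi>1) ^ Suc k) = (if n = k then 1 else 0)" for n
    unfolding characters_orthonormal[OF cnj_power_character cnj_power_character] cnj_power_inj by simp
  have "(\<Sum>n<N. c n * l2_inner M ((cnj \<circ> \<phi>1) ^ Suc n) ((cnj \<circ> \<phi>1) ^ Suc k)) = c k" if "N > k" for N
    unfolding inner using that by (simp add: if_distrib[of "\<lambda>x. c _ * x"] sum.delta cong: if_cong)
  then show "(\<lambda>N. \<Sum>n<N. ((1 / \<mu> \<phi>1) ^ n * l2_inner M f (\<psi> (Suc n))) *
      l2_inner M ((cnj \<circ> \<phi>1) ^ Suc n) ((cnj \<circ> \<phi>1) ^ Suc k)) \<longlonglongrightarrow> (1 / \<mu> \<phi>1) ^ k * l2_inner M f (\<psi> (Suc k))"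
    unfolding c_def[symmetric] by (intro tendsto_eventually eventually_sequentiallyI[of "Suc k"]) simp
qed

lemma hankel_series_orthogonal:
  assumes f: "f \<in> L2 M" and h: "h \<in> L2 M" and orth: "\<And>n. l2_inner M ((cnj \<circ> \<phi>1) ^ Suc n) h = 0"
  shows "l2_inner M (hankel_series (\<mu> \<phi>1) \<psi> f) h = 0"
  using hankel_series_inner_tendsto[OF f h] unfolding orth by (simp add: LIMSEQ_const_iff)

lemma hankel_series_H2minus:
  assumes f: "f \<in> L2 M"
  shows "hankel_series (\<mu> \<phi>1) \<psi> f \<in> H2minus M r"
proof -
  have "l2_inner M (hankel_series (\<mu> \<phi>1) \<psi> f) h = 0" if h: "h \<in> H2 M r" for h
  proof (rule hankel_series_orthogonal[OF f H2_L2[OF h]])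
    show "l2_inner M ((cnj \<circ> \<phi>1) ^ Suc n) h = 0" for n
      using Xminus_H2minus[OF cnj_power_Xminus, of "Suc n"] h unfolding H2minus_def by simp
  qed
  then show ?thesis
    using hankel_series_L2[OF f] unfolding H2minus_def by blast
qed

lemma hankel_series_bounded_op: "bounded_op M (H2 M r) (H2minus M r) (hankel_series (\<mu> \<phi>1) \<psi>)"
  unfolding bounded_op_def linear_op_def
proof (intro conjI ballI allI impI)
  have sm: "summable (\<lambda>n. ((1 / \<mu> \<phi>1) ^ n * l2_inner M f (\<psi> (Suc n))) * ((cnj \<circ> \<phi>1) ^ Suc n) x)"
    if f: "f \<in> L2 M" for f x
  proof (rule summable_norm_cancel)
    show "summable (\<lambda>n. cmod (((1 / \<mu> \<phi>1) ^ n * l2_inner M f (\<psi> (Suc n))) * ((cnj \<circ> \<phi>1) ^ Suc n) x))"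
      unfolding norm_mult[of _ "((cnj \<circ> \<phi>1) ^ Suc _) x"] characterD(3)[OF cnj_power_character] mult_1_right
      by (rule hankel_coefficient_summable[OF f])
  qed
  have \<psi>L: "\<psi> (Suc n) \<in> L2 M" for n
    by (intro H2_L2 \<psi>) simp
  fix f assume f: "f \<in> H2 M r"
  then show "hankel_series (\<mu> \<phi>1) \<psi> f \<in> H2minus M r"
    by (intro hankel_series_H2minus H2_L2)
  show "AE x in M. hankel_series (\<mu> \<phi>1) \<psi> (cscale c f) x = c * hankel_series (\<mu> \<phi>1) \<psi> f x" for c
    unfolding hankel_series_def l2_inner_cscale_left suminf_mult[OF sm[OF H2_L2[OF f]], symmetric]
    by (simp only: mult_ac AE_I2)
  fix g assume g: "g \<in> H2 M r"
  show "AE x in M. hankel_series (\<mu> \<phi>1) \<psi> (f + g) x = hankel_series (\<mu> \<phi>1) \<psi> f x + hankel_series (\<mu> \<phi>1) \<psi> g x"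
    unfolding hankel_series_def l2_inner_add_left[OF H2_L2[OF f] H2_L2[OF g] \<psi>L]
      suminf_add[OF sm[OF H2_L2[OF f]] sm[OF H2_L2[OF g]]]
    by (simp only: distrib_left distrib_right AE_I2)
  assume "AE x in M. f x = g x"
  then have "l2_inner M f (\<psi> (Suc n)) = l2_inner M g (\<psi> (Suc n))" for n
    by (intro l2_inner_cong_AE H2_L2 f g \<psi>) simp
  then show "AE x in M. hankel_series (\<mu> \<phi>1) \<psi> f x = hankel_series (\<mu> \<phi>1) \<psi> g x"
    by (simp add: hankel_series_def)
next
  show "\<exists>K. \<forall>f\<in>H2 M r. l2_norm M (hankel_series (\<mu> \<phi>1) \<psi> f) \<le> K * l2_norm M f"
    using hankel_series_tail[OF H2_L2, of _ 0] by (intro exI ballI) (simp only: atLeastatMost_empty zero_less_one sum.empty diff_zero)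
qed

lemma series_term_sum_H2minus: "(\<Sum>n=1..N. series_term M \<mu> \<phi>1 \<psi> n f) \<in> H2minus M r"
  unfolding series_term_def rank_one_def
  by (intro H2minus_sum H2minus_cscale Xminus_H2minus cnj_power_Xminus) simp

lemma op_sums_if_AE_eq:
  assumes A: "bounded_op M (H2 M r) (H2minus M r) A"
    and eq: "\<And>f. f \<in> H2 M r \<Longrightarrow> l2_norm M (A f - hankel_series (\<mu> \<phi>1) \<psi> f) = 0"
  shows "op_sums M (H2 M r) (series_term M \<mu> \<phi>1 \<psi>) A"
    and "op_norm M (H2 M r) A \<le> cmod (\<mu> \<phi>1) * C / (cmod (\<mu> \<phi>1) - 1)"
    and "f \<in> H2 M r \<Longrightarrow> (\<lambda>N. l2_norm M (A f - (\<Sum>n=1..N. series_term M \<mu> \<phi>1 \<psi> n f))) \<longlonglongrightarrow> 0"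
proof -
  define q where "q = 1 / cmod (\<mu> \<phi>1)"
  have q: "0 < q" "q < 1"
    using ratio_bounds by (simp_all add: q_def)
  have C0: "0 \<le> C"
    by (rule bound_nonneg)
  have SL: "(\<Sum>n=1..N. series_term M \<mu> \<phi>1 \<psi> n f) \<in> L2 M" for N f
    by (rule H2minus_L2[OF series_term_sum_H2minus])
  have tail: "l2_norm M (A f - (\<Sum>n=1..N. series_term M \<mu> \<phi>1 \<psi> n f)) \<le> (C * q ^ N / (1 - q)) * l2_norm M f"
    if f: "f \<in> H2 M r" for f N
    using l2_norm_triangle_diff[OF bounded_op_L2[OF A f] hankel_series_L2[OF H2_L2[OF f]] SL[where N=N and f=f]]
      hankel_series_tail[OF H2_L2[OF f], of N] eq[OF f]
    by (simp only: q_def)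
  have nonneg: "0 \<le> C * q ^ N / (1 - q)" for N
    using q C0 by simp
  have lim: "(\<lambda>N. C * q ^ N / (1 - q)) \<longlonglongrightarrow> 0"
  proof -
    have "(\<lambda>N. C * q ^ N / (1 - q)) \<longlonglongrightarrow> C * 0 / (1 - q)"
      using q by (intro tendsto_intros LIMSEQ_power_zero) auto
    then show ?thesis
      by simp
  qed
  show "op_sums M (H2 M r) (series_term M \<mu> \<phi>1 \<psi>) A"
    unfolding op_sums_def
  proof (rule tendsto_sandwich[OF _ _ tendsto_const lim])
    show "\<forall>\<^sub>F N in sequentially. 0 \<le> op_norm M (H2 M r) (\<lambda>f. A f - (\<Sum>n = 1..N. series_term M \<mu> \<phi>1 \<psi> n f))"
      using op_norm_bounds(3)[OF tail nonneg] by (intro always_eventually allI)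
    show "\<forall>\<^sub>F N in sequentially. op_norm M (H2 M r) (\<lambda>f. A f - (\<Sum>n = 1..N. series_term M \<mu> \<phi>1 \<psi> n f)) \<le> C * q ^ N / (1 - q)"
      using op_norm_bounds(1)[OF tail nonneg] by (intro always_eventually allI)
  qed
  have "l2_norm M (A f) \<le> (C / (1 - q)) * l2_norm M f" if "f \<in> H2 M r" for f
    using tail[OF that, of 0] by simp
  then have "op_norm M (H2 M r) A \<le> C / (1 - q)"
    using divide_nonneg_pos[OF C0, of "1 - q"] q(2) by (intro op_norm_bounds(1)) simp_all
  also have "\<dots> = cmod (\<mu> \<phi>1) * C / (cmod (\<mu> \<phi>1) - 1)"
    using \<mu> by (auto simp: q_def divide_simps)
  finally show "op_norm M (H2 M r) A \<le> cmod (\<mu> \<phi>1) * C / (cmod (\<mu> \<phi>1) - 1)" .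
  show "(\<lambda>N. l2_norm M (A f - (\<Sum>n=1..N. series_term M \<mu> \<phi>1 \<psi> n f))) \<longlonglongrightarrow> 0" if f: "f \<in> H2 M r"
  proof (rule tendsto_sandwich[OF _ _ tendsto_const tendsto_mult_left_zero[OF lim]])
    show "\<forall>\<^sub>F N in sequentially. l2_norm M (A f - (\<Sum>n=1..N. series_term M \<mu> \<phi>1 \<psi> n f)) \<le> C * q ^ N / (1 - q) * l2_norm M f"
      using tail[OF f] by (intro always_eventually allI)
  qed simp
qed

lemma nuclear_if_op_sums:
  assumes A: "bounded_op M (H2 M r) (H2minus M r) A"
    and sums: "op_sums M (H2 M r) (series_term M \<mu> \<phi>1 \<psi>) A"
  shows "nuclear_op M (H2 M r) (H2minus M r) A"
proof -
  \<comment> \<open>The term of index \<open>0\<close> does not enter the operator sum, but it does enter the summability condition.\<close>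
  define v where "v n = (if n = 0 then 0 else cscale ((1 / \<mu> \<phi>1) ^ (n - 1)) ((cnj \<circ> \<phi>1) ^ n))" for n :: nat
  define u where "u n = (if n = 0 then 0 else \<psi> n)" for n :: nat
  have vu: "v n \<in> H2minus M r" "u n \<in> H2 M r" for n
    using H2minus_cscale[OF Xminus_H2minus[OF cnj_power_Xminus]] H2minus_zero H2_zero \<psi>
    unfolding v_def u_def by simp_all
  have terms_eq: "series_term M \<mu> \<phi>1 \<psi> n f = rank_one M (v n) (u n) f" if "n \<in> {1..N}" for n N f
    using that by (simp add: series_term_def rank_one_def v_def u_def cscale_def mult_ac)
  have "summable (\<lambda>n. l2_norm M (v (Suc n)) * l2_norm M (u (Suc n)))"
  proof (rule summable_comparison_test')
    show "summable (\<lambda>n. C * (1 / cmod (\<mu> \<phi>1)) ^ n)"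
      using ratio_bounds by (intro summable_mult summable_geometric) simp
    fix n :: nat
    have "l2_norm M (v (Suc n)) = (1 / cmod (\<mu> \<phi>1)) ^ n"
      unfolding v_def using l2_norm_character[OF cnj_power_character, of "Suc n"]
      by (simp add: l2_norm_cscale norm_power norm_divide del: power_Suc)
    then show "norm (l2_norm M (v (Suc n)) * l2_norm M (u (Suc n))) \<le> C * (1 / cmod (\<mu> \<phi>1)) ^ n"
      using C[of "Suc n"] by (simp add: u_def mult.commute[of C] mult_left_mono)
  qed
  then have "summable (\<lambda>n. l2_norm M (v n) * l2_norm M (u n))"
    using summable_Suc_iff[of "\<lambda>n. l2_norm M (v n) * l2_norm M (u n)"] by blast
  moreover have "op_sums M (H2 M r) (\<lambda>n. rank_one M (v n) (u n)) A"
  proof -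
    have "(\<Sum>n=1..N. series_term M \<mu> \<phi>1 \<psi> n f) = (\<Sum>n=1..N. rank_one M (v n) (u n) f)" for N f
      by (rule sum.cong[OF refl terms_eq])
    then show ?thesis
      using sums by (simp only: op_sums_def)
  qed
  ultimately show ?thesis
    unfolding nuclear_op_def using A vu by blast
qed

text \<open>
  The operator norm is a supremum over the unit ball, so convergence of the operators gives
  convergence in norm at each character; the limit there is the same as for the pointwise series.
\<close>

lemma op_sums_at_character:
  assumes A: "bounded_op M (H2 M r) (H2minus M r) A"
    and sums: "op_sums M (H2 M r) (series_term M \<mu> \<phi>1 \<psi>) A"
    and \<phi>: "\<phi> \<in> Xplus r" and h: "h \<in> L2 M"
  shows "l2_inner M (A \<phi>) h = l2_inner M (hankel_series (\<mu> \<phi>1) \<psi> \<phi>) h"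
proof -
  note B = hankel_series_bounded_op
  have \<phi>H: "\<phi> \<in> H2 M r" "l2_norm M \<phi> \<le> 1"
    using Xplus_H2[OF \<phi>] l2_norm_character[OF XplusD(1)[OF \<phi>]] by simp_all
  define S where "S N f = (\<Sum>n=1..N. series_term M \<mu> \<phi>1 \<psi> n f)" for N f
  have SL: "S N f \<in> L2 M" for N f
    unfolding S_def by (rule H2minus_L2[OF series_term_sum_H2minus])
  obtain K where K: "K \<ge> 0" "\<And>f. f \<in> H2 M r \<Longrightarrow> l2_norm M (A f) \<le> K * l2_norm M f"
    using bounded_op_bound[OF A] by blast
  obtain K' where K': "K' \<ge> 0" "\<And>f. f \<in> H2 M r \<Longrightarrow> l2_norm M (hankel_series (\<mu> \<phi>1) \<psi> f) \<le> K' * l2_norm M f"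
    using bounded_op_bound[OF B] by blast
  define q where "q = 1 / cmod (\<mu> \<phi>1)"
  have q: "0 < q" "q < 1"
    using ratio_bounds by (simp_all add: q_def)
  have C0: "0 \<le> C"
    by (rule bound_nonneg)
  have bound: "l2_norm M (A f - S N f) \<le> (K + K' + C * q ^ N / (1 - q)) * l2_norm M f" if f: "f \<in> H2 M r" for f N
  proof -
    note BL = hankel_series_L2[OF H2_L2[OF f]] and AL = bounded_op_L2[OF A f]
    have "l2_norm M (A f - S N f) \<le> l2_norm M (A f - hankel_series (\<mu> \<phi>1) \<psi> f) + l2_norm M (hankel_series (\<mu> \<phi>1) \<psi> f - S N f)"
      by (rule l2_norm_triangle_diff[OF AL BL SL])
    moreover have "l2_norm M (A f - hankel_series (\<mu> \<phi>1) \<psi> f) \<le> l2_norm M (A f) + l2_norm M (hankel_series (\<mu> \<phi>1) \<psi> f)"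
      using l2_norm_triangle_diff[OF AL L2_zero BL] unfolding l2_norm_minus_commute[of M 0] diff_zero .
    moreover have "l2_norm M (hankel_series (\<mu> \<phi>1) \<psi> f - S N f) \<le> C * q ^ N / (1 - q) * l2_norm M f"
      unfolding S_def q_def by (rule hankel_series_tail[OF H2_L2[OF f]])
    ultimately show ?thesis
      using K(2)[OF f] K'(2)[OF f] by (simp add: distrib_right)
  qed
  have le: "l2_norm M (A \<phi> - S N \<phi>) \<le> op_norm M (H2 M r) (\<lambda>f. A f - S N f)" for N
    by (rule op_norm_bounds(2)[OF bound]) (use \<phi>H K K' q C0 in auto)
  have "(\<lambda>N. op_norm M (H2 M r) (\<lambda>f. A f - S N f)) \<longlonglongrightarrow> 0"
    using sums by (simp only: op_sums_def S_def)
  then have "(\<lambda>N. l2_norm M (A \<phi> - S N \<phi>)) \<longlonglongrightarrow> 0"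
    by (rule tendsto_sandwich[OF _ _ tendsto_const, rotated 2]) (use le in auto)
  then have limA: "(\<lambda>N. l2_norm M (S N \<phi> - A \<phi>)) \<longlonglongrightarrow> 0"
    by (simp only: l2_norm_minus_commute)
  have "(\<lambda>N. l2_norm M (hankel_series (\<mu> \<phi>1) \<psi> \<phi> - S N \<phi>)) \<longlonglongrightarrow> 0"
    unfolding S_def by (rule op_sums_if_AE_eq(3)[OF B _ \<phi>H(1)]) simp
  then have limB: "(\<lambda>N. l2_norm M (S N \<phi> - hankel_series (\<mu> \<phi>1) \<psi> \<phi>)) \<longlonglongrightarrow> 0"
    by (simp only: l2_norm_minus_commute)
  have "(\<lambda>N. l2_inner M (S N \<phi>) h) \<longlonglongrightarrow> l2_inner M (A \<phi>) h"
    by (rule l2_inner_tendsto[OF SL bounded_op_L2[OF A \<phi>H(1)] h limA])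
  moreover have "(\<lambda>N. l2_inner M (S N \<phi>) h) \<longlonglongrightarrow> l2_inner M (hankel_series (\<mu> \<phi>1) \<psi> \<phi>) h"
    by (rule l2_inner_tendsto[OF SL hankel_series_L2[OF H2_L2[OF \<phi>H(1)]] h limB])
  ultimately show ?thesis
    by (rule LIMSEQ_unique)
qed

end

section \<open>Semi-characters and \<open>\<mu>\<close>-Hankel operators\<close>

lemma semi_character_mult:
  "semi_character r \<mu> \<Longrightarrow> \<phi> \<in> Xplus r \<Longrightarrow> \<xi> \<in> Xplus r \<Longrightarrow> \<mu> (\<phi> * \<xi>) = \<mu> \<phi> * \<mu> \<xi>"
  by (simp add: semi_character_def)

lemma semi_character_one:
  assumes "semi_character r \<mu>"
  shows "\<mu> 1 = 1"
proof -
  obtain \<phi> where \<phi>: "\<phi> \<in> Xplus r" "\<mu> \<phi> \<noteq> 0"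
    using assms by (auto simp: semi_character_def)
  have "\<mu> \<phi> * \<mu> 1 = \<mu> \<phi> * 1"
    using semi_character_mult[OF assms \<phi>(1) one_Xplus] unfolding mult_1_right by (rule sym)
  then show ?thesis
    using \<phi>(2) by simp
qed

lemma semi_character_power:
  assumes "semi_character r \<mu>"
  shows "\<mu> (\<phi>1 ^ n) = \<mu> \<phi>1 ^ n"
proof (induct n)
  case 0
  show ?case
    unfolding power_0 by (rule semi_character_one[OF assms])
next
  case (Suc n)
  then show ?case
    unfolding power_Suc semi_character_mult[OF assms \<phi>1_Xplus \<phi>1_power_Xplus] by simp
qed

lemma Xplus_mult_nontrivial:
  assumes "\<phi> \<in> Xplus r" "\<xi> \<in> Xplus r - {1}"
  shows "\<phi> * \<xi> \<in> Xplus r - {1}"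
  using Xplus_mult[of \<phi> \<xi>] Xplus_mult_eq_1[of \<phi> \<xi>] assms by blast

lemma bounded_mu_HankelD:
  assumes "bounded_mu_Hankel M r \<mu> a A"
  shows "bounded_op M (H2 M r) (H2minus M r) A"
    and "\<phi> \<in> Xplus r \<Longrightarrow> \<xi> \<in> Xplus r - {1} \<Longrightarrow> l2_inner M (A \<phi>) (cnj \<circ> \<xi>) = \<mu> \<phi> * a (\<phi> * \<xi>)"
  using assms unfolding bounded_mu_Hankel_def mu_Hankel_def by blast+

text \<open>
  A character \<open>\<xi>\<close> above all powers of \<open>\<phi>1\<close> is divisible by each of them, so \<open>\<mu> \<phi>1 ^ n * a \<xi>\<close> is
  a matrix entry of the operator for every \<open>n\<close>; these entries are bounded, which forces \<open>a \<xi> = 0\<close>.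
\<close>

lemma bounded_mu_Hankel_supported:
  assumes \<mu>: "semi_character r \<mu>" and A: "bounded_mu_Hankel M r \<mu> a A" and gt: "cmod (\<mu> \<phi>1) > 1"
    and \<xi>: "\<xi> \<in> Xplus r" "\<xi> \<notin> range (\<lambda>n. \<phi>1 ^ n)"
  shows "a \<xi> = 0"
proof (rule ccontr)
  assume a0: "a \<xi> \<noteq> 0"
  note bA = bounded_mu_HankelD(1)[OF A]
  obtain K where K: "K \<ge> 0" "\<And>f. f \<in> H2 M r \<Longrightarrow> l2_norm M (A f) \<le> K * l2_norm M f"
    using bounded_op_bound[OF bA] by blast
  have le: "cmod (\<mu> \<phi>1) ^ n * cmod (a \<xi>) \<le> K" for n
  proof -
    define \<zeta> where "\<zeta> = \<xi> * (cnj \<circ> \<phi>1) ^ n"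
    have \<zeta>: "\<zeta> \<in> Xplus r - {1}"
      unfolding \<zeta>_def by (rule nonpower_divided_Xplus[OF \<xi>])
    have \<zeta>': "cnj \<circ> \<zeta> \<in> characters"
      using \<zeta> by (intro character_cnj XplusD) blast
    have "\<phi>1 ^ n * \<zeta> = \<xi> * (\<phi>1 ^ n * (cnj \<circ> \<phi>1) ^ n)"
      unfolding \<zeta>_def by (rule mult.left_commute)
    also have "\<dots> = \<xi>"
      unfolding cnj_power character_inverse[OF \<phi>1_power_character] by (rule mult_1_right)
    finally have "l2_inner M (A (\<phi>1 ^ n)) (cnj \<circ> \<zeta>) = \<mu> \<phi>1 ^ n * a \<xi>"
      using bounded_mu_HankelD(2)[OF A \<phi>1_power_Xplus \<zeta>, of n] semi_character_power[OF \<mu>] by metis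
    then have "cmod (\<mu> \<phi>1) ^ n * cmod (a \<xi>) = cmod (l2_inner M (A (\<phi>1 ^ n)) (cnj \<circ> \<zeta>))"
      by (simp add: norm_mult norm_power)
    also have "\<dots> \<le> l2_norm M (A (\<phi>1 ^ n)) * l2_norm M (cnj \<circ> \<zeta>)"
      by (intro l2_cauchy_schwarz bounded_op_L2[OF bA] Xplus_H2 \<phi>1_power_Xplus character_in_L2 \<zeta>')
    also have "\<dots> \<le> K"
      using K(2)[OF Xplus_H2[OF \<phi>1_power_Xplus], of n] unfolding l2_norm_character[OF \<phi>1_power_character] l2_norm_character[OF \<zeta>'] by simp
    finally show ?thesis .
  qed
  obtain n where "K / cmod (a \<xi>) < cmod (\<mu> \<phi>1) ^ n"
    using real_arch_pow[OF gt] by blast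
  then have "K < cmod (\<mu> \<phi>1) ^ n * cmod (a \<xi>)"
    using a0 by (simp add: divide_less_eq)
  then show False
    using le[of n] by simp
qed

text \<open>
  These are the coefficients of the function representing the bounded functional that takes \<open>f\<close> to
  the inner product of \<open>A f\<close> and \<open>cnj \<circ> \<phi>1\<close>. With \<open>f\<close> a partial sum of the series with these
  coefficients, the value of the functional is the squared norm of \<open>f\<close>, so the norm of \<open>f\<close> is at
  most a bound of \<open>A\<close>.
\<close>

lemma bounded_mu_Hankel_square_summable:
  assumes \<mu>: "semi_character r \<mu>" and A: "bounded_mu_Hankel M r \<mu> a A"
  shows "summable (\<lambda>j. (cmod (cnj (\<mu> \<phi>1 ^ j * a (\<phi>1 ^ Suc j))))\<^sup>2)"
proof -
  define \<beta> where "\<beta> j = cnj (\<mu> \<phi>1 ^ j * a (\<phi>1 ^ Suc j))" for j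
  note bA = bounded_mu_HankelD(1)[OF A]
  obtain K where K: "K \<ge> 0" "\<And>f. f \<in> H2 M r \<Longrightarrow> l2_norm M (A f) \<le> K * l2_norm M f"
    using bounded_op_bound[OF bA] by blast
  have cL: "cnj \<circ> \<phi>1 \<in> characters"
    by (rule character_cnj[OF \<phi>1_character])
  have entry: "l2_inner M (A (\<phi>1 ^ j)) (cnj \<circ> \<phi>1) = cnj (\<beta> j)" for j
  proof -
    have "\<phi>1 \<in> Xplus r - {1}"
      using \<phi>1_Xplus \<phi>1_neq_1 by blast
    from bounded_mu_HankelD(2)[OF A \<phi>1_power_Xplus this, of j] show ?thesis
      unfolding \<beta>_def semi_character_power[OF \<mu>] power_Suc2 by simp
  qed
  have bound: "(\<Sum>j<N. (cmod (\<beta> j))\<^sup>2) \<le> K\<^sup>2" for N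
  proof -
    define f where "f = (\<Sum>j<N. cscale (\<beta> j) (\<phi>1 ^ j))"
    define s where "s = (\<Sum>j<N. (cmod (\<beta> j))\<^sup>2)"
    have f: "f \<in> H2 M r"
      unfolding f_def by (intro H2_sum H2_cscale Xplus_H2 \<phi>1_power_Xplus)
    have s0: "0 \<le> s"
      unfolding s_def by (intro sum_nonneg) simp
    have "(l2_norm M f)\<^sup>2 = s"
      unfolding f_def s_def
      by (rule l2_norm_scaled_pythagoras)
        (simp_all only: character_in_L2[OF \<phi>1_power_character] characters_orthonormal[OF \<phi>1_power_character \<phi>1_power_character] \<phi>1_power_inj finite_lessThan)
    then have nf: "l2_norm M f = sqrt s"
      by (metis l2_norm_nonneg real_sqrt_unique)
    have "l2_inner M (A f) (cnj \<circ> \<phi>1) = (\<Sum>j<N. \<beta> j * l2_inner M (A (\<phi>1 ^ j)) (cnj \<circ> \<phi>1))"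
      unfolding f_def by (rule bounded_op_inner_sum[OF bA Xplus_H2[OF \<phi>1_power_Xplus] character_in_L2[OF cL]]) simp
    also have "\<dots> = of_real s"
      unfolding entry s_def of_real_sum complex_norm_square ..
    finally have "s = cmod (l2_inner M (A f) (cnj \<circ> \<phi>1))"
      using s0 by simp
    also have "\<dots> \<le> l2_norm M (A f) * l2_norm M (cnj \<circ> \<phi>1)"
      by (intro l2_cauchy_schwarz bounded_op_L2[OF bA] f character_in_L2 cL)
    also have "\<dots> \<le> K * sqrt s"
      using K(2)[OF f] unfolding l2_norm_character[OF cL] nf by simp
    finally have le: "sqrt s * sqrt s \<le> K * sqrt s"
      using s0 by simp
    have "sqrt s \<le> K"
    proof (cases "sqrt s = 0")
      case False
      then show ?thesis
        using le s0 mult_le_cancel_right[of "sqrt s" "sqrt s" K] real_sqrt_ge_zero[OF s0] by linarith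
    qed (use K(1) in simp)
    then have "s \<le> K\<^sup>2"
      using s0 real_sqrt_pow2[OF s0] power_mono[of "sqrt s" K 2] by simp
    then show ?thesis
      by (simp only: s_def)
  qed
  have "summable (\<lambda>j. (cmod (\<beta> j))\<^sup>2)"
    by (rule summableI_nonneg_bounded[where x = "K\<^sup>2"]) (use bound in auto)
  then show ?thesis
    by (simp only: \<beta>_def)
qed

lemma power_series_in_H2:
  assumes c: "summable (\<lambda>n. (cmod (c n))\<^sup>2)"
  shows "\<exists>g\<in>H2 M r. (\<forall>k. l2_inner M g (\<phi>1 ^ k) = c k)
    \<and> (\<forall>\<phi>\<in>characters - range (\<lambda>n. \<phi>1 ^ n). l2_inner M g \<phi> = 0) \<and> (l2_norm M g)\<^sup>2 = (\<Sum>n. (cmod (c n))\<^sup>2)"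
proof -
  have orth: "l2_inner M (\<phi>1 ^ m) (\<phi>1 ^ n) = (if m = n then 1 else 0)" for m n
    unfolding characters_orthonormal[OF \<phi>1_power_character \<phi>1_power_character] \<phi>1_power_inj ..
  obtain g where g: "g \<in> L2 M" "(\<lambda>N. l2_norm M ((\<Sum>n<N. cscale (c n) (\<phi>1 ^ n)) - g)) \<longlonglongrightarrow> 0"
    "(l2_norm M g)\<^sup>2 = (\<Sum>n. (cmod (c n))\<^sup>2)"
    using riesz_fischer[OF finite_measure_M character_in_L2[OF \<phi>1_power_character] orth c] by blast
  have lim: "(\<lambda>N. \<Sum>n<N. c n * l2_inner M (\<phi>1 ^ n) h) \<longlonglongrightarrow> l2_inner M g h" if h: "h \<in> L2 M" for h
  proof -
    have "(\<lambda>N. l2_inner M (\<Sum>n<N. cscale (c n) (\<phi>1 ^ n)) h) \<longlonglongrightarrow> l2_inner M g h"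
      by (intro l2_inner_tendsto L2_sum L2_cscale character_in_L2 \<phi>1_power_character g h)
    moreover have "l2_inner M (\<Sum>n<N. cscale (c n) (\<phi>1 ^ n)) h = (\<Sum>n<N. c n * l2_inner M (\<phi>1 ^ n) h)" for N
      by (subst l2_inner_sum_left) (simp_all only: l2_inner_cscale_left L2_cscale character_in_L2 \<phi>1_power_character h)
    ultimately show ?thesis
      by simp
  qed
  have "l2_inner M g (\<phi>1 ^ k) = c k" for k
  proof (rule LIMSEQ_unique[OF lim[OF character_in_L2[OF \<phi>1_power_character]]])
    have "(\<Sum>n<N. c n * l2_inner M (\<phi>1 ^ n) (\<phi>1 ^ k)) = c k" if "N > k" for N
      unfolding orth using that by (simp add: if_distrib[of "\<lambda>x. c _ * x"] sum.delta cong: if_cong)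
    then show "(\<lambda>N. \<Sum>n<N. c n * l2_inner M (\<phi>1 ^ n) (\<phi>1 ^ k)) \<longlonglongrightarrow> c k"
      by (intro tendsto_eventually eventually_sequentiallyI[of "Suc k"]) simp
  qed
  moreover have zero: "l2_inner M g \<phi> = 0" if \<phi>: "\<phi> \<in> characters - range (\<lambda>n. \<phi>1 ^ n)" for \<phi>
  proof -
    have "l2_inner M (\<phi>1 ^ n) \<phi> = 0" for n
      using \<phi> by (subst characters_orthonormal[OF \<phi>1_power_character]) auto
    then show ?thesis
      using lim[OF character_in_L2, of \<phi>] \<phi> by (simp add: LIMSEQ_const_iff)
  qed
  moreover have "g \<in> H2 M r"
  proof (rule H2I[OF g(1)])
    fix \<phi> assume "\<phi> \<in> Xminus r"
    then show "l2_inner M g \<phi> = 0"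
      using \<phi>1_power_Xplus by (intro zero) (auto simp: Xminus_def)
  qed
  ultimately show ?thesis
    using g(3) by blast
qed

lemma supported_in_powers_iff:
  "supported_in_powers r \<phi>1 a \<longleftrightarrow> (\<forall>\<xi>\<in>Xplus r - {1}. \<xi> \<notin> range (\<lambda>n. \<phi>1 ^ n) \<longrightarrow> a \<xi> = 0)"
  unfolding supported_in_powers_def by blast

lemma supported_product:
  assumes a: "supported_in_powers r \<phi>1 a" and \<phi>: "\<phi> \<in> Xplus r" and \<xi>: "\<xi> \<in> Xplus r - {1}"
    and np: "\<xi> \<notin> range (\<lambda>n. \<phi>1 ^ n)"
  shows "a (\<phi> * \<xi>) = 0"
proof -
  have "\<phi> * \<xi> \<notin> range (\<lambda>n. \<phi>1 ^ n)"
    using factor_of_power[OF \<phi>, of \<xi>] \<xi> np by blast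
  then show ?thesis
    using a Xplus_mult_nontrivial[OF \<phi> \<xi>] unfolding supported_in_powers_iff by blast
qed

text \<open>
  Multiplicativity of \<open>\<mu>\<close> turns the coefficients of \<open>\<psi> (Suc k)\<close> into \<open>\<mu> \<phi>1 ^ k\<close> times matrix entries of a
  \<open>\<mu>\<close>-Hankel operator; the scalar factors of the series compensate for this power.
\<close>

lemma has_coefficients_inner:
  assumes \<mu>: "semi_character r \<mu>" and coeff: "has_coefficients M r \<mu> a \<phi>1 \<psi>" and gt: "cmod (\<mu> \<phi>1) > 1"
    and \<phi>: "\<phi> \<in> Xplus r"
  shows "(1 / \<mu> \<phi>1) ^ k * l2_inner M \<phi> (\<psi> (Suc k)) = \<mu> \<phi> * a (\<phi> * \<phi>1 ^ Suc k)"
proof -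
  have "l2_inner M (\<psi> (Suc k)) \<phi> = cnj (\<mu> (\<phi>1 ^ k * \<phi>) * a (\<phi>1 ^ Suc k * \<phi>))"
    using coeff \<phi> unfolding has_coefficients_def by (metis diff_Suc_1 le_add1 plus_1_eq_Suc)
  then have "l2_inner M \<phi> (\<psi> (Suc k)) = \<mu> (\<phi>1 ^ k * \<phi>) * a (\<phi>1 ^ Suc k * \<phi>)"
    by (subst l2_inner_commute) (simp only: complex_cnj_cnj)
  also have "\<dots> = \<mu> \<phi>1 ^ k * \<mu> \<phi> * a (\<phi> * \<phi>1 ^ Suc k)"
    unfolding semi_character_mult[OF \<mu> \<phi>1_power_Xplus \<phi>] semi_character_power[OF \<mu>] mult.commute[of "\<phi>1 ^ Suc k" \<phi>] ..
  finally have "(1 / \<mu> \<phi>1) ^ k * l2_inner M \<phi> (\<psi> (Suc k)) = ((1 / \<mu> \<phi>1) ^ k * \<mu> \<phi>1 ^ k) * (\<mu> \<phi> * a (\<phi> * \<phi>1 ^ Suc k))"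
    by (simp only: mult.assoc)
  moreover have "(1 / \<mu> \<phi>1) ^ k * \<mu> \<phi>1 ^ k = 1"
    using gt by (auto simp flip: power_mult_distrib)
  ultimately show ?thesis
    by simp
qed

text \<open>
  Since \<open>a\<close> vanishes off the powers of \<open>\<phi>1\<close>, the prescribed coefficients of \<open>\<psi> n\<close> vanish off these
  powers as well, and on \<open>\<phi>1 ^ k\<close> they form the sequence \<open>\<beta>\<close> shifted by \<open>n - 1\<close>. Therefore
  \<open>\<psi> n\<close> exists by square summability of \<open>\<beta>\<close>, and its norm is at most that of \<open>\<psi> 1\<close>. The adjoint
  of \<open>A\<close> maps \<open>(cnj \<circ> \<phi>1) ^ n\<close> to a multiple of \<open>\<psi> n\<close> and annihilates the remaining negative
  characters; this is the expansion of \<open>A f\<close> in its Fourier series.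
\<close>

theorem bounded_mu_Hankel_expansion:
  assumes \<mu>: "semi_character r \<mu>" and A: "bounded_mu_Hankel M r \<mu> a A" and gt: "cmod (\<mu> \<phi>1) > 1"
  shows "\<exists>\<psi>. bounded_H2_sequence M r \<psi> \<and> has_coefficients M r \<mu> a \<phi>1 \<psi> \<and>
      op_sums M (H2 M r) (series_term M \<mu> \<phi>1 \<psi>) A \<and>
      op_norm M (H2 M r) A \<le> cmod (\<mu> \<phi>1) * l2_norm M (\<psi> 1) / (cmod (\<mu> \<phi>1) - 1)"
    and "A ` H2 M r \<subseteq> H2_cnj M \<phi>1"
    and "supported_in_powers r \<phi>1 a"
    and "nuclear_op M (H2 M r) (H2minus M r) A"
proof -
  note bA = bounded_mu_HankelD(1)[OF A]
  show supp: "supported_in_powers r \<phi>1 a"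
    unfolding supported_in_powers_iff using bounded_mu_Hankel_supported[OF \<mu> A gt] by blast

  define \<beta> where "\<beta> j = cnj (\<mu> \<phi>1 ^ j * a (\<phi>1 ^ Suc j))" for j
  have \<beta>: "summable (\<lambda>j. (cmod (\<beta> j))\<^sup>2)"
    unfolding \<beta>_def by (rule bounded_mu_Hankel_square_summable[OF \<mu> A])
  have "\<forall>n. \<exists>g\<in>H2 M r. (\<forall>k. l2_inner M g (\<phi>1 ^ k) = \<beta> (k + n))
      \<and> (\<forall>\<phi>\<in>characters - range (\<lambda>n. \<phi>1 ^ n). l2_inner M g \<phi> = 0)
      \<and> (l2_norm M g)\<^sup>2 = (\<Sum>k. (cmod (\<beta> (k + n)))\<^sup>2)"
    using power_series_in_H2[OF summable_ignore_initial_segment[OF \<beta>]] by blast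
  then obtain g where g: "\<And>n. g n \<in> H2 M r" "\<And>n k. l2_inner M (g n) (\<phi>1 ^ k) = \<beta> (k + n)"
    "\<And>n \<phi>. \<phi> \<in> characters - range (\<lambda>n. \<phi>1 ^ n) \<Longrightarrow> l2_inner M (g n) \<phi> = 0"
    "\<And>n. (l2_norm M (g n))\<^sup>2 = (\<Sum>k. (cmod (\<beta> (k + n)))\<^sup>2)"
    by metis
  define \<psi> where "\<psi> n = g (n - 1)" for n
  have \<psi>: "\<psi> n \<in> H2 M r" for n
    unfolding \<psi>_def by (rule g(1))
  have \<psi>_le: "l2_norm M (\<psi> n) \<le> l2_norm M (\<psi> 1)" for n
  proof (rule power2_le_imp_le)
    have "(\<Sum>k. (cmod (\<beta> (k + (n - 1))))\<^sup>2) \<le> (\<Sum>k. (cmod (\<beta> k))\<^sup>2)"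
      using suminf_split_initial_segment[OF \<beta>, of "n - 1"] sum_nonneg[of "{..<n - 1}" "\<lambda>k. (cmod (\<beta> k))\<^sup>2"] by simp
    then show "(l2_norm M (\<psi> n))\<^sup>2 \<le> (l2_norm M (\<psi> 1))\<^sup>2"
      by (simp add: \<psi>_def g(4))
  qed simp
  have bdd: "bounded_H2_sequence M r \<psi>"
    unfolding bounded_H2_sequence_def using \<psi> \<psi>_le by blast

  have coeff: "has_coefficients M r \<mu> a \<phi>1 \<psi>"
    unfolding has_coefficients_def
  proof (intro allI impI ballI)
    fix n :: nat and \<phi> assume n: "n \<ge> 1" and \<phi>: "\<phi> \<in> Xplus r"
    show "l2_inner M (\<psi> n) \<phi> = cnj (\<mu> (\<phi>1 ^ (n - 1) * \<phi>) * a (\<phi>1 ^ n * \<phi>))"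
    proof (cases "\<phi> \<in> range (\<lambda>n. \<phi>1 ^ n)")
      case True
      then obtain k where k: "\<phi> = \<phi>1 ^ k"
        by blast
      have "\<phi>1 ^ (n - 1) * \<phi> = \<phi>1 ^ (k + (n - 1))" "\<phi>1 ^ n * \<phi> = \<phi>1 ^ Suc (k + (n - 1))"
        unfolding k power_add[symmetric] using n by (simp_all add: add.commute)
      then show ?thesis
        unfolding \<psi>_def using g(2)[of "n - 1" k] semi_character_power[OF \<mu>] by (simp only: k \<beta>_def)
    next
      case False
      have "\<phi>1 ^ n \<in> Xplus r" "\<phi> \<in> Xplus r - {1}"
        using \<phi>1_power_Xplus \<phi> False power_0[of \<phi>1] by (blast, metis DiffI rangeI singletonD)
      then have "a (\<phi>1 ^ n * \<phi>) = 0"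
        using supported_product[OF supp _ _ False] by blast
      moreover have "l2_inner M (\<psi> n) \<phi> = 0"
        unfolding \<psi>_def using False XplusD(1)[OF \<phi>] by (intro g(3)) blast
      ultimately show ?thesis
        by simp
    qed
  qed

  have powers: "l2_inner M (A f) ((cnj \<circ> \<phi>1) ^ Suc k) = (1 / \<mu> \<phi>1) ^ k * l2_inner M f (\<psi> (Suc k))"
    if f: "f \<in> H2 M r" for f k
  proof -
    define \<psi>' where "\<psi>' = cscale (cnj ((1 / \<mu> \<phi>1) ^ k)) (\<psi> (Suc k))"
    have inner: "l2_inner M h \<psi>' = (1 / \<mu> \<phi>1) ^ k * l2_inner M h (\<psi> (Suc k))" for h
      by (simp only: \<psi>'_def l2_inner_cscale_right complex_cnj_cnj)
    have ne: "\<phi>1 ^ Suc k \<in> Xplus r - {1}"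
      using \<phi>1_power_Xplus[of "Suc k"] \<phi>1_power_eq_1_iff[of "Suc k"] by blast
    have "l2_inner M (A f) ((cnj \<circ> \<phi>1) ^ Suc k) = l2_inner M f \<psi>'"
    proof (rule bounded_op_inner_eqI[OF bA character_in_L2[OF cnj_power_character] _ _ f])
      show "\<psi>' \<in> L2 M"
        unfolding \<psi>'_def by (intro L2_cscale H2_L2 \<psi>)
      show "l2_inner M (A \<phi>) ((cnj \<circ> \<phi>1) ^ Suc k) = l2_inner M \<phi> \<psi>'" if \<phi>: "\<phi> \<in> Xplus r" for \<phi>
        unfolding inner has_coefficients_inner[OF \<mu> coeff gt \<phi>] cnj_power by (rule bounded_mu_HankelD(2)[OF A \<phi> ne])
    qed
    then show ?thesis
      unfolding inner .
  qed

  have nonpowers: "l2_inner M (A f) (cnj \<circ> \<xi>) = 0"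
    if f: "f \<in> H2 M r" and \<xi>: "\<xi> \<in> Xplus r - {1}" "\<xi> \<notin> range (\<lambda>n. \<phi>1 ^ n)" for f \<xi>
  proof -
    have \<xi>L: "cnj \<circ> \<xi> \<in> L2 M"
      using \<xi>(1) by (intro character_in_L2 character_cnj XplusD) blast
    have "l2_inner M (A f) (cnj \<circ> \<xi>) = l2_inner M f 0"
    proof (rule bounded_op_inner_eqI[OF bA \<xi>L L2_zero _ f])
      show "l2_inner M (A \<phi>) (cnj \<circ> \<xi>) = l2_inner M \<phi> 0" if \<phi>: "\<phi> \<in> Xplus r" for \<phi>
        unfolding bounded_mu_HankelD(2)[OF A \<phi> \<xi>(1)] supported_product[OF supp \<phi> \<xi>] by simp
    qed
    then show ?thesis
      by simp
  qed

  \<comment> \<open>All Fourier coefficients of \<open>A f\<close> and of the series agree, so they are equal in the space \<open>L\<^sup>2\<close>.\<close>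
  have eq: "l2_norm M (A f - hankel_series (\<mu> \<phi>1) \<psi> f) = 0" if f: "f \<in> H2 M r" for f
  proof (rule L2_eq_0_if_orthogonal_to_characters)
    have AL: "A f \<in> L2 M" and BL: "hankel_series (\<mu> \<phi>1) \<psi> f \<in> L2 M"
      and BH: "hankel_series (\<mu> \<phi>1) \<psi> f \<in> H2minus M r"
      by (rule bounded_op_L2[OF bA f], rule hankel_series_L2[of \<mu> \<psi>, OF gt \<psi> \<psi>_le H2_L2[OF f]],
          rule hankel_series_H2minus[of \<mu> \<psi>, OF gt \<psi> \<psi>_le H2_L2[OF f]])
    show "A f - hankel_series (\<mu> \<phi>1) \<psi> f \<in> L2 M"
      by (rule L2_diff[OF AL BL])
    fix \<phi> :: "'g \<Rightarrow> complex" assume \<phi>: "\<phi> \<in> characters"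
    have "l2_inner M (A f) \<phi> = l2_inner M (hankel_series (\<mu> \<phi>1) \<psi> f) \<phi>"
    proof (cases "\<phi> \<in> Xplus r")
      case True
      then show ?thesis
        using Xplus_H2 bounded_op_H2minus[OF bA f] BH unfolding H2minus_def by simp
    next
      case False
      then have \<phi>m: "\<phi> \<in> Xminus r"
        using \<phi> by (simp add: Xminus_def)
      define \<xi> where "\<xi> = cnj \<circ> \<phi>"
      have \<xi>: "\<xi> \<in> Xplus r - {1}" "\<phi> = cnj \<circ> \<xi>"
        using Xminus_cnj_Xplus[OF \<phi>m] unfolding \<xi>_def cnj_cnj_comp by simp_all
      show ?thesis
      proof (cases "\<xi> \<in> range (\<lambda>n. \<phi>1 ^ n)")
        case True
        then obtain k where k: "\<xi> = \<phi>1 ^ k"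
          by blast
        then have "k \<noteq> 0"
          using \<xi>(1) \<phi>1_power_eq_1_iff[of k] by blast
        then obtain k' where "\<phi> = (cnj \<circ> \<phi>1) ^ Suc k'"
          unfolding \<xi>(2) k cnj_power by (metis not0_implies_Suc)
        then show ?thesis
          using powers[OF f] hankel_series_coefficient[of \<mu> \<psi>, OF gt \<psi> \<psi>_le H2_L2[OF f]] by metis
      next
        case False
        have "\<phi> \<noteq> (cnj \<circ> \<phi>1) ^ Suc n" for n
          unfolding \<xi>(2) cnj_power cnj_comp_eq_iff using False by blast
        then have "l2_inner M ((cnj \<circ> \<phi>1) ^ Suc n) \<phi> = 0" for n
          unfolding characters_orthonormal[OF cnj_power_character \<phi>] by metis
        then have "l2_inner M (hankel_series (\<mu> \<phi>1) \<psi> f) \<phi> = 0"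
          by (rule hankel_series_orthogonal[of \<mu> \<psi>, OF gt \<psi> \<psi>_le H2_L2[OF f] character_in_L2[OF \<phi>]])
        then show ?thesis
          using nonpowers[OF f \<xi>(1) False] unfolding \<xi>(2) by simp
      qed
    qed
    then show "l2_inner M (A f - hankel_series (\<mu> \<phi>1) \<psi> f) \<phi> = 0"
      using l2_inner_diff_left[OF AL BL character_in_L2[OF \<phi>]] by simp
  qed

  note concl = op_sums_if_AE_eq[of \<mu> \<psi>, OF gt \<psi> \<psi>_le bA eq]
  show "\<exists>\<psi>. bounded_H2_sequence M r \<psi> \<and> has_coefficients M r \<mu> a \<phi>1 \<psi> \<and>
      op_sums M (H2 M r) (series_term M \<mu> \<phi>1 \<psi>) A \<and>
      op_norm M (H2 M r) A \<le> cmod (\<mu> \<phi>1) * l2_norm M (\<psi> 1) / (cmod (\<mu> \<phi>1) - 1)"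
    using bdd coeff concl(1,2) by blast
  show "nuclear_op M (H2 M r) (H2minus M r) A"
    by (rule nuclear_if_op_sums[of \<mu> \<psi>, OF gt \<psi> \<psi>_le bA concl(1)])
  show "A ` H2 M r \<subseteq> H2_cnj M \<phi>1"
  proof
    fix w assume "w \<in> A ` H2 M r"
    then obtain f where f: "f \<in> H2 M r" and w: "w = A f"
      by blast
    have "\<exists>p\<in>cfun.span {(cnj \<circ> \<phi>1) ^ n |n. n \<ge> 1}. l2_norm M (A f - p) < e" if "e > 0" for e
    proof -
      have "\<forall>\<^sub>F N in sequentially. l2_norm M (A f - (\<Sum>n=1..N. series_term M \<mu> \<phi>1 \<psi> n f)) < e"
        by (rule order_tendstoD(2)[OF concl(3)[OF _ f] that])
      then obtain N where N: "l2_norm M (A f - (\<Sum>n=1..N. series_term M \<mu> \<phi>1 \<psi> n f)) < e"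
        by (auto simp only: eventually_sequentially)
      have "(\<Sum>n=1..N. series_term M \<mu> \<phi>1 \<psi> n f) \<in> cfun.span {(cnj \<circ> \<phi>1) ^ n |n. n \<ge> 1}"
        unfolding series_term_def rank_one_def
        by (intro cfun.span_sum cfun.span_scale cfun.span_base) auto
      then show ?thesis
        using N by blast
    qed
    then show "w \<in> H2_cnj M \<phi>1"
      unfolding w H2_cnj_def closed_span_def using bounded_op_L2[OF bA f] by blast
  qed
qed

text \<open>
  The matrix entries of the sum of the series at \<open>cnj \<circ> \<xi>\<close> are given by the coefficients of
  \<open>\<psi> n\<close> if \<open>\<xi> = \<phi>1 ^ n\<close>. For all other \<open>\<xi>\<close> they are zero, as are the numbers \<open>a (\<phi> * \<xi>)\<close>: a
  multiple of a non-power by a positive character is not a power.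
\<close>

theorem hankel_series_is_mu_Hankel:
  assumes bdd: "bounded_H2_sequence M r \<psi>" and \<mu>: "semi_character r \<mu>" and gt: "cmod (\<mu> \<phi>1) > 1"
    and supp: "supported_in_powers r \<phi>1 a" and coeff: "has_coefficients M r \<mu> a \<phi>1 \<psi>"
  shows "\<exists>A. bounded_op M (H2 M r) (H2minus M r) A \<and> op_sums M (H2 M r) (series_term M \<mu> \<phi>1 \<psi>) A"
    and "bounded_op M (H2 M r) (H2minus M r) A \<Longrightarrow> op_sums M (H2 M r) (series_term M \<mu> \<phi>1 \<psi>) A \<Longrightarrow>
      nuclear_op M (H2 M r) (H2minus M r) A \<and> bounded_mu_Hankel M r \<mu> a A"
proof -
  obtain C where \<psi>: "\<And>n. n \<ge> 1 \<Longrightarrow> \<psi> n \<in> H2 M r" and C: "\<And>n. n \<ge> 1 \<Longrightarrow> l2_norm M (\<psi> n) \<le> C"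
    using bdd unfolding bounded_H2_sequence_def by blast
  note B = hankel_series_bounded_op[of \<mu> \<psi> C, OF gt \<psi> C]
  have "op_sums M (H2 M r) (series_term M \<mu> \<phi>1 \<psi>) (hankel_series (\<mu> \<phi>1) \<psi>)"
    by (rule op_sums_if_AE_eq(1)[of \<mu> \<psi> C, OF gt \<psi> C B]) simp_all
  then show "\<exists>A. bounded_op M (H2 M r) (H2minus M r) A \<and> op_sums M (H2 M r) (series_term M \<mu> \<phi>1 \<psi>) A"
    using B by blast
  assume A: "bounded_op M (H2 M r) (H2minus M r) A" and sums: "op_sums M (H2 M r) (series_term M \<mu> \<phi>1 \<psi>) A"
  have entry: "l2_inner M (A \<phi>) (cnj \<circ> \<xi>) = \<mu> \<phi> * a (\<phi> * \<xi>)" if \<phi>: "\<phi> \<in> Xplus r" and \<xi>: "\<xi> \<in> Xplus r - {1}" for \<phi> \<xi>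
  proof -
    have \<phi>L: "\<phi> \<in> L2 M" and \<xi>c: "cnj \<circ> \<xi> \<in> characters"
      using \<phi> \<xi> by (auto intro: character_in_L2 character_cnj XplusD)
    have "l2_inner M (A \<phi>) (cnj \<circ> \<xi>) = l2_inner M (hankel_series (\<mu> \<phi>1) \<psi> \<phi>) (cnj \<circ> \<xi>)"
      by (rule op_sums_at_character[of \<mu> \<psi> C, OF gt \<psi> C A sums \<phi> character_in_L2[OF \<xi>c]])
    also have "\<dots> = \<mu> \<phi> * a (\<phi> * \<xi>)"
    proof (cases "\<xi> \<in> range (\<lambda>n. \<phi>1 ^ n)")
      case True
      then obtain k where k: "\<xi> = \<phi>1 ^ k"
        by blast
      then have "k \<noteq> 0"
        using \<xi> \<phi>1_power_eq_1_iff[of k] by blast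
      then obtain k' where k': "k = Suc k'"
        using not0_implies_Suc by blast
      have "l2_inner M (hankel_series (\<mu> \<phi>1) \<psi> \<phi>) (cnj \<circ> \<xi>)
          = l2_inner M (hankel_series (\<mu> \<phi>1) \<psi> \<phi>) ((cnj \<circ> \<phi>1) ^ Suc k')"
        unfolding k k' cnj_power ..
      also have "\<dots> = (1 / \<mu> \<phi>1) ^ k' * l2_inner M \<phi> (\<psi> (Suc k'))"
        by (rule hankel_series_coefficient[of \<mu> \<psi> C, OF gt \<psi> C \<phi>L])
      also have "\<dots> = \<mu> \<phi> * a (\<phi> * \<phi>1 ^ Suc k')"
        by (rule has_coefficients_inner[OF \<mu> coeff gt \<phi>])
      finally show ?thesis
        unfolding k k' .
    next
      case False
      have "l2_inner M ((cnj \<circ> \<phi>1) ^ Suc n) (cnj \<circ> \<xi>) = 0" for n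
      proof -
        have "(cnj \<circ> \<phi>1) ^ Suc n \<noteq> cnj \<circ> \<xi>"
          unfolding cnj_power cnj_comp_eq_iff using False by blast
        then show ?thesis
          unfolding characters_orthonormal[OF cnj_power_character \<xi>c] by (rule if_not_P)
      qed
      then have "l2_inner M (hankel_series (\<mu> \<phi>1) \<psi> \<phi>) (cnj \<circ> \<xi>) = 0"
        by (intro hankel_series_orthogonal[of \<mu> \<psi> C, OF gt \<psi> C \<phi>L character_in_L2[OF \<xi>c]])
      then show ?thesis
        unfolding supported_product[OF supp \<phi> \<xi> False] by simp
    qed
    finally show ?thesis .
  qed
  have "bounded_mu_Hankel M r \<mu> a A"
    unfolding bounded_mu_Hankel_def mu_Hankel_def
    using H2_subspace span_Xplus_H2 A entry unfolding bounded_op_def by blast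
  then show "nuclear_op M (H2 M r) (H2minus M r) A \<and> bounded_mu_Hankel M r \<mu> a A"
    using nuclear_if_op_sums[of \<mu> \<psi> C, OF gt \<psi> C A sums] by blast
qed

end

theorem theorem12:
  fixes M :: "'g::{topological_ab_group_add,t2_space} measure"
    and r :: "('g \<Rightarrow> complex) rel"
    and \<phi>1 :: "'g \<Rightarrow> complex"
  assumes "compact (UNIV :: 'g set)"
    and "connected (UNIV :: 'g set)"
    and "normalized_haar M"
    and "dual_order r"
    and "first_positive r \<phi>1"
  shows
    "(\<forall>\<mu> a A.
        semi_character r \<mu> \<and> bounded_mu_Hankel M r \<mu> a A \<and> cmod (\<mu> \<phi>1) > 1 \<longrightarrow>
        (\<exists>\<psi>. bounded_H2_sequence M r \<psi> \<and>
             has_coefficients M r \<mu> a \<phi>1 \<psi> \<and>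
             op_sums M (H2 M r) (series_term M \<mu> \<phi>1 \<psi>) A \<and>
             op_norm M (H2 M r) A \<le> cmod (\<mu> \<phi>1) * l2_norm M (\<psi> 1) / (cmod (\<mu> \<phi>1) - 1)) \<and>
        A ` H2 M r \<subseteq> H2_cnj M \<phi>1 \<and>
        supported_in_powers r \<phi>1 a \<and>
        nuclear_op M (H2 M r) (H2minus M r) A) \<and>
     (\<forall>\<mu> a \<psi>.
        bounded_H2_sequence M r \<psi> \<and>
        semi_character r \<mu> \<and> cmod (\<mu> \<phi>1) > 1 \<and>
        supported_in_powers r \<phi>1 a \<and>
        has_coefficients M r \<mu> a \<phi>1 \<psi> \<longrightarrow>
        (\<exists>A. bounded_op M (H2 M r) (H2minus M r) A \<and>
             op_sums M (H2 M r) (series_term M \<mu> \<phi>1 \<psi>) A) \<and>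
        (\<forall>A. bounded_op M (H2 M r) (H2minus M r) A \<and>
             op_sums M (H2 M r) (series_term M \<mu> \<phi>1 \<psi>) A \<longrightarrow>
             nuclear_op M (H2 M r) (H2minus M r) A \<and>
             bounded_mu_Hankel M r \<mu> a A))"
proof -
  interpret ordered_dual_group M r \<phi>1
    by unfold_locales (use assms in blast)+
  show ?thesis
  proof (intro conjI allI impI; elim conjE)
    fix \<mu> a A
    assume *: "semi_character r \<mu>" "bounded_mu_Hankel M r \<mu> a A" "cmod (\<mu> \<phi>1) > 1"
    note expansion = bounded_mu_Hankel_expansion[OF *]
    show "\<exists>\<psi>. bounded_H2_sequence M r \<psi> \<and>
             has_coefficients M r \<mu> a \<phi>1 \<psi> \<and>
             op_sums M (H2 M r) (series_term M \<mu> \<phi>1 \<psi>) A \<and>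
             op_norm M (H2 M r) A \<le> cmod (\<mu> \<phi>1) * l2_norm M (\<psi> 1) / (cmod (\<mu> \<phi>1) - 1)"
      by (rule expansion(1))
    show "A ` H2 M r \<subseteq> H2_cnj M \<phi>1" "supported_in_powers r \<phi>1 a"
      "nuclear_op M (H2 M r) (H2minus M r) A"
      by (rule expansion(2), rule expansion(3), rule expansion(4))
  next
    fix \<mu> a \<psi>
    assume *: "bounded_H2_sequence M r \<psi>" "semi_character r \<mu>" "cmod (\<mu> \<phi>1) > 1"
      "supported_in_powers r \<phi>1 a" "has_coefficients M r \<mu> a \<phi>1 \<psi>"
    note converse = hankel_series_is_mu_Hankel[OF *]
    show "\<exists>A. bounded_op M (H2 M r) (H2minus M r) A \<and>
             op_sums M (H2 M r) (series_term M \<mu> \<phi>1 \<psi>) A"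
      by (rule converse(1))
    fix A assume "bounded_op M (H2 M r) (H2minus M r) A" "op_sums M (H2 M r) (series_term M \<mu> \<phi>1 \<psi>) A"
    from converse(2)[OF this] show "nuclear_op M (H2 M r) (H2minus M r) A" "bounded_mu_Hankel M r \<mu> a A"
      by blast+
  qed
qed

end
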